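(* There exist absolute constants $A,B,p,\varepsilon_0>0$ such that the following holds. Let $0<\varepsilon<1/2$, let $k\ge1$ be an integer and $q$ a prime power, and let $$n=\left\lceil \frac{B\,k\,\log(q)\,\log^5(1/\varepsilon)}{\min\{\varepsilon,\ q\varepsilon^2\}}\right\rceil .$$ Let $G\in\mathbb{F}_q^{k\times n}$ be a uniformly random matrix and let $\mathcal{C}=\{x^TG : x\in\mathbb{F}_q^k\}\subseteq\mathbb{F}_q^n$ be the corresponding random linear code. Then: (1) with probability at least $p$, $\mathcal{C}$ has dimension $k$ (hence rate $k/n=\Omega\!\left(\frac{\min\{\varepsilon,q\varepsilon^2\}}{\log(q)\log^5(1/\varepsilon)}\right)$) and is $\left(1-\frac1q-A\varepsilon,\ \frac{2}{\varepsilon^2}\right)$-list decodable; (2) if moreover $q>1/\varepsilon^2$ and $\varepsilon\le\varepsilon_0$, then with probability at least $p$, $\mathcal{C}$ has dimension $k$ and is $\left(1-\frac1q-A\varepsilon,\ \frac1\varepsilon\right)$-list decodable.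
   Context: $d$ denotes relative Hamming distance on $\mathbb{F}_q^n$ (fraction of coordinates that differ). A code $\mathcal{C}\subseteq\mathbb{F}_q^n$ is $(\rho,\ell)$-list decodable if for every $z\in\mathbb{F}_q^n$ the number of codewords $c\in\mathcal{C}$ with $d(z,c)\le\rho$ is at most $\ell$. The rate of a linear code $\mathcal{C}\subseteq\mathbb{F}_q^n$ is $\dim(\mathcal{C})/n$. $\log$ is the logarithm base $2$ and $\log^5(x)=(\log x)^5$. The implied constant in $\Omega$ is absolute. *)

theory Defs
  imports
    "HOL-Probability.Probability"
    "HOL-Number_Theory.Prime_Powers"
    "Jordan_Normal_Form.Missing_VectorSpace"
begin

text \<open>
  The finite field is a field structure \<open>F\<close> in the sense of HOL-Algebra.
  Results with constants independent of the field quantify over all such structures with carrier in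
  one fixed infinite type, namely \<open>nat\<close>; every finite field is isomorphic to one of these.  Vectors in \<open>F^n\<close> are
  functions on the index set \<open>{..<n}\<close>, extended by \<open>undefined\<close> outside of it, so that equality of
  functions is equality of vectors; \<open>k \<times> n\<close> matrices are treated in the same way.
\<close>

definition vectors :: "('a, 'b) ring_scheme \<Rightarrow> nat \<Rightarrow> (nat \<Rightarrow> 'a) set" where
  "vectors F n = {..<n} \<rightarrow>\<^sub>E carrier F"

definition matrices :: "('a, 'b) ring_scheme \<Rightarrow> nat \<Rightarrow> nat \<Rightarrow> (nat \<times> nat \<Rightarrow> 'a) set" where
  "matrices F k n = {..<k} \<times> {..<n} \<rightarrow>\<^sub>E carrier F"

definition vec_mat_mult ::
  "('a, 'b) ring_scheme \<Rightarrow> nat \<Rightarrow> nat \<Rightarrow> (nat \<Rightarrow> 'a) \<Rightarrow> (nat \<times> nat \<Rightarrow> 'a) \<Rightarrow> nat \<Rightarrow> 'a" where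
  "vec_mat_mult F k n x G = (\<lambda>j\<in>{..<n}. \<Oplus>\<^bsub>F\<^esub>i\<in>{..<k}. x i \<otimes>\<^bsub>F\<^esub> G (i, j))"

definition linear_code ::
  "('a, 'b) ring_scheme \<Rightarrow> nat \<Rightarrow> nat \<Rightarrow> (nat \<times> nat \<Rightarrow> 'a) \<Rightarrow> (nat \<Rightarrow> 'a) set" where
  "linear_code F k n G = {vec_mat_mult F k n x G | x. x \<in> vectors F k}"

definition code_dim :: "('a, 'b) ring_scheme \<Rightarrow> nat \<Rightarrow> (nat \<Rightarrow> 'a) set \<Rightarrow> nat" where
  "code_dim F n C = vectorspace.dim F ((ring.func_space F {..<n})\<lparr>carrier := C\<rparr>)"

definition code_rate :: "('a, 'b) ring_scheme \<Rightarrow> nat \<Rightarrow> (nat \<Rightarrow> 'a) set \<Rightarrow> real" where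
  "code_rate F n C = real (code_dim F n C) / real n"

definition rel_hamming_dist :: "nat \<Rightarrow> (nat \<Rightarrow> 'a) \<Rightarrow> (nat \<Rightarrow> 'a) \<Rightarrow> real" where
  "rel_hamming_dist n x y = real (card {i\<in>{..<n}. x i \<noteq> y i}) / real n"

definition list_decodable ::
  "('a, 'b) ring_scheme \<Rightarrow> nat \<Rightarrow> (nat \<Rightarrow> 'a) set \<Rightarrow> real \<Rightarrow> real \<Rightarrow> bool" where
  "list_decodable F n C \<rho> L \<longleftrightarrow>
    (\<forall>z\<in>vectors F n. real (card {c\<in>C. rel_hamming_dist n z c \<le> \<rho>}) \<le> L)"

definition random_matrix :: "('a, 'b) ring_scheme \<Rightarrow> nat \<Rightarrow> nat \<Rightarrow> (nat \<times> nat \<Rightarrow> 'a) pmf" where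
  "random_matrix F k n = pmf_of_set (matrices F k n)"

definition block_length :: "real \<Rightarrow> nat \<Rightarrow> nat \<Rightarrow> real \<Rightarrow> nat" where
  "block_length B k q \<epsilon> =
    nat \<lceil>B * real k * log 2 (real q) * (log 2 (1 / \<epsilon>)) ^ 5 / min \<epsilon> (real q * \<epsilon>\<^sup>2)\<rceil>"

end

(* A list of L messages defeats the code at a word z only if the sum over the columns j of G of
   the plurality of the list at j (the largest number of its codewords sharing a symbol there) is
   at least n L (1/q + A eps).  Since two distinct messages collide at a random column with
   probability at most 1/q, the expected plurality is at most L/q + sqrt L, and at most 5 if
   q > 1/eps^2 and L <= 2/eps; so it suffices that the sum concentrates around its mean
   simultaneously for all lists.  Dependent messages rule out a union bound with
   exponential tails for a single list.  Instead one passes from the list to random sublists,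
   halving it repeatedly: the step at a sublist of size s is paid for by a union bound over
   about |F|^(k s) pairs, weighted by L/s, and replaces the plurality X by 2 X', where the
   difference is of order sqrt X up to logarithms as soon as X exceeds a threshold
   K ~ log(1/eps); pluralities are cut off below that threshold.  In place of symmetrization, the
   self-normalized bound E exp(c D - c^2 D^2) <= 1 + c E D + c^2 E D^2 controls sums of the
   (unbounded) differences D by their empirical second moments, so that one good chain of
   sublists can be chosen after the matrix is revealed. *)

theory Submission
  imports Defs
begin

section \<open>Averages and self-normalized tails\<close>

text \<open>The empirical second moments in the self-normalized bound are not known beforehand:
  along a chain they are controlled only by the pluralities of the full list, whose sum x is the
  quantity to be bounded. The result is therefore an implicit inequality x <= E + r (x + E) + error,
  with E the bound on the mean. It can be solved for x because the parameter \<gamma> of the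
  exponential moment, fixed before the matrix is drawn, can be chosen with r <= 1/2.

  The length that this requires is of order T^2 K^2 ln(q^k) (1/q + \<epsilon>) / \<epsilon>^2, for T
  levels. Halving a list of about 1/\<epsilon>^2 messages takes T <= 3 l levels, l =
  log(1/\<epsilon>), and the threshold is K = 20 l, whence a factor (60 l^2)^2; the last fraction is
  at most 2 / min(\<epsilon>, q \<epsilon>^2).

  Probabilities are averages over finite products, with one factor for each column, so that
  independence becomes the product rule for sums.\<close>

definition avg :: "'a set \<Rightarrow> ('a \<Rightarrow> real) \<Rightarrow> real" where
  "avg S f = (\<Sum>x\<in>S. f x) / real (card S)"

lemma avg_add: "avg S (\<lambda>x. f x + g x) = avg S f + avg S g"
  by (simp add: avg_def sum.distrib add_divide_distrib)

lemma avg_diff: "avg S (\<lambda>x. f x - g x) = avg S f - avg S g"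
  by (simp add: avg_def sum_subtractf diff_divide_distrib)

lemma avg_cmult: "avg S (\<lambda>x. c * f x) = c * avg S f"
  by (simp add: avg_def sum_distrib_left)

lemma avg_divide: "avg S (\<lambda>x. f x / c) = avg S f / c"
  using avg_cmult[of S "1/c" f] by simp

lemma avg_sum: "avg S (\<lambda>x. \<Sum>i\<in>I. f i x) = (\<Sum>i\<in>I. avg S (f i))"
  by (simp add: avg_def sum.swap[of _ I S] sum_divide_distrib)

lemma avg_swap: "avg S (\<lambda>x. avg R (f x)) = avg R (\<lambda>y. avg S (\<lambda>x. f x y))"
  by (simp add: avg_def sum.swap[of _ S R] sum_divide_distrib mult.commute)

lemma avg_const: "finite S \<Longrightarrow> S \<noteq> {} \<Longrightarrow> avg S (\<lambda>_. c) = c"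
  by (simp add: avg_def)

lemma avg_mono: "(\<And>x. x \<in> S \<Longrightarrow> f x \<le> g x) \<Longrightarrow> avg S f \<le> avg S g"
  by (simp add: avg_def divide_right_mono sum_mono)

lemma avg_cong: "(\<And>x. x \<in> S \<Longrightarrow> f x = g x) \<Longrightarrow> avg S f = avg S g"
  by (simp add: avg_def)

lemma avg_nonneg: "(\<And>x. x \<in> S \<Longrightarrow> 0 \<le> f x) \<Longrightarrow> 0 \<le> avg S f"
  by (simp add: avg_def sum_nonneg)

text \<open>Independence of the coordinates of a uniform point of a product. It serves both for the
  columns of the matrix and for the labels that select random sublists.\<close>

lemma avg_PiE_prod:
  assumes "finite I" "finite S"
  shows "avg (I \<rightarrow>\<^sub>E S) (\<lambda>w. \<Prod>i\<in>I. f i (w i)) = (\<Prod>i\<in>I. avg S (f i))"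
  using assms by (simp add: avg_def card_PiE prod_dividef prod_sum_PiE)

lemma avg_PiE_exp_sum:
  assumes "finite I" "finite S" "S \<noteq> {}" "C \<subseteq> I"
  shows "avg (I \<rightarrow>\<^sub>E S) (\<lambda>w. exp (\<Sum>i\<in>C. u (w i))) = avg S (\<lambda>v. exp (u v)) ^ card C"
proof -
  have fC: "finite C" using assms finite_subset by blast
  have "exp (\<Sum>i\<in>C. u (w i)) = (\<Prod>i\<in>I. if i \<in> C then exp (u (w i)) else 1)" for w
    using assms fC by (simp add: exp_sum prod.If_cases Int_absorb1)
  then have "avg (I \<rightarrow>\<^sub>E S) (\<lambda>w. exp (\<Sum>i\<in>C. u (w i)))
      = (\<Prod>i\<in>I. avg S (\<lambda>v. if i \<in> C then exp (u v) else 1))"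
    using avg_PiE_prod[OF assms(1,2), of "\<lambda>i v. if i \<in> C then exp (u v) else 1"] by simp
  also have "\<dots> = (\<Prod>i\<in>I. if i \<in> C then avg S (\<lambda>v. exp (u v)) else 1)"
    using assms by (intro prod.cong) (auto simp: avg_const)
  also have "\<dots> = avg S (\<lambda>v. exp (u v)) ^ card C"
    using assms by (simp add: prod.If_cases Int_absorb1)
  finally show ?thesis .
qed

lemma avg_PiE_component:
  assumes "finite I" "finite S" "S \<noteq> {}" "j \<in> I"
  shows "avg (I \<rightarrow>\<^sub>E S) (\<lambda>w. f (w j)) = avg S f"
proof -
  have "(\<Prod>i\<in>I. if i = j then f (w i) else 1) = f (w j)" for w
    using assms by (simp add: prod.delta)
  then have "avg (I \<rightarrow>\<^sub>E S) (\<lambda>w. f (w j))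
      = (\<Prod>i\<in>I. avg S (\<lambda>v. if i = j then f v else 1))"
    using avg_PiE_prod[OF assms(1,2), of "\<lambda>i v. if i = j then f v else 1"] by simp
  also have "\<dots> = (\<Prod>i\<in>I. if i = j then avg S f else 1)"
    using assms by (intro prod.cong) (auto simp: avg_const)
  finally show ?thesis using assms by simp
qed

lemma avg_union_bound:
  assumes "finite I"
  shows "avg S (\<lambda>x. of_bool (\<exists>i\<in>I. P i x)) \<le> (\<Sum>i\<in>I. avg S (\<lambda>x. of_bool (P i x)))"
proof -
  have "of_bool (\<exists>i\<in>I. P i x) \<le> (\<Sum>i\<in>I. of_bool (P i x) :: real)" for x
  proof (cases "\<exists>i\<in>I. P i x")
    case True
    then obtain i where i: "i \<in> I" "P i x" by auto
    then have "of_bool (P i x) \<le> (\<Sum>i\<in>I. of_bool (P i x) :: real)"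
      using assms by (intro member_le_sum) auto
    with i show ?thesis by simp
  qed (auto intro: sum_nonneg)
  then show ?thesis unfolding avg_sum[symmetric] by (intro avg_mono)
qed

lemma avg_exp_markov:
  assumes "avg S (\<lambda>x. exp (f x)) \<le> c"
  shows "avg S (\<lambda>x. of_bool (f x > u)) \<le> c * exp (- u)"
proof -
  have "avg S (\<lambda>x. of_bool (f x > u)) \<le> avg S (\<lambda>x. exp (- u) * exp (f x))"
    by (intro avg_mono) (auto simp: exp_add[symmetric])
  also have "\<dots> = exp (- u) * avg S (\<lambda>x. exp (f x))" by (rule avg_cmult)
  also have "\<dots> \<le> exp (- u) * c" using assms by simp
  finally show ?thesis by (simp add: mult.commute)
qed

text \<open>The reciprocal exp (x^2 - x) is at least 1 - x + x^2, and (1 - x + x^2) (1 + x + x^2) =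
  1 + x^2 + x^4 is at least 1. No range is imposed on x, which is what admits unbounded
  summands.\<close>

lemma exp_diff_square_le: "exp (x - x\<^sup>2) \<le> 1 + x + (x::real)\<^sup>2"
proof -
  have "0 \<le> (x - 1/2)\<^sup>2" "0 \<le> (x + 1/2)\<^sup>2" by auto
  then have p: "1 - x + x\<^sup>2 > 0" "1 + x + x\<^sup>2 > 0" by (auto simp: power2_eq_square algebra_simps)
  have "1 - x + x\<^sup>2 \<le> exp (x\<^sup>2 - x)" using exp_ge_add_one_self[of "x\<^sup>2 - x"] by linarith
  moreover have "exp (x - x\<^sup>2) * exp (x\<^sup>2 - x) = 1" by (simp add: exp_add[symmetric])
  ultimately have "exp (x - x\<^sup>2) * (1 - x + x\<^sup>2) \<le> 1"
    by (metis exp_ge_zero mult_left_mono)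
  also have "1 \<le> (1 + x + x\<^sup>2) * (1 - x + x\<^sup>2)"
  proof -
    have "(1 + x + x\<^sup>2) * (1 - x + x\<^sup>2) = 1 + x\<^sup>2 + (x\<^sup>2)\<^sup>2"
      by (simp add: power2_eq_square algebra_simps)
    then show ?thesis by simp
  qed
  finally show ?thesis using p by (simp add: mult_le_cancel_right)
qed

text \<open>By \<open>exp_diff_square_le\<close>, subtracting \<gamma>^2 D^2 in the exponent leaves
  an average of at most 1 + \<gamma> E D + \<gamma>^2 E D^2, however large D may be; the two
  subtracted means compensate this through 1 + y \<le> exp y.\<close>

lemma self_normalized_mgf:
  assumes "finite I" "finite S" "S \<noteq> {}"
  shows "avg (I \<rightarrow>\<^sub>E S) (\<lambda>w. exp (\<Sum>i\<in>I. \<gamma> * (D (w i) - avg S D)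
      - \<gamma>\<^sup>2 * ((D (w i))\<^sup>2 + avg S (\<lambda>g. (D g)\<^sup>2)))) \<le> 1"
proof -
  define m1 m2 where "m1 = avg S D" and "m2 = avg S (\<lambda>g. (D g)\<^sup>2)"
  have "avg S (\<lambda>g. exp (\<gamma> * (D g - m1) - \<gamma>\<^sup>2 * ((D g)\<^sup>2 + m2)))
      \<le> avg S (\<lambda>g. exp (- \<gamma> * m1 - \<gamma>\<^sup>2 * m2) * (1 + \<gamma> * D g + \<gamma>\<^sup>2 * (D g)\<^sup>2))"
  proof (rule avg_mono)
    fix g
    have "exp (\<gamma> * (D g - m1) - \<gamma>\<^sup>2 * ((D g)\<^sup>2 + m2))
        = exp (- \<gamma> * m1 - \<gamma>\<^sup>2 * m2) * exp (\<gamma> * D g - (\<gamma> * D g)\<^sup>2)"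
      by (simp add: exp_add[symmetric] power_mult_distrib algebra_simps)
    also have "\<dots> \<le> exp (- \<gamma> * m1 - \<gamma>\<^sup>2 * m2) * (1 + \<gamma> * D g + (\<gamma> * D g)\<^sup>2)"
      using exp_diff_square_le by simp
    finally show "exp (\<gamma> * (D g - m1) - \<gamma>\<^sup>2 * ((D g)\<^sup>2 + m2))
        \<le> exp (- \<gamma> * m1 - \<gamma>\<^sup>2 * m2) * (1 + \<gamma> * D g + \<gamma>\<^sup>2 * (D g)\<^sup>2)"
      by (simp add: power_mult_distrib)
  qed
  also have "\<dots> = exp (- \<gamma> * m1 - \<gamma>\<^sup>2 * m2) * (1 + \<gamma> * m1 + \<gamma>\<^sup>2 * m2)"
    using assms by (simp add: avg_cmult avg_add avg_const m1_def m2_def)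
  also have "\<dots> \<le> exp (- \<gamma> * m1 - \<gamma>\<^sup>2 * m2) * exp (\<gamma> * m1 + \<gamma>\<^sup>2 * m2)"
    using exp_ge_add_one_self[of "\<gamma> * m1 + \<gamma>\<^sup>2 * m2"] by (simp add: add.assoc)
  also have "\<dots> = 1" by (simp add: exp_add[symmetric])
  finally have 1: "avg S (\<lambda>g. exp (\<gamma> * (D g - m1) - \<gamma>\<^sup>2 * ((D g)\<^sup>2 + m2))) \<le> 1" .
  have "avg S (\<lambda>g. exp (\<gamma> * (D g - m1) - \<gamma>\<^sup>2 * ((D g)\<^sup>2 + m2))) ^ card I \<le> 1"
    by (intro power_le_one avg_nonneg 1) auto
  then show ?thesis
    unfolding m1_def m2_def
    using avg_PiE_exp_sum[OF assms subset_refl,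
      of "\<lambda>g. \<gamma> * (D g - avg S D) - \<gamma>\<^sup>2 * ((D g)\<^sup>2 + avg S (\<lambda>g. (D g)\<^sup>2))"] by simp
qed

text \<open>Since \<gamma> is fixed before the sample is drawn, the bound is linear in the second
  moment b, namely \<gamma> b + u / \<gamma> instead of the optimized 2 sqrt (u b). One \<gamma>
  then serves all lists and levels at once.\<close>

lemma self_normalized_tail:
  assumes "finite I" "finite S" "S \<noteq> {}" "\<gamma> > 0"
  shows "avg (I \<rightarrow>\<^sub>E S) (\<lambda>w. of_bool ((\<Sum>i\<in>I. D (w i)) - card I * avg S D
      > \<gamma> * ((\<Sum>i\<in>I. (D (w i))\<^sup>2) + card I * avg S (\<lambda>g. (D g)\<^sup>2)) + u / \<gamma>)) \<le> exp (- u)"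
    (is "avg ?W (\<lambda>w. of_bool (?P w)) \<le> _")
proof -
  define E where "E w = (\<Sum>i\<in>I. \<gamma> * (D (w i) - avg S D)
      - \<gamma>\<^sup>2 * ((D (w i))\<^sup>2 + avg S (\<lambda>g. (D g)\<^sup>2)))" for w
  have "?P w \<longleftrightarrow> E w > u" for w
  proof -
    define a b where "a = (\<Sum>i\<in>I. D (w i)) - card I * avg S D"
      and "b = (\<Sum>i\<in>I. (D (w i))\<^sup>2) + card I * avg S (\<lambda>g. (D g)\<^sup>2)"
    have "E w = \<gamma> * a - \<gamma>\<^sup>2 * b"
      unfolding E_def a_def b_def
      by (simp add: sum_subtractf sum.distrib sum_distrib_left[symmetric] algebra_simps)
    also have "\<dots> > u \<longleftrightarrow> a > \<gamma> * b + u / \<gamma>"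
      using assms(4) by (simp add: field_simps power2_eq_square)
    finally show ?thesis by (simp add: a_def b_def)
  qed
  then have "avg ?W (\<lambda>w. of_bool (?P w)) = avg ?W (\<lambda>w. of_bool (E w > u))" by simp
  also have "\<dots> \<le> 1 * exp (- u)"
    using self_normalized_mgf[OF assms(1-3), of \<gamma> D] by (intro avg_exp_markov) (simp add: E_def)
  finally show ?thesis by simp
qed

section \<open>Pluralities of random sublists\<close>

text \<open>The value 0 is inserted for the empty list, where \<open>Max\<close> would be
  unspecified: random sublists may be empty.\<close>

definition plurality :: "('x \<Rightarrow> 'a) \<Rightarrow> 'x set \<Rightarrow> nat" where
  "plurality \<phi> \<Lambda> = Max (insert 0 ((\<lambda>a. card {x\<in>\<Lambda>. \<phi> x = a}) ` \<phi> ` \<Lambda>))"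

text \<open>Subtracting K, instead of merely discarding small values, keeps this 1-Lipschitz in the
  plurality, so that halving can be compared symbol by symbol with an error of only K.\<close>

definition excess :: "real \<Rightarrow> ('x \<Rightarrow> 'a) \<Rightarrow> 'x set \<Rightarrow> real" where
  "excess K \<phi> \<Lambda> = max 0 (real (plurality \<phi> \<Lambda>) - K)"

lemma plurality_empty [simp]: "plurality \<phi> {} = 0"
  by (simp add: plurality_def)

lemma fibre_le_plurality:
  assumes "finite \<Lambda>"
  shows "card {x\<in>\<Lambda>. \<phi> x = a} \<le> plurality \<phi> \<Lambda>"
proof (cases "a \<in> \<phi> ` \<Lambda>")
  case True
  then show ?thesis using assms unfolding plurality_def by (intro Max_ge) auto
next
  case False
  then have e: "{x\<in>\<Lambda>. \<phi> x = a} = {}" by auto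
  show ?thesis unfolding e by simp
qed

lemma plurality_attained:
  assumes "finite \<Lambda>" "\<Lambda> \<noteq> {}"
  obtains a where "a \<in> \<phi> ` \<Lambda>" "plurality \<phi> \<Lambda> = card {x\<in>\<Lambda>. \<phi> x = a}"
proof -
  have "plurality \<phi> \<Lambda> \<in> insert 0 ((\<lambda>a. card {x\<in>\<Lambda>. \<phi> x = a}) ` \<phi> ` \<Lambda>)"
    using assms unfolding plurality_def by (intro Max_in) auto
  moreover have "plurality \<phi> \<Lambda> \<noteq> 0"
  proof -
    obtain x where x: "x \<in> \<Lambda>" using assms by auto
    then have "card {y\<in>\<Lambda>. \<phi> y = \<phi> x} > 0" using assms by (auto simp: card_gt_0_iff)
    then show ?thesis using fibre_le_plurality[OF assms(1), of \<phi> "\<phi> x"] by linarith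
  qed
  ultimately have "plurality \<phi> \<Lambda> \<in> (\<lambda>a. card {x\<in>\<Lambda>. \<phi> x = a}) ` \<phi> ` \<Lambda>" by simp
  then show ?thesis by (rule imageE) (rule that)
qed

lemma plurality_ge_1:
  assumes "finite \<Lambda>" "\<Lambda> \<noteq> {}"
  shows "plurality \<phi> \<Lambda> \<ge> 1"
proof -
  obtain x where x: "x \<in> \<Lambda>" using assms by auto
  then have "card {y\<in>\<Lambda>. \<phi> y = \<phi> x} > 0" using assms by (auto simp: card_gt_0_iff)
  then show ?thesis using fibre_le_plurality[OF assms(1), of \<phi> "\<phi> x"] by linarith
qed

lemma excess_empty: "K \<ge> 0 \<Longrightarrow> excess K \<phi> {} = 0"
  by (simp add: excess_def)

lemma excess_nonneg: "excess K \<phi> \<Lambda> \<ge> 0"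
  by (simp add: excess_def)

text \<open>The witness a is a most frequent symbol of \<Lambda>1 if D > 0 and of \<Lambda>2 if D <
  0. In the other list its fibre bounds the excess only from below, which is the direction needed.
  With fibre sizes X and Y, the error K arises because 2 (Y - K) subtracts the threshold twice and X
  - K only once.\<close>

lemma excess_halving_gap:
  fixes K D :: real
  assumes "finite \<Lambda>" "\<Lambda>1 \<subseteq> \<Lambda>" "\<Lambda>2 \<subseteq> \<Lambda>1" "K \<ge> 0"
    and D: "D = excess K \<phi> \<Lambda>1 - 2 * excess K \<phi> \<Lambda>2" "D \<noteq> 0"
  obtains a where "a \<in> \<phi> ` \<Lambda>" "card {x\<in>\<Lambda>1. \<phi> x = a} > K"
    "\<bar>D\<bar> \<le> card {x\<in>\<Lambda>1. \<phi> x = a}"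
    "\<bar>D\<bar> \<le> \<bar>real (card {x\<in>\<Lambda>1. \<phi> x = a}) - 2 * real (card {x\<in>\<Lambda>2. \<phi> x = a})\<bar> + K"
proof -
  have fin1: "finite \<Lambda>1" using assms(1,2) by (rule rev_finite_subset)
  have fin2: "finite \<Lambda>2" using fin1 assms(3) by (rule rev_finite_subset)
  note fin = fin1 fin2
  have le1: "max 0 (real (card {x\<in>\<Lambda>1. \<phi> x = a}) - K) \<le> excess K \<phi> \<Lambda>1" for a
    using fibre_le_plurality[OF fin(1), of \<phi> a] by (simp add: excess_def)
  have le2: "max 0 (real (card {x\<in>\<Lambda>2. \<phi> x = a}) - K) \<le> excess K \<phi> \<Lambda>2" for a
    using fibre_le_plurality[OF fin(2), of \<phi> a] by (simp add: excess_def)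
  show ?thesis
  proof (cases "D > 0")
    case True
    then have pos: "excess K \<phi> \<Lambda>1 > 0" using D excess_nonneg[of K \<phi> \<Lambda>2] by linarith
    then have "\<Lambda>1 \<noteq> {}" using pos excess_empty[OF assms(4), of \<phi>] by auto
    then obtain a where a: "a \<in> \<phi> ` \<Lambda>1" "plurality \<phi> \<Lambda>1 = card {x\<in>\<Lambda>1. \<phi> x = a}"
      by (rule plurality_attained[OF fin(1)])
    have e: "excess K \<phi> \<Lambda>1 = card {x\<in>\<Lambda>1. \<phi> x = a} - K" "card {x\<in>\<Lambda>1. \<phi> x = a} > K"
      using pos a by (auto simp: excess_def)
    show ?thesis
    proof (rule that[of a])
      show "a \<in> \<phi> ` \<Lambda>" using a(1) assms(2) by blast
    qed (use e le2[of a] D(1) True assms(4) in linarith)+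
  next
    case False
    then have pos: "excess K \<phi> \<Lambda>2 > 0" using D excess_nonneg[of K \<phi> \<Lambda>1] by linarith
    then have "\<Lambda>2 \<noteq> {}" using pos excess_empty[OF assms(4), of \<phi>] by auto
    then obtain a where a: "a \<in> \<phi> ` \<Lambda>2" "plurality \<phi> \<Lambda>2 = card {x\<in>\<Lambda>2. \<phi> x = a}"
      by (rule plurality_attained[OF fin(2)])
    have e: "excess K \<phi> \<Lambda>2 = card {x\<in>\<Lambda>2. \<phi> x = a} - K" "card {x\<in>\<Lambda>2. \<phi> x = a} > K"
      using pos a by (auto simp: excess_def)
    have "card {x\<in>\<Lambda>2. \<phi> x = a} \<le> card {x\<in>\<Lambda>1. \<phi> x = a}"
      using assms(3) fin by (intro card_mono) auto
    then have "real (card {x\<in>\<Lambda>2. \<phi> x = a}) \<le> real (card {x\<in>\<Lambda>1. \<phi> x = a})" by simp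
    note le = this e le1[of a] D(1) False assms(4)
    show ?thesis
    proof (rule that[of a])
      show "a \<in> \<phi> ` \<Lambda>" using a(1) assms(2,3) by blast
    qed (use le in linarith)+
  qed
qed

text \<open>A single label \<open>b x\<close>, uniform on \<open>{..<2^T}\<close>, couples all levels: the sets \<open>thin T s \<Lambda> b\<close>
  decrease in \<open>s\<close>, and each retains every point independently with probability \<open>2^-s\<close>.\<close>

definition thin :: "nat \<Rightarrow> nat \<Rightarrow> 'x set \<Rightarrow> ('x \<Rightarrow> nat) \<Rightarrow> 'x set" where
  "thin T s \<Lambda> b = {x\<in>\<Lambda>. b x < 2 ^ (T - s)}"

abbreviation labels :: "nat \<Rightarrow> 'x set \<Rightarrow> ('x \<Rightarrow> nat) set" where
  "labels T \<Lambda> \<equiv> \<Lambda> \<rightarrow>\<^sub>E {..<2 ^ T}"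

lemma finite_labels: "finite \<Lambda> \<Longrightarrow> finite (labels T \<Lambda>)"
  by (auto intro!: finite_PiE)

lemma labels_nonempty: "labels T \<Lambda> \<noteq> {}"
  by (simp add: PiE_eq_empty_iff lessThan_empty_iff)

lemma avg_labels_const: "finite \<Lambda> \<Longrightarrow> avg (labels T \<Lambda>) (\<lambda>_. c) = c"
  by (rule avg_const[OF finite_labels labels_nonempty])

lemma avg_label_less:
  assumes "s \<le> T"
  shows "avg {..<2 ^ T} (\<lambda>v::nat. of_bool (v < 2 ^ (T - s))) = 1 / 2 ^ s"
proof -
  have "(2::nat) ^ (T - s) \<le> 2 ^ T" by (intro power_increasing) auto
  then have "v < 2 ^ T" if "v < 2 ^ (T - s)" for v :: nat using that by (rule less_le_trans[rotated])
  then have "{..<2 ^ T} \<inter> {v::nat. v < 2 ^ (T - s)} = {..<2 ^ (T - s)}"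
    by blast
  then have "avg {..<2 ^ T} (\<lambda>v::nat. of_bool (v < 2 ^ (T - s))) = 2 ^ (T - s) / 2 ^ T"
    by (simp add: avg_def sum.If_cases of_bool_def)
  also have "\<dots> = 1 / 2 ^ s" using assms by (simp add: power_diff)
  finally show ?thesis .
qed

lemma card_thin_fibre:
  assumes "finite \<Lambda>" "C \<subseteq> \<Lambda>"
  shows "real (card {x\<in>C. b x < m}) = (\<Sum>x\<in>C. of_bool (b x < (m::nat)))"
  using finite_subset[OF assms(2,1)] by (simp add: of_bool_def sum.If_cases Int_def conj_commute)

section \<open>Exponential moments of thinned fibres\<close>

lemma exp_plus_exp_minus_le:
  fixes x :: real
  assumes "0 \<le> x" "x \<le> 1"
  shows "(exp x - 1) + (exp (- x) - 1) \<le> 2 * x\<^sup>2"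
proof -
  have 1: "exp x \<le> 1 + x + x\<^sup>2" using exp_bound[OF assms] .
  \<comment> \<open>The bound on exp (-x) comes from the reciprocal of this quadratic lower
    bound.\<close>
  have "1 + x + x\<^sup>2 / 2 \<le> exp x" by (rule exp_lower_Taylor_quadratic[OF assms(1)])
  then have "exp (- x) * (1 + x + x\<^sup>2 / 2) \<le> exp (- x) * exp x" by simp
  also have "\<dots> = 1" by (simp add: exp_add[symmetric])
  also have "1 \<le> (1 - x + x\<^sup>2) * (1 + x + x\<^sup>2 / 2)"
  proof -
    have "(1 - x + x\<^sup>2) * (1 + x + x\<^sup>2 / 2) = 1 + x\<^sup>2 * ((1 + x + x\<^sup>2) / 2)"
      by (simp add: field_simps power2_eq_square)
    moreover have "0 \<le> x\<^sup>2 * ((1 + x + x\<^sup>2) / 2)"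
      using assms by (intro mult_nonneg_nonneg divide_nonneg_nonneg add_nonneg_nonneg) auto
    ultimately show ?thesis by linarith
  qed
  finally have "exp (- x) \<le> 1 - x + x\<^sup>2"
  proof (rule mult_right_le_imp_le)
    show "0 < 1 + x + x\<^sup>2 / 2" using assms by (intro add_pos_nonneg) auto
  qed
  with 1 show ?thesis by simp
qed

text \<open>Each point survives with probability 2^-s, so the count is binomial and every factor is
  1 + (e - 1) / 2^s, with e - 1 \<le> 2.\<close>

lemma thin_mgf:
  assumes "finite \<Lambda>" "C \<subseteq> \<Lambda>" "s \<le> T"
  shows "avg (labels T \<Lambda>) (\<lambda>b. exp (real (card {x\<in>C. b x < 2 ^ (T - s)})))
    \<le> exp (2 * card C / 2 ^ s)"
proof -
  let ?V = "{..<(2::nat) ^ T}"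
  have nV: "?V \<noteq> {}" by (simp add: lessThan_empty_iff)
  have "avg (labels T \<Lambda>) (\<lambda>b. exp (real (card {x\<in>C. b x < 2 ^ (T - s)})))
      = avg ?V (\<lambda>v. exp (of_bool (v < 2 ^ (T - s)))) ^ card C"
    unfolding card_thin_fibre[OF assms(1,2)]
    using nV by (intro avg_PiE_exp_sum assms) auto
  also have "avg ?V (\<lambda>v. exp (of_bool (v < 2 ^ (T - s))))
      = avg ?V (\<lambda>v. 1 + (exp 1 - 1) * of_bool (v < 2 ^ (T - s)))"
    by (intro avg_cong) auto
  also have "\<dots> = 1 + (exp 1 - 1) / 2 ^ s"
    using nV avg_label_less[OF assms(3)] by (simp add: avg_add avg_cmult avg_const)
  also have "(1 + (exp 1 - 1) / 2 ^ s) ^ card C \<le> exp (2 / 2 ^ s :: real) ^ card C"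
  proof (rule power_mono)
    have "(exp 1 - 1) / 2 ^ s \<le> (2::real) / 2 ^ s"
      using exp_le by (intro divide_right_mono) auto
    then show "1 + (exp 1 - 1) / 2 ^ s \<le> exp (2 / 2 ^ s :: real)"
      using exp_ge_add_one_self[of "2 / 2 ^ s :: real"] by linarith
  qed (auto intro!: add_nonneg_nonneg divide_nonneg_nonneg)
  also have "\<dots> = exp (2 * card C / 2 ^ s)"
    by (simp add: exp_of_nat_mult[symmetric] mult.commute)
  finally show ?thesis .
qed

text \<open>A point contributes +1 if it survives level s but not the next, -1 if it survives both,
  and 0 otherwise; both nonzero values have probability 1 / 2^(s+1). The difference is thus a sum of
  independent symmetric terms of total variance |C| / 2^s, and subgaussian in the given range of
  \<eta>.\<close>

lemma thin_difference_mgf: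
  assumes "finite \<Lambda>" "C \<subseteq> \<Lambda>" "s < T" "\<bar>\<eta>\<bar> \<le> 1"
  shows "avg (labels T \<Lambda>) (\<lambda>b. exp (\<eta> * (real (card {x\<in>C. b x < 2 ^ (T - s)})
      - 2 * real (card {x\<in>C. b x < 2 ^ (T - Suc s)})))) \<le> exp (card C / 2 ^ s * \<eta>\<^sup>2)"
proof -
  let ?V = "{..<(2::nat) ^ T}"
  have nV: "?V \<noteq> {}" by (simp add: lessThan_empty_iff)
  let ?u = "\<lambda>v. \<eta> * (of_bool (v < 2 ^ (T - s)) - 2 * of_bool (v < 2 ^ (T - Suc s)))"
  have lt: "(2::nat) ^ (T - Suc s) \<le> 2 ^ (T - s)" by (intro power_increasing) auto
  have "\<eta> * (real (card {x\<in>C. b x < 2 ^ (T - s)}) - 2 * real (card {x\<in>C. b x < 2 ^ (T - Suc s)}))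
      = (\<Sum>x\<in>C. ?u (b x))" for b :: "'a \<Rightarrow> nat"
    unfolding card_thin_fibre[OF assms(1,2)] sum_distrib_left[symmetric] sum_subtractf by simp
  then have "avg (labels T \<Lambda>) (\<lambda>b. exp (\<eta> * (real (card {x\<in>C. b x < 2 ^ (T - s)})
      - 2 * real (card {x\<in>C. b x < 2 ^ (T - Suc s)}))))
      = avg ?V (\<lambda>v. exp (?u v)) ^ card C"
    using avg_PiE_exp_sum[OF assms(1) _ nV assms(2), of ?u] by simp
  also have "avg ?V (\<lambda>v. exp (?u v))
      = avg ?V (\<lambda>v. 1 + (exp \<eta> - 1) * (of_bool (v < 2 ^ (T - s)) - of_bool (v < 2 ^ (T - Suc s)))
          + (exp (- \<eta>) - 1) * of_bool (v < 2 ^ (T - Suc s)))"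
  proof (intro avg_cong)
    fix v :: nat
    have "v < 2 ^ (T - s)" if "v < 2 ^ (T - Suc s)" using that lt by linarith
    then show "exp (?u v) = 1 + (exp \<eta> - 1) * (of_bool (v < 2 ^ (T - s)) - of_bool (v < 2 ^ (T - Suc s)))
        + (exp (- \<eta>) - 1) * of_bool (v < 2 ^ (T - Suc s))" by auto
  qed
  also have "\<dots> = 1 + (exp \<eta> - 1) * (1 / 2 ^ s - 1 / 2 ^ Suc s) + (exp (- \<eta>) - 1) * (1 / 2 ^ Suc s)"
    using nV avg_label_less[of s T] avg_label_less[of "Suc s" T] assms(3)
    by (simp add: avg_add avg_diff avg_cmult avg_const)
  also have "\<dots> = 1 + ((exp \<eta> - 1) + (exp (- \<eta>) - 1)) / (2 * 2 ^ s)"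
    by (simp add: field_simps)
  also have "\<dots> ^ card C \<le> exp (\<eta>\<^sup>2 / 2 ^ s) ^ card C"
  proof (rule power_mono)
    have "(exp \<eta> - 1) + (exp (- \<eta>) - 1) \<le> 2 * \<eta>\<^sup>2"
      using exp_plus_exp_minus_le[of \<eta>] exp_plus_exp_minus_le[of "- \<eta>"] assms(4)
      by (cases "\<eta> \<ge> 0") auto
    then have "((exp \<eta> - 1) + (exp (- \<eta>) - 1)) / (2 * 2 ^ s) \<le> 2 * \<eta>\<^sup>2 / (2 * 2 ^ s)"
      by (intro divide_right_mono) auto
    then show "1 + ((exp \<eta> - 1) + (exp (- \<eta>) - 1)) / (2 * 2 ^ s) \<le> exp (\<eta>\<^sup>2 / 2 ^ s)"
      using exp_ge_add_one_self[of "\<eta>\<^sup>2 / 2 ^ s"]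
      by linarith
    have "0 \<le> (exp \<eta> - 1) + (exp (- \<eta>) - 1)"
      using exp_ge_add_one_self[of \<eta>] exp_ge_add_one_self[of "-\<eta>"] by linarith
    then have "0 \<le> ((exp \<eta> - 1) + (exp (- \<eta>) - 1)) / (2 * 2 ^ s)"
      by (rule divide_nonneg_nonneg) simp
    then show "0 \<le> 1 + ((exp \<eta> - 1) + (exp (- \<eta>) - 1)) / (2 * 2 ^ s)"
      by linarith
  qed
  also have "\<dots> = exp (card C / 2 ^ s * \<eta>\<^sup>2)"
    by (simp add: exp_of_nat_mult[symmetric] mult.commute)
  finally show ?thesis .
qed

lemma square_le_exp_half: "(x::real) \<ge> 0 \<Longrightarrow> x\<^sup>2 \<le> 8 * exp (x / 2)"
  using exp_lower_Taylor_quadratic[of "x / 2"] by (simp add: power_divide)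

text \<open>With at most one expected survivor, more than K are exponentially rare: for a count X >
  K, X^2 \<le> 8 exp (X/2) \<le> 8 exp (-K/2) exp X. The factor |C| / 2^s has to be retained, so
  that the sum over all symbols is governed by |\<Lambda>| / 2^s.\<close>

lemma thin_small_fibre:
  fixes K :: real
  assumes "finite \<Lambda>" "C \<subseteq> \<Lambda>" "s \<le> T" "card C \<le> 2 ^ s" "K \<ge> 0"
  shows "avg (labels T \<Lambda>) (\<lambda>b. (real (card {x\<in>C. b x < 2 ^ (T - s)}))\<^sup>2
      * of_bool (real (card {x\<in>C. b x < 2 ^ (T - s)}) > K)) \<le> 288 * exp (- K / 2) * (card C / 2 ^ s)"
proof -
  let ?X = "\<lambda>b. card {x\<in>C. b x < 2 ^ (T - s)}"
  have "avg (labels T \<Lambda>) (\<lambda>b. (real (?X b))\<^sup>2 * of_bool (real (?X b) > K))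
      \<le> avg (labels T \<Lambda>) (\<lambda>b. 16 * exp (- K / 2) * (exp (real (?X b)) - 1))"
  proof (rule avg_mono)
    fix b :: "'a \<Rightarrow> nat"
    show "(real (?X b))\<^sup>2 * of_bool (real (?X b) > K) \<le> 16 * exp (- K / 2) * (exp (real (?X b)) - 1)"
    proof (cases "real (?X b) > K")
      case True
      define X where "X = real (?X b)"
      have X: "X > K" "X \<ge> 1" using True assms(5) by (auto simp: X_def)
      have e: "exp X \<ge> 2" using exp_ge_add_one_self[of X] X by linarith
      have "X\<^sup>2 \<le> 8 * exp (X / 2)" using X by (intro square_le_exp_half) auto
      also have "\<dots> \<le> 8 * exp (X - K / 2)" using X by simp
      also have "\<dots> = 8 * exp (- K / 2) * exp X" by (simp add: exp_add[symmetric])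
      \<comment> \<open>X is at least 1 here, so exp X \<le> 2 (exp X - 1). The new expression
        vanishes at X = 0, and for this reason its average is of order |C| / 2^s.\<close>
      also have "\<dots> \<le> 8 * exp (- K / 2) * (2 * (exp X - 1))" using e by (intro mult_left_mono) auto
      also have "\<dots> = 16 * exp (- K / 2) * (exp X - 1)" by simp
      finally show ?thesis using True by (simp add: X_def)
    qed auto
  qed
  also have "\<dots> = 16 * exp (- K / 2) * (avg (labels T \<Lambda>) (\<lambda>b. exp (real (?X b))) - 1)"
    using assms(1) by (simp only: avg_cmult avg_diff avg_labels_const)
  also have "\<dots> \<le> 16 * exp (- K / 2) * (18 * (card C / 2 ^ s))"
  proof (intro mult_left_mono)
    define \<mu> where "\<mu> = card C / (2::real) ^ s"
    have "real (card C) \<le> 2 ^ s" using assms(4) of_nat_le_iff[where 'a=real] by fastforce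
    then have \<mu>: "0 \<le> \<mu>" "\<mu> \<le> 1" by (auto simp: \<mu>_def)
    have "avg (labels T \<Lambda>) (\<lambda>b. exp (real (?X b))) \<le> exp (2 * \<mu>)"
      using thin_mgf[OF assms(1-3)] by (simp add: \<mu>_def)
    \<comment> \<open>From exp (-y) \<ge> 1 - y at y = 2 \<mu> follows exp y - 1 \<le> y exp y,
      which is linear in \<mu>. Then exp 2 \<le> 9 supplies the 18, and 16 * 18 = 288.\<close>
    also have "exp (2 * \<mu>) * (1 - 2 * \<mu>) \<le> exp (2 * \<mu>) * exp (- (2 * \<mu>))"
      using exp_ge_add_one_self[of "- (2 * \<mu>)"] by (intro mult_left_mono) auto
    then have "exp (2 * \<mu>) \<le> 1 + 2 * \<mu> * exp (2 * \<mu>)" by (simp add: exp_add[symmetric] algebra_simps)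
    also have "\<dots> \<le> 1 + 2 * \<mu> * 9"
    proof -
      have "exp (2 * \<mu>) \<le> exp (2 * 1)" using \<mu> by simp
      also have "\<dots> = (exp 1)\<^sup>2" using exp_double[of "1::real"] by simp
      also have "\<dots> \<le> 3\<^sup>2" using exp_le by (intro power_mono) auto
      finally show ?thesis using \<mu> by (intro add_left_mono mult_left_mono) auto
    qed
    finally show "avg (labels T \<Lambda>) (\<lambda>b. exp (real (?X b))) - 1 \<le> 18 * (card C / 2 ^ s)"
      by (simp add: \<mu>_def)
  qed auto
  finally show ?thesis by simp
qed

lemma sum_card_fibres:
  assumes "finite \<Lambda>"
  shows "(\<Sum>a\<in>\<phi> ` \<Lambda>. card {x\<in>\<Lambda>. \<phi> x = a}) = card \<Lambda>"
  using sum.image_gen[OF assms, of "\<lambda>_. 1::nat" \<phi>] by simp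

lemma thin_fibre: "{x \<in> thin T s \<Lambda> b. \<phi> x = a} = {x \<in> {x\<in>\<Lambda>. \<phi> x = a}. b x < 2 ^ (T - s)}"
  by (auto simp: thin_def)

lemma thin_small_plurality:
  fixes K :: real
  assumes "finite \<Lambda>" "s \<le> T" "plurality \<phi> \<Lambda> \<le> 2 ^ s" "K \<ge> 0"
  shows "avg (labels T \<Lambda>) (\<lambda>b. \<Sum>a\<in>\<phi> ` \<Lambda>. (real (card {x \<in> thin T s \<Lambda> b. \<phi> x = a}))\<^sup>2
      * of_bool (real (card {x \<in> thin T s \<Lambda> b. \<phi> x = a}) > K)) \<le> 288 * exp (- K / 2) * card \<Lambda> / 2 ^ s"
proof -
  have "avg (labels T \<Lambda>) (\<lambda>b. \<Sum>a\<in>\<phi> ` \<Lambda>. (real (card {x \<in> thin T s \<Lambda> b. \<phi> x = a}))\<^sup>2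
      * of_bool (real (card {x \<in> thin T s \<Lambda> b. \<phi> x = a}) > K))
      \<le> (\<Sum>a\<in>\<phi> ` \<Lambda>. 288 * exp (- K / 2) * (card {x\<in>\<Lambda>. \<phi> x = a} / 2 ^ s))"
    unfolding avg_sum thin_fibre
    using fibre_le_plurality[OF assms(1), of \<phi>] assms
    by (intro sum_mono thin_small_fibre) (auto intro: order_trans)
  also have "\<dots> = 288 * exp (- K / 2) * real (\<Sum>a\<in>\<phi> ` \<Lambda>. card {x\<in>\<Lambda>. \<phi> x = a}) / 2 ^ s"
    by (simp add: sum_distrib_left sum_divide_distrib)
  also have "\<dots> = 288 * exp (- K / 2) * card \<Lambda> / 2 ^ s"
    by (simp only: sum_card_fibres[OF assms(1)])
  finally show ?thesis .
qed

text \<open>Let \<mu> = P / 2^s be the expected number of survivors of the largest fibre, P the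
  plurality of \<Lambda>. If \<mu> \<le> 1, a nonzero difference needs a fibre with more than K
  survivors, which is rare. If \<mu> > 1, the difference at each symbol is subgaussian with variance
  at most \<mu>, and its maximum over the at most |\<Lambda>| symbols is of order K sqrt \<mu>,
  because K is large compared with ln |\<Lambda>|.\<close>

lemma avg_excess_halving_gap_square:
  fixes K :: real
  assumes "finite \<Lambda>" "\<Lambda> \<noteq> {}" "s < T" "K \<ge> 1" "288 * card \<Lambda> * exp (- K / 2) \<le> 1"
  shows "avg (labels T \<Lambda>) (\<lambda>b. (excess K \<phi> (thin T s \<Lambda> b) - 2 * excess K \<phi> (thin T (Suc s) \<Lambda> b))\<^sup>2)
    \<le> 6 * K\<^sup>2 * plurality \<phi> \<Lambda> / 2 ^ s"
proof -
  define D where "D b = excess K \<phi> (thin T s \<Lambda> b) - 2 * excess K \<phi> (thin T (Suc s) \<Lambda> b)" for b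
  define X where "X b a = real (card {x \<in> thin T s \<Lambda> b. \<phi> x = a})" for b a
  define Y where "Y b a = real (card {x \<in> thin T (Suc s) \<Lambda> b. \<phi> x = a})" for b a
  have sub: "thin T s \<Lambda> b \<subseteq> \<Lambda>" "thin T (Suc s) \<Lambda> b \<subseteq> thin T s \<Lambda> b" for b
  proof -
    have "(2::nat) ^ (T - Suc s) \<le> 2 ^ (T - s)" by (intro power_increasing) auto
    then show "thin T (Suc s) \<Lambda> b \<subseteq> thin T s \<Lambda> b"
      unfolding thin_def by (intro Collect_mono) (metis less_le_trans)
  qed (auto simp: thin_def)
  have gap: "\<exists>a\<in>\<phi> ` \<Lambda>. X b a > K \<and> \<bar>D b\<bar> \<le> X b a \<and> \<bar>D b\<bar> \<le> \<bar>X b a - 2 * Y b a\<bar> + K" if "D b \<noteq> 0" for b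
  proof -
    have "K \<ge> 0" using assms(4) by simp
    from excess_halving_gap[OF assms(1) sub this D_def that]
    obtain a where "a \<in> \<phi> ` \<Lambda>" "X b a > K" "\<bar>D b\<bar> \<le> X b a" "\<bar>D b\<bar> \<le> \<bar>X b a - 2 * Y b a\<bar> + K"
      unfolding X_def Y_def .
    then show ?thesis by blast
  qed
  have P1: "plurality \<phi> \<Lambda> \<ge> 1" using plurality_ge_1[OF assms(1,2)] .
  have fi: "finite (\<phi> ` \<Lambda>)" using assms by auto
  have small: "288 * exp (- K / 2) * card \<Lambda> \<le> 1" using assms(5) by (simp add: mult_ac)
  show ?thesis
  proof (cases "plurality \<phi> \<Lambda> \<le> 2 ^ s")
    case True
    have "avg (labels T \<Lambda>) (\<lambda>b. (D b)\<^sup>2)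
        \<le> avg (labels T \<Lambda>) (\<lambda>b. \<Sum>a\<in>\<phi> ` \<Lambda>. (X b a)\<^sup>2 * of_bool (X b a > K))"
    proof (rule avg_mono)
      fix b
      show "(D b)\<^sup>2 \<le> (\<Sum>a\<in>\<phi> ` \<Lambda>. (X b a)\<^sup>2 * of_bool (X b a > K))"
      proof (cases "D b = 0")
        case False
        then obtain a where a: "a \<in> \<phi> ` \<Lambda>" "X b a > K" "\<bar>D b\<bar> \<le> X b a" using gap by blast
        have "(D b)\<^sup>2 \<le> (X b a)\<^sup>2 * of_bool (X b a > K)"
          using a power_mono[OF a(3), of 2] by simp
        also have "\<dots> \<le> (\<Sum>a\<in>\<phi> ` \<Lambda>. (X b a)\<^sup>2 * of_bool (X b a > K))"
          using fi a by (intro member_le_sum) auto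
        finally show ?thesis .
      qed (auto intro: sum_nonneg)
    qed
    also have "\<dots> \<le> 288 * exp (- K / 2) * card \<Lambda> / 2 ^ s"
      unfolding X_def using assms True by (intro thin_small_plurality) auto
    also have "\<dots> \<le> 1 / 2 ^ s" using small by (intro divide_right_mono) auto
    also have "\<dots> \<le> 6 * K\<^sup>2 * plurality \<phi> \<Lambda> / 2 ^ s"
    proof (intro divide_right_mono)
      have "1 * 1 \<le> K\<^sup>2 * real (plurality \<phi> \<Lambda>)"
        using P1 assms(4) by (intro mult_mono) auto
      then show "1 \<le> 6 * K\<^sup>2 * plurality \<phi> \<Lambda>" by simp
    qed auto
    finally show ?thesis by (simp add: D_def)
  next
    case False
    define \<mu> where "\<mu> = plurality \<phi> \<Lambda> / (2::real) ^ s"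
    have "real (plurality \<phi> \<Lambda>) \<ge> 2 ^ s"
      using False of_nat_le_iff[where 'a=real, of "2 ^ s" "plurality \<phi> \<Lambda>"] by simp
    then have \<mu>: "\<mu> \<ge> 1" by (simp add: \<mu>_def)
    \<comment> \<open>Scaled so that \<eta>^2 |C| / 2^s is at most 1 for every fibre C; each of the
      two exponentials in \<open>Z\<close> then averages to at most e \<le> 3.\<close>
    define \<eta> where "\<eta> = 1 / sqrt \<mu>"
    have \<eta>: "0 < \<eta>" "\<eta> \<le> 1" "\<eta>\<^sup>2 * \<mu> = 1" using \<mu> by (auto simp: \<eta>_def power_divide)
    define Z where "Z b a = exp (\<eta> * (X b a - 2 * Y b a)) + exp (- \<eta> * (X b a - 2 * Y b a))" for b a
    have Z: "avg (labels T \<Lambda>) (\<lambda>b. Z b a) \<le> 6" for a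
    proof -
      define C where "C = {x\<in>\<Lambda>. \<phi> x = a}"
      have "card C / 2 ^ s \<le> \<mu>"
        using fibre_le_plurality[OF assms(1), of \<phi> a]
        by (auto simp: C_def \<mu>_def intro: divide_right_mono)
      then have "card C / 2 ^ s * \<eta>\<^sup>2 \<le> \<mu> * \<eta>\<^sup>2" by (intro mult_right_mono) auto
      then have c: "exp (card C / 2 ^ s * \<eta>\<^sup>2) \<le> 3" 
        using \<eta>(3) exp_le by (simp add: mult.commute order_trans[OF _ exp_le])
      have C: "C \<subseteq> \<Lambda>" by (auto simp: C_def)
      have "avg (labels T \<Lambda>) (\<lambda>b. exp (\<eta> * (X b a - 2 * Y b a))) \<le> exp (card C / 2 ^ s * \<eta>\<^sup>2)"
        unfolding X_def Y_def thin_fibre C_def[symmetric]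
        using \<eta> by (intro thin_difference_mgf assms C) auto
      moreover have "avg (labels T \<Lambda>) (\<lambda>b. exp (- \<eta> * (X b a - 2 * Y b a)))
          \<le> exp (card C / 2 ^ s * (- \<eta>)\<^sup>2)"
        unfolding X_def Y_def thin_fibre C_def[symmetric]
        using \<eta> by (intro thin_difference_mgf assms C) auto
      ultimately show ?thesis using c by (simp add: Z_def avg_add)
    qed
    have "avg (labels T \<Lambda>) (\<lambda>b. (D b)\<^sup>2)
        \<le> avg (labels T \<Lambda>) (\<lambda>b. 2 * K\<^sup>2 + 2 * \<mu> * (K\<^sup>2 + 8 * exp (- K / 2) * (\<Sum>a\<in>\<phi> ` \<Lambda>. Z b a)))"
    proof (rule avg_mono)
      fix b
      have Zn: "Z b a \<ge> 0" for a by (auto simp: Z_def intro: add_nonneg_nonneg)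
      show "(D b)\<^sup>2 \<le> 2 * K\<^sup>2 + 2 * \<mu> * (K\<^sup>2 + 8 * exp (- K / 2) * (\<Sum>a\<in>\<phi> ` \<Lambda>. Z b a))"
      proof (cases "D b = 0")
        case True
        then show ?thesis using \<mu> Zn by (auto intro!: add_nonneg_nonneg mult_nonneg_nonneg sum_nonneg)
      next
        case False
        then obtain a where a: "a \<in> \<phi> ` \<Lambda>" "\<bar>D b\<bar> \<le> \<bar>X b a - 2 * Y b a\<bar> + K" using gap by blast
        define w where "w = \<bar>\<eta> * (X b a - 2 * Y b a)\<bar>"
        have "(X b a - 2 * Y b a)\<^sup>2 = \<mu> * w\<^sup>2"
          using \<eta>(3) by (simp add: w_def power_mult_distrib mult.assoc[symmetric] mult.commute)
        \<comment> \<open>Values up to K are paid for by K^2. Beyond K, exp (w/2) \<le> exp (-K/2)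
          exp w, and the factor exp (-K/2) later absorbs the sum of \<open>Z\<close> over all
          symbols.\<close>
        have w: "w\<^sup>2 \<le> K\<^sup>2 + 8 * exp (- K / 2) * Z b a"
        proof (cases "w \<le> K")
          case True
          then have "w\<^sup>2 \<le> K\<^sup>2" by (intro power_mono) (auto simp: w_def)
          then show ?thesis using Zn by (simp add: add_increasing2)
        next
          case False
          have "w\<^sup>2 \<le> 8 * exp (w / 2)" by (intro square_le_exp_half) (auto simp: w_def)
          also have "\<dots> \<le> 8 * exp (- K / 2 + w)" using False by simp
          also have "\<dots> = 8 * exp (- K / 2) * exp w" by (simp add: exp_add[symmetric])
          also have "\<dots> \<le> 8 * exp (- K / 2) * Z b a"
            by (intro mult_left_mono) (auto simp: w_def Z_def abs_if)
          finally show ?thesis by (simp add: add_increasing)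
        qed
        have "Z b a \<le> (\<Sum>a\<in>\<phi> ` \<Lambda>. Z b a)" using a fi Zn by (intro member_le_sum) auto
        then have "8 * exp (- K / 2) * Z b a \<le> 8 * exp (- K / 2) * (\<Sum>a\<in>\<phi> ` \<Lambda>. Z b a)"
          by (intro mult_left_mono) auto
        with w have w': "w\<^sup>2 \<le> K\<^sup>2 + 8 * exp (- K / 2) * (\<Sum>a\<in>\<phi> ` \<Lambda>. Z b a)" by linarith
        have "(D b)\<^sup>2 \<le> (\<bar>X b a - 2 * Y b a\<bar> + K)\<^sup>2"
          using power_mono[OF a(2), of 2] by simp
        also have "\<dots> \<le> 2 * K\<^sup>2 + 2 * (X b a - 2 * Y b a)\<^sup>2"
        proof -
          have "0 \<le> (\<bar>X b a - 2 * Y b a\<bar> - K)\<^sup>2" by simp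
          then show ?thesis by (simp add: power2_sum power2_diff)
        qed
        also have "\<dots> = 2 * K\<^sup>2 + 2 * \<mu> * w\<^sup>2"
          using \<open>(X b a - 2 * Y b a)\<^sup>2 = \<mu> * w\<^sup>2\<close> by simp
        also have "\<dots> \<le> 2 * K\<^sup>2 + 2 * \<mu> * (K\<^sup>2 + 8 * exp (- K / 2) * (\<Sum>a\<in>\<phi> ` \<Lambda>. Z b a))"
          using w' \<mu> by (intro add_left_mono mult_left_mono) auto
        finally show ?thesis .
      qed
    qed
    also have "\<dots> = 2 * K\<^sup>2 + 2 * \<mu> * (K\<^sup>2 + 8 * exp (- K / 2) * (\<Sum>a\<in>\<phi> ` \<Lambda>. avg (labels T \<Lambda>) (\<lambda>b. Z b a)))"
      using assms(1) by (simp only: avg_add avg_cmult avg_labels_const avg_sum)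
    also have "\<dots> \<le> 2 * K\<^sup>2 + 2 * \<mu> * (K\<^sup>2 + 1)"
    proof (intro add_left_mono mult_left_mono)
      have "(\<Sum>a\<in>\<phi> ` \<Lambda>. avg (labels T \<Lambda>) (\<lambda>b. Z b a)) \<le> (\<Sum>a\<in>\<phi> ` \<Lambda>. 6)"
        by (intro sum_mono Z)
      also have "\<dots> \<le> 6 * card \<Lambda>" using card_image_le[OF assms(1), of \<phi>] by simp
      finally have "8 * exp (- K / 2) * (\<Sum>a\<in>\<phi> ` \<Lambda>. avg (labels T \<Lambda>) (\<lambda>b. Z b a))
          \<le> 8 * exp (- K / 2) * (6 * card \<Lambda>)" by (intro mult_left_mono) auto
      \<comment> \<open>The factor 8 * 6 = 48 is within the 288 granted by the hypothesis on
        K.\<close>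
      also have "\<dots> \<le> 1"
      proof -
        have "0 \<le> exp (- K / 2) * card \<Lambda>" by simp
        then show ?thesis using small by linarith
      qed
      finally show "8 * exp (- K / 2) * (\<Sum>a\<in>\<phi> ` \<Lambda>. avg (labels T \<Lambda>) (\<lambda>b. Z b a)) \<le> 1" .
    qed (use \<mu> in auto)
    also have "\<dots> \<le> 6 * K\<^sup>2 * \<mu>"
    proof -
      have K2: "K\<^sup>2 \<ge> 1" using assms(4) by simp
      have "K\<^sup>2 * 1 \<le> K\<^sup>2 * \<mu>" using \<mu> by (intro mult_left_mono) auto
      moreover have "1 * \<mu> \<le> K\<^sup>2 * \<mu>" using \<mu> K2 by (intro mult_right_mono) auto
      ultimately show ?thesis by (simp add: algebra_simps)
    qed
    finally show ?thesis by (simp add: D_def \<mu>_def)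
  qed
qed

text \<open>Since |\<Lambda>| \<le> 2^T, every fibre has at most one expected survivor at the last
  level, so only rare large fibres count. The bound 1 / 2^T cancels the weight 2^T of this level in
  the telescoped sum.\<close>

lemma avg_excess_last:
  fixes K :: real
  assumes "finite \<Lambda>" "\<Lambda> \<noteq> {}" "card \<Lambda> \<le> 2 ^ T" "K \<ge> 0" "288 * card \<Lambda> * exp (- K / 2) \<le> 1"
  shows "avg (labels T \<Lambda>) (\<lambda>b. excess K \<phi> (thin T T \<Lambda> b)) \<le> 1 / 2 ^ T"
proof -
  have small: "288 * exp (- K / 2) * card \<Lambda> \<le> 1" using assms(5) by (simp add: mult_ac)
  have "avg (labels T \<Lambda>) (\<lambda>b. excess K \<phi> (thin T T \<Lambda> b))
    \<le> avg (labels T \<Lambda>) (\<lambda>b. \<Sum>a\<in>\<phi> ` \<Lambda>. (real (card {x \<in> thin T T \<Lambda> b. \<phi> x = a}))\<^sup>2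
      * of_bool (real (card {x \<in> thin T T \<Lambda> b. \<phi> x = a}) > K))"
  proof (rule avg_mono)
    fix b
    let ?X = "\<lambda>a. real (card {x \<in> thin T T \<Lambda> b. \<phi> x = a})"
    have fin: "finite (thin T T \<Lambda> b)" using assms(1) by (simp add: thin_def)
    show "excess K \<phi> (thin T T \<Lambda> b) \<le> (\<Sum>a\<in>\<phi> ` \<Lambda>. (?X a)\<^sup>2 * of_bool (?X a > K))"
    proof (cases "excess K \<phi> (thin T T \<Lambda> b) = 0")
      case False
      then have "thin T T \<Lambda> b \<noteq> {}" using excess_empty[OF assms(4), of \<phi>] by auto
      then obtain a where a: "a \<in> \<phi> ` thin T T \<Lambda> b" "plurality \<phi> (thin T T \<Lambda> b) = card {x \<in> thin T T \<Lambda> b. \<phi> x = a}"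
        by (rule plurality_attained[OF fin])
      have X: "?X a > K" "excess K \<phi> (thin T T \<Lambda> b) \<le> ?X a"
        using False a(2) assms(4) by (auto simp: excess_def max_def split: if_splits)
      have "?X a > 0" using X(1) assms(4) by linarith
      then have "card {x \<in> thin T T \<Lambda> b. \<phi> x = a} \<ge> 1" by linarith
      then have "?X a \<ge> 1" using of_nat_mono by fastforce
      then have "?X a * 1 \<le> ?X a * ?X a" by (intro mult_left_mono) auto
      with X have "excess K \<phi> (thin T T \<Lambda> b) \<le> ?X a * ?X a" by linarith
      then have "excess K \<phi> (thin T T \<Lambda> b) \<le> (?X a)\<^sup>2 * of_bool (?X a > K)"
        using X(1) by (simp only: of_bool_eq power2_eq_square mult_1_right)
      also have "\<dots> \<le> (\<Sum>a\<in>\<phi> ` \<Lambda>. (?X a)\<^sup>2 * of_bool (?X a > K))"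
        using a assms(1) by (intro member_le_sum) (auto simp: thin_def)
      finally show ?thesis .
    qed (auto intro: sum_nonneg)
  qed
  also have "\<dots> \<le> 288 * exp (- K / 2) * card \<Lambda> / 2 ^ T"
  proof (rule thin_small_plurality)
    have "plurality \<phi> \<Lambda> \<le> card \<Lambda>"
    proof -
      obtain a where "plurality \<phi> \<Lambda> = card {x\<in>\<Lambda>. \<phi> x = a}"
        by (rule plurality_attained[OF assms(1,2)])
      then show ?thesis using assms(1) by (auto intro: card_mono)
    qed
    then show "plurality \<phi> \<Lambda> \<le> 2 ^ T" using assms(3) by simp
  qed (use assms in auto)
  also have "\<dots> \<le> 1 / 2 ^ T" using small by (intro divide_right_mono) auto
  finally show ?thesis .
qed

section \<open>Chaining\<close>

lemma sum_Pow_power_card: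
  fixes r :: real
  assumes "finite V"
  shows "(\<Sum>\<Lambda>\<in>Pow V. r ^ card \<Lambda>) = (1 + r) ^ card V"
  using prod_add[OF assms, of "\<lambda>_. r" "\<lambda>_. 1"] by (simp add: add.commute)

text \<open>The cost of a union bound in which a list of size s fails with probability N^(-6 s), N =
  |V|: the sum is (1 + r)^N - 1 with r = c N^-6, and r N \<le> 2 / 2^5 = 1/16. Taking c = 2 pays for
  the 2^s sublists of each list, c = 1 for the list alone.\<close>

lemma sum_nonempty_subsets_le:
  assumes "finite V" "card V \<ge> 2" "0 \<le> c" "c \<le> 2"
  shows "(\<Sum>\<Lambda>\<in>Pow V - {{}}. (c * exp (- (6 * ln (card V)))) ^ card \<Lambda>) \<le> 1 / 8"
proof -
  define N where "N = real (card V)"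
  have N: "N \<ge> 2" using assms(2) by (simp add: N_def)
  define r where "r = c * exp (- (6 * ln N))"
  have "exp (- (6 * ln N)) = 1 / N ^ 6"
    using N exp_of_nat_mult[of 6 "ln N"] by (simp add: exp_minus divide_inverse)
  then have "r * N = c / N ^ 5" using N by (simp add: r_def power_Suc eval_nat_numeral)
  also have "\<dots> \<le> 2 / 2 ^ 5" using N assms(3,4) by (intro frac_le power_mono) auto
  finally have rN: "r * N \<le> 1 / 16" by simp
  have r0: "r \<ge> 0" using assms(3) by (simp add: r_def)
  have "(\<Sum>\<Lambda>\<in>Pow V. r ^ card \<Lambda>) = (1 + r) ^ card V" by (rule sum_Pow_power_card[OF assms(1)])
  also have "\<dots> \<le> exp r ^ card V"
    using exp_ge_add_one_self[of r] r0 by (intro power_mono) auto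
  also have "\<dots> = exp (r * N)" by (simp add: exp_of_nat_mult[symmetric] N_def mult.commute)
  also have "\<dots> \<le> exp (1 / 16)" using rN by simp
  also have "\<dots> \<le> 1 + 1 / 16 + (1 / 16)\<^sup>2" by (rule exp_bound) auto
  also have "\<dots> \<le> 9 / 8" by (simp add: power2_eq_square)
  finally have "(\<Sum>\<Lambda>\<in>Pow V. r ^ card \<Lambda>) \<le> 9 / 8" .
  moreover have "(\<Sum>\<Lambda>\<in>Pow V. r ^ card \<Lambda>) = 1 + (\<Sum>\<Lambda>\<in>Pow V - {{}}. r ^ card \<Lambda>)"
    using assms(1) by (subst sum.remove[of _ "{}"]) auto
  ultimately show ?thesis by (simp add: r_def N_def)
qed

text \<open>The failure exponent scales with the size of the larger list of a pair. A single event
  thereby covers all sizes, and a deep level of a chain is charged only for the points that it still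
  contains.\<close>

lemma uniform_self_normalized_tail:
  fixes D :: "'x set \<Rightarrow> 'x set \<Rightarrow> 'g \<Rightarrow> real"
  assumes "finite V" "card V \<ge> 2" "finite \<Omega>" "\<Omega> \<noteq> {}" "finite J" "\<gamma> > 0"
  shows "avg (J \<rightarrow>\<^sub>E \<Omega>) (\<lambda>w. of_bool (\<exists>\<Lambda>\<in>Pow V - {{}}. \<exists>\<Lambda>'\<in>Pow \<Lambda>.
      (\<Sum>j\<in>J. D \<Lambda> \<Lambda>' (w j)) - card J * avg \<Omega> (D \<Lambda> \<Lambda>')
      > \<gamma> * ((\<Sum>j\<in>J. (D \<Lambda> \<Lambda>' (w j))\<^sup>2) + card J * avg \<Omega> (\<lambda>g. (D \<Lambda> \<Lambda>' g)\<^sup>2))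
        + 6 * ln (card V) * card \<Lambda> / \<gamma>)) \<le> 1 / 8"
    (is "avg ?W (\<lambda>w. of_bool (\<exists>\<Lambda>\<in>_. \<exists>\<Lambda>'\<in>_. ?P \<Lambda> \<Lambda>' w)) \<le> _")
proof -
  have "avg ?W (\<lambda>w. of_bool (\<exists>\<Lambda>\<in>Pow V - {{}}. \<exists>\<Lambda>'\<in>Pow \<Lambda>. ?P \<Lambda> \<Lambda>' w))
      \<le> (\<Sum>\<Lambda>\<in>Pow V - {{}}. avg ?W (\<lambda>w. of_bool (\<exists>\<Lambda>'\<in>Pow \<Lambda>. ?P \<Lambda> \<Lambda>' w)))"
    using assms(1) by (intro avg_union_bound) auto
  also have "\<dots> \<le> (\<Sum>\<Lambda>\<in>Pow V - {{}}. (2 * exp (- (6 * ln (card V)))) ^ card \<Lambda>)"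
  proof (rule sum_mono)
    fix \<Lambda> assume "\<Lambda> \<in> Pow V - {{}}"
    then have fin: "finite \<Lambda>" using assms(1) finite_subset by auto
    have "avg ?W (\<lambda>w. of_bool (\<exists>\<Lambda>'\<in>Pow \<Lambda>. ?P \<Lambda> \<Lambda>' w))
        \<le> (\<Sum>\<Lambda>'\<in>Pow \<Lambda>. avg ?W (\<lambda>w. of_bool (?P \<Lambda> \<Lambda>' w)))"
      using fin by (intro avg_union_bound) auto
    also have "\<dots> \<le> (\<Sum>\<Lambda>'\<in>Pow \<Lambda>. exp (- (6 * ln (card V) * card \<Lambda>)))"
      by (intro sum_mono self_normalized_tail assms)
    also have "\<dots> = 2 ^ card \<Lambda> * exp (card \<Lambda> * (- (6 * ln (card V))))"
      using fin by (simp add: card_Pow mult.commute)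
    also have "\<dots> = (2 * exp (- (6 * ln (card V)))) ^ card \<Lambda>"
      by (simp only: exp_of_nat_mult power_mult_distrib)
    finally show "avg ?W (\<lambda>w. of_bool (\<exists>\<Lambda>'\<in>Pow \<Lambda>. ?P \<Lambda> \<Lambda>' w))
        \<le> (2 * exp (- (6 * ln (card V)))) ^ card \<Lambda>" .
  qed
  also have "\<dots> \<le> 1 / 8" using assms by (intro sum_nonempty_subsets_le) auto
  finally show ?thesis .
qed

lemma avg_card_thin:
  assumes "finite \<Lambda>" "s \<le> T"
  shows "avg (labels T \<Lambda>) (\<lambda>b. real (card (thin T s \<Lambda> b))) = card \<Lambda> / 2 ^ s"
proof -
  have n: "{..<(2::nat) ^ T} \<noteq> {}" by (simp add: lessThan_empty_iff)
  have "avg (labels T \<Lambda>) (\<lambda>b. real (card (thin T s \<Lambda> b)))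
      = (\<Sum>x\<in>\<Lambda>. avg (labels T \<Lambda>) (\<lambda>b. of_bool (b x < 2 ^ (T - s))))"
    unfolding thin_def card_thin_fibre[OF assms(1) subset_refl] by (rule avg_sum)
  also have "\<dots> = (\<Sum>x\<in>\<Lambda>. 1 / 2 ^ s)"
  proof (rule sum.cong[OF refl])
    fix x assume "x \<in> \<Lambda>"
    then show "avg (labels T \<Lambda>) (\<lambda>b. of_bool (b x < 2 ^ (T - s))) = 1 / 2 ^ s"
      using avg_PiE_component[OF assms(1) finite_lessThan n, of x "\<lambda>v. of_bool (v < 2 ^ (T - s))"]
        avg_label_less[OF assms(2)] by simp
  qed
  finally show ?thesis by simp
qed

text \<open>The matrix \<open>w\<close> is fixed and \<open>good\<close> is deterministic; the
  labels are the only randomness. Level s enters with weight 2^s, while its second moment is at most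
  6 K^2 P / 2^s (P the plurality of \<Lambda>) and its expected size is |\<Lambda>| / 2^s. Hence all
  T levels contribute equally. The final \<open>card J\<close> is the cost of the last
  level.\<close>

lemma chaining_bound:
  fixes h :: "'g \<Rightarrow> 'x \<Rightarrow> 'a" and w :: "'j \<Rightarrow> 'g" and K \<gamma> u :: real
  assumes \<Omega>: "finite \<Omega>" "\<Omega> \<noteq> {}" and \<Lambda>: "finite \<Lambda>" "\<Lambda> \<noteq> {}" "card \<Lambda> \<le> 2 ^ T"
    and K: "K \<ge> 1" "288 * card \<Lambda> * exp (- K / 2) \<le> 1" and \<gamma>: "\<gamma> > 0"
    and good: "\<And>\<Lambda>1 \<Lambda>2 D. \<Lambda>1 \<subseteq> \<Lambda> \<Longrightarrow> \<Lambda>1 \<noteq> {} \<Longrightarrow> \<Lambda>2 \<subseteq> \<Lambda>1 \<Longrightarrow>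
      D = (\<lambda>g. excess K (h g) \<Lambda>1 - 2 * excess K (h g) \<Lambda>2) \<Longrightarrow>
      (\<Sum>j\<in>J. D (w j)) - card J * avg \<Omega> D
        \<le> \<gamma> * ((\<Sum>j\<in>J. (D (w j))\<^sup>2) + card J * avg \<Omega> (\<lambda>g. (D g)\<^sup>2)) + u * card \<Lambda>1 / \<gamma>"
  shows "(\<Sum>j\<in>J. excess K (h (w j)) \<Lambda>) - card J * avg \<Omega> (\<lambda>g. excess K (h g) \<Lambda>)
    \<le> 6 * \<gamma> * T * K\<^sup>2 * ((\<Sum>j\<in>J. real (plurality (h (w j)) \<Lambda>))
        + card J * avg \<Omega> (\<lambda>g. real (plurality (h g) \<Lambda>))) + T * u * card \<Lambda> / \<gamma> + card J"
proof -
  \<comment> \<open>The bound holds along every chain of sublists with an error depending on the labels \<open>b\<close>;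
    averaging over \<open>b\<close> evaluates the error.\<close>
  define dev where "dev G = (\<Sum>j\<in>J. G (w j)) - card J * avg \<Omega> G" for G :: "'g \<Rightarrow> real"
  define tot where "tot G = (\<Sum>j\<in>J. G (w j)) + card J * avg \<Omega> G" for G :: "'g \<Rightarrow> real"
  define X where "X b s g = excess K (h g) (thin T s \<Lambda> b)" for b s g
  define D where "D b s g = X b s g - 2 * X b (Suc s) g" for b s g
  define P where "P g = real (plurality (h g) \<Lambda>)" for g
  define B where "B = labels T \<Lambda>"
  have tot_mono: "tot G \<le> tot H" if "\<And>g. G g \<le> H g" for G H
    unfolding tot_def using that by (intro add_mono sum_mono mult_left_mono avg_mono) auto
  have tot_avg: "avg B (\<lambda>b. tot (G b)) = tot (\<lambda>g. avg B (\<lambda>b. G b g))" for G :: "('x \<Rightarrow> nat) \<Rightarrow> 'g \<Rightarrow> real"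
    unfolding tot_def by (simp add: avg_add avg_cmult avg_sum avg_swap[of B])
  have tot_cmult: "tot (\<lambda>g. c * G g) = c * tot G" for c G
    unfolding tot_def by (simp add: avg_cmult sum_distrib_left[symmetric] algebra_simps)
  have telescope: "dev (X b 0) = (\<Sum>s<m. 2 ^ s * dev (D b s)) + 2 ^ m * dev (X b m)" for b m
  proof (induction m)
    case (Suc m)
    have "dev (X b m) = dev (D b m) + 2 * dev (X b (Suc m))"
      unfolding dev_def D_def
      by (simp add: avg_diff avg_cmult sum_subtractf sum_distrib_left[symmetric] algebra_simps)
    with Suc show ?case by (simp add: distrib_left)
  qed simp
  have X0: "X b 0 = (\<lambda>g. excess K (h g) \<Lambda>)" if "b \<in> B" for b
  proof -
    have "thin T 0 \<Lambda> b = \<Lambda>" using that by (auto simp: thin_def B_def)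
    then show ?thesis by (simp add: X_def fun_eq_iff)
  qed
  define R where "R b = (\<Sum>s<T. 2 ^ s * (\<gamma> * tot (\<lambda>g. (D b s g)\<^sup>2) + u / \<gamma> * card (thin T s \<Lambda> b)))
      + 2 ^ T * (\<Sum>j\<in>J. X b T (w j))" for b
  have dev_R: "dev (\<lambda>g. excess K (h g) \<Lambda>) \<le> R b" if "b \<in> B" for b
  proof -
    have step: "dev (D b s) \<le> \<gamma> * tot (\<lambda>g. (D b s g)\<^sup>2) + u / \<gamma> * card (thin T s \<Lambda> b)" for s
    proof -
      have "(2::nat) ^ (T - Suc s) \<le> 2 ^ (T - s)" by (intro power_increasing) auto
      then have sub: "thin T (Suc s) \<Lambda> b \<subseteq> thin T s \<Lambda> b"
        unfolding thin_def by (intro Collect_mono) (metis less_le_trans)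
      have sub': "thin T s \<Lambda> b \<subseteq> \<Lambda>" by (auto simp: thin_def)
      show ?thesis
      proof (cases "thin T s \<Lambda> b = {}")
        case True
        \<comment> \<open>\<open>good\<close> speaks of nonempty lists only; here every term is
          0.\<close>
        then have "D b s g = 0" for g using sub K by (simp add: D_def X_def excess_empty)
        then show ?thesis using True by (simp add: dev_def tot_def avg_def)
      next
        case False
        have "D b s = (\<lambda>g. excess K (h g) (thin T s \<Lambda> b) - 2 * excess K (h g) (thin T (Suc s) \<Lambda> b))"
          by (simp add: D_def X_def fun_eq_iff)
        from good[OF sub' False sub this] show ?thesis
          by (simp add: dev_def tot_def)
      qed
    qed
    \<comment> \<open>The subtracted expectation is nonnegative and may be dropped: at the last
      level the uncentred sum is small enough on average over the labels.\<close>
    have "dev (X b T) \<le> (\<Sum>j\<in>J. X b T (w j))"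
      unfolding dev_def X_def by (simp add: avg_nonneg excess_nonneg)
    then have "dev (X b 0) \<le> R b"
      unfolding telescope[of b T] R_def
      using step by (intro add_mono sum_mono mult_left_mono) auto
    then show ?thesis using X0[OF that] by simp
  qed
  have "dev (\<lambda>g. excess K (h g) \<Lambda>) = avg B (\<lambda>_. dev (\<lambda>g. excess K (h g) \<Lambda>))"
    unfolding B_def by (simp only: avg_labels_const[OF \<Lambda>(1)])
  also have "\<dots> \<le> avg B R" by (intro avg_mono dev_R)
  also have "avg B R = (\<Sum>s<T. 2 ^ s * (\<gamma> * tot (\<lambda>g. avg B (\<lambda>b. (D b s g)\<^sup>2))
        + u / \<gamma> * avg B (\<lambda>b. card (thin T s \<Lambda> b)))) + 2 ^ T * (\<Sum>j\<in>J. avg B (\<lambda>b. X b T (w j)))"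
    unfolding R_def by (simp only: avg_add avg_cmult avg_sum tot_avg)
  also have "\<dots> \<le> (\<Sum>s<T. 6 * \<gamma> * K\<^sup>2 * tot P + u * card \<Lambda> / \<gamma>) + card J"
  proof (rule add_mono)
    show "(\<Sum>s<T. 2 ^ s * (\<gamma> * tot (\<lambda>g. avg B (\<lambda>b. (D b s g)\<^sup>2))
        + u / \<gamma> * avg B (\<lambda>b. card (thin T s \<Lambda> b)))) \<le> (\<Sum>s<T. 6 * \<gamma> * K\<^sup>2 * tot P + u * card \<Lambda> / \<gamma>)"
    proof (rule sum_mono)
      fix s assume "s \<in> {..<T}"
      then have s: "s < T" by simp
      have "tot (\<lambda>g. avg B (\<lambda>b. (D b s g)\<^sup>2)) \<le> tot (\<lambda>g. 6 * K\<^sup>2 / 2 ^ s * P g)"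
      proof (rule tot_mono)
        fix g
        show "avg B (\<lambda>b. (D b s g)\<^sup>2) \<le> 6 * K\<^sup>2 / 2 ^ s * P g"
          unfolding B_def D_def X_def P_def
          using avg_excess_halving_gap_square[OF \<Lambda>(1,2) s K, of "h g"] by simp
      qed
      also have "\<dots> = 6 * K\<^sup>2 / 2 ^ s * tot P" by (rule tot_cmult)
      finally have "\<gamma> * tot (\<lambda>g. avg B (\<lambda>b. (D b s g)\<^sup>2)) \<le> \<gamma> * (6 * K\<^sup>2 / 2 ^ s * tot P)"
        using \<gamma> by (intro mult_left_mono) auto
      moreover have "avg B (\<lambda>b. card (thin T s \<Lambda> b)) = card \<Lambda> / 2 ^ s"
        unfolding B_def using avg_card_thin[OF \<Lambda>(1)] s by simp
      ultimately have "2 ^ s * (\<gamma> * tot (\<lambda>g. avg B (\<lambda>b. (D b s g)\<^sup>2))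
          + u / \<gamma> * avg B (\<lambda>b. card (thin T s \<Lambda> b)))
          \<le> 2 ^ s * (\<gamma> * (6 * K\<^sup>2 / 2 ^ s * tot P) + u / \<gamma> * (card \<Lambda> / 2 ^ s))"
        by (intro mult_left_mono) auto
      also have "\<dots> = 6 * \<gamma> * K\<^sup>2 * tot P + u * card \<Lambda> / \<gamma>"
        by (simp add: field_simps)
      finally show "2 ^ s * (\<gamma> * tot (\<lambda>g. avg B (\<lambda>b. (D b s g)\<^sup>2))
          + u / \<gamma> * avg B (\<lambda>b. card (thin T s \<Lambda> b))) \<le> 6 * \<gamma> * K\<^sup>2 * tot P + u * card \<Lambda> / \<gamma>" .
    qed
    have "2 ^ T * (\<Sum>j\<in>J. avg B (\<lambda>b. X b T (w j))) \<le> 2 ^ T * (\<Sum>j\<in>J. 1 / 2 ^ T)"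
      unfolding B_def X_def using K
      by (intro mult_left_mono sum_mono avg_excess_last \<Lambda>) auto
    then show "2 ^ T * (\<Sum>j\<in>J. avg B (\<lambda>b. X b T (w j))) \<le> card J" by simp
  qed
  also have "\<dots> = 6 * \<gamma> * T * K\<^sup>2 * tot P + T * u * card \<Lambda> / \<gamma> + card J"
    by (simp add: algebra_simps)
  finally show ?thesis unfolding dev_def tot_def P_def .
qed

section \<open>Expected plurality from pairwise collisions\<close>

lemma sum_fibre_squares:
  assumes "finite \<Lambda>" "finite A" "\<phi> ` \<Lambda> \<subseteq> A"
  shows "(\<Sum>a\<in>A. (real (card {x\<in>\<Lambda>. \<phi> x = a}))\<^sup>2) = (\<Sum>x\<in>\<Lambda>. \<Sum>y\<in>\<Lambda>. of_bool (\<phi> x = \<phi> y))"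
proof -
  have c: "real (card {x\<in>\<Lambda>. \<phi> x = a}) = (\<Sum>x\<in>\<Lambda>. of_bool (\<phi> x = a))" for a
    using assms(1) by (simp add: of_bool_def sum.If_cases Int_def conj_commute)
  have "(\<Sum>a\<in>A. (real (card {x\<in>\<Lambda>. \<phi> x = a}))\<^sup>2)
      = (\<Sum>a\<in>A. \<Sum>x\<in>\<Lambda>. \<Sum>y\<in>\<Lambda>. of_bool (\<phi> x = a) * of_bool (\<phi> y = a))"
    unfolding c power2_eq_square sum_product ..
  also have "\<dots> = (\<Sum>x\<in>\<Lambda>. \<Sum>y\<in>\<Lambda>. \<Sum>a\<in>A. of_bool (\<phi> x = a) * of_bool (\<phi> y = a))"
    by (subst sum.swap) (intro sum.cong refl sum.swap)
  also have "\<dots> = (\<Sum>x\<in>\<Lambda>. \<Sum>y\<in>\<Lambda>. of_bool (\<phi> x = \<phi> y))"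
  proof (intro sum.cong refl)
    fix x y assume "x \<in> \<Lambda>" "y \<in> \<Lambda>"
    then have "(\<Sum>a\<in>A. of_bool (\<phi> x = a) * of_bool (\<phi> y = a))
        = (\<Sum>a\<in>{\<phi> x}. of_bool (\<phi> x = a) * of_bool (\<phi> y = a) :: real)"
      using assms by (intro sum.mono_neutral_right) auto
    then show "(\<Sum>a\<in>A. of_bool (\<phi> x = a) * of_bool (\<phi> y = a)) = (of_bool (\<phi> x = \<phi> y) :: real)"
      by (auto simp: of_bool_def)
  qed
  finally show ?thesis .
qed

text \<open>Messages may be linearly dependent, so only pairs are under control and the argument is
  one of second moments. The squared deviation of the largest fibre from L / q is at most the sum
  over all fibres, which is the number of colliding ordered pairs minus L^2 / q.\<close>

lemma avg_plurality_le_sqrt: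
  fixes h :: "'g \<Rightarrow> 'x \<Rightarrow> 'a"
  assumes \<Omega>: "finite \<Omega>" "\<Omega> \<noteq> {}" and \<Lambda>: "finite \<Lambda>" "\<Lambda> \<noteq> {}"
    and A: "finite A" "A \<noteq> {}" "\<And>g x. g \<in> \<Omega> \<Longrightarrow> x \<in> \<Lambda> \<Longrightarrow> h g x \<in> A"
    and coll: "\<And>x y. x \<in> \<Lambda> \<Longrightarrow> y \<in> \<Lambda> \<Longrightarrow> x \<noteq> y \<Longrightarrow> avg \<Omega> (\<lambda>g. of_bool (h g x = h g y)) \<le> 1 / card A"
  shows "avg \<Omega> (\<lambda>g. real (plurality (h g) \<Lambda>)) \<le> card \<Lambda> / card A + sqrt (card \<Lambda>)"
proof -
  define q where "q = real (card A)"
  define L where "L = real (card \<Lambda>)"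
  have q: "q > 0" using A by (simp add: q_def card_gt_0_iff)
  have L: "L > 0" using \<Lambda> by (simp add: L_def card_gt_0_iff)
  have 1: "(real (plurality (h g) \<Lambda>) - L / q)\<^sup>2 \<le> (\<Sum>x\<in>\<Lambda>. \<Sum>y\<in>\<Lambda>. of_bool (h g x = h g y)) - L\<^sup>2 / q"
    if g: "g \<in> \<Omega>" for g
  proof -
    define N where "N a = real (card {x\<in>\<Lambda>. h g x = a})" for a
    have im: "h g ` \<Lambda> \<subseteq> A" using A(3) g by auto
    obtain a where a: "a \<in> h g ` \<Lambda>" "plurality (h g) \<Lambda> = card {x\<in>\<Lambda>. h g x = a}"
      by (rule plurality_attained[OF \<Lambda>])
    have N: "(\<Sum>a\<in>A. N a) = L"
    proof -
      have "(\<Sum>a\<in>A. N a) = (\<Sum>a\<in>h g ` \<Lambda>. N a)"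
      proof (rule sum.mono_neutral_right[OF A(1) im], rule ballI)
        fix a assume "a \<in> A - h g ` \<Lambda>"
        then have "{x\<in>\<Lambda>. h g x = a} = {}" by auto
        then show "N a = 0" by (simp only: N_def card.empty of_nat_0)
      qed
      also have "\<dots> = L"
        unfolding N_def L_def using sum_card_fibres[OF \<Lambda>(1), of "h g"] by (metis of_nat_sum)
      finally show ?thesis .
    qed
    have "(N a - L / q)\<^sup>2 \<le> (\<Sum>a\<in>A. (N a - L / q)\<^sup>2)"
      using a(1) im A(1) by (intro member_le_sum) auto
    also have "\<dots> = (\<Sum>a\<in>A. (N a)\<^sup>2 - 2 * (L / q) * N a + (L / q)\<^sup>2)"
      by (simp add: power2_diff algebra_simps)
    also have "\<dots> = (\<Sum>a\<in>A. (N a)\<^sup>2) - 2 * (L / q) * (\<Sum>a\<in>A. N a) + q * (L / q)\<^sup>2"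
      by (simp only: sum.distrib sum_subtractf sum_distrib_left[symmetric] sum_constant q_def)
    also have "\<dots> = (\<Sum>a\<in>A. (N a)\<^sup>2) - 2 * (L / q) * L + q * (L / q)\<^sup>2"
      unfolding N ..
    also have "\<dots> = (\<Sum>a\<in>A. (N a)\<^sup>2) - L\<^sup>2 / q"
      using q by (simp add: power2_eq_square)
    finally show ?thesis
      unfolding N_def sum_fibre_squares[OF \<Lambda>(1) A(1) im] a(2) .
  qed
  \<comment> \<open>The 1/q is added on the diagonal as well, so that the sum over all pairs is L +
    L^2 / q and the term L^2 / q cancels exactly.\<close>
  have pair: "avg \<Omega> (\<lambda>g. of_bool (h g x = h g y)) \<le> of_bool (x = y) + 1 / q"
    if "x \<in> \<Lambda>" "y \<in> \<Lambda>" for x y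
    using coll[OF that] \<Omega> q by (cases "x = y") (auto simp: avg_const q_def)
  have "avg \<Omega> (\<lambda>g. (real (plurality (h g) \<Lambda>) - L / q)\<^sup>2)
      \<le> avg \<Omega> (\<lambda>g. (\<Sum>x\<in>\<Lambda>. \<Sum>y\<in>\<Lambda>. of_bool (h g x = h g y)) - L\<^sup>2 / q)"
    by (intro avg_mono 1)
  also have "\<dots> = (\<Sum>x\<in>\<Lambda>. \<Sum>y\<in>\<Lambda>. avg \<Omega> (\<lambda>g. of_bool (h g x = h g y))) - L\<^sup>2 / q"
    by (simp only: avg_diff avg_sum avg_const[OF \<Omega>])
  also have "\<dots> \<le> (\<Sum>x\<in>\<Lambda>. \<Sum>y\<in>\<Lambda>. of_bool (x = y) + 1 / q) - L\<^sup>2 / q"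
    by (intro diff_right_mono sum_mono pair)
  also have "\<dots> = L"
    using \<Lambda>(1) by (simp add: sum.distrib L_def power2_eq_square of_bool_def sum.delta distrib_left)
  finally have var: "avg \<Omega> (\<lambda>g. (real (plurality (h g) \<Lambda>) - L / q)\<^sup>2) \<le> L" .
  \<comment> \<open>In place of Cauchy-Schwarz, t \<le> c/2 + t^2 / (2 c) is averaged; c = sqrt L is
    the best choice for a mean square of L.\<close>
  define c where "c = sqrt L"
  have c: "c > 0" "c\<^sup>2 = L" using L by (auto simp: c_def)
  have "avg \<Omega> (\<lambda>g. real (plurality (h g) \<Lambda>))
      \<le> avg \<Omega> (\<lambda>g. L / q + c / 2 + (real (plurality (h g) \<Lambda>) - L / q)\<^sup>2 / (2 * c))"
  proof (rule avg_mono)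
    fix g
    define t where "t = real (plurality (h g) \<Lambda>) - L / q"
    have "0 \<le> (t - c)\<^sup>2 / (2 * c)" using c by simp
    also have "\<dots> = t\<^sup>2 / (2 * c) - t + c / 2" using c(1) by (simp add: power2_eq_square field_simps)
    finally show "real (plurality (h g) \<Lambda>) \<le> L / q + c / 2 + (real (plurality (h g) \<Lambda>) - L / q)\<^sup>2 / (2 * c)"
      by (simp add: t_def)
  qed
  also have "\<dots> = L / q + c / 2 + avg \<Omega> (\<lambda>g. (real (plurality (h g) \<Lambda>) - L / q)\<^sup>2) / (2 * c)"
    by (simp only: avg_add avg_divide avg_const[OF \<Omega>])
  also have "\<dots> \<le> L / q + c / 2 + L / (2 * c)"
    using var c by (intro add_left_mono divide_right_mono) auto
  also have "L / (2 * c) = c / 2" using c by (simp add: power2_eq_square field_simps)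
  finally show ?thesis by (simp add: L_def q_def c_def)
qed

text \<open>All other points with the most frequent symbol collide with one fixed point that has it,
  so the plurality exceeds 1 by at most the number of colliding ordered pairs. This improves on the
  square root when |\<Lambda>|^2 p stays bounded, as for a large alphabet.\<close>

lemma avg_plurality_le_collisions:
  fixes h :: "'g \<Rightarrow> 'x \<Rightarrow> 'a" and p :: real
  assumes \<Omega>: "finite \<Omega>" "\<Omega> \<noteq> {}" and \<Lambda>: "finite \<Lambda>" "\<Lambda> \<noteq> {}" and "p \<ge> 0"
    and coll: "\<And>x y. x \<in> \<Lambda> \<Longrightarrow> y \<in> \<Lambda> \<Longrightarrow> x \<noteq> y \<Longrightarrow> avg \<Omega> (\<lambda>g. of_bool (h g x = h g y)) \<le> p"
  shows "avg \<Omega> (\<lambda>g. real (plurality (h g) \<Lambda>)) \<le> 1 + (card \<Lambda>)\<^sup>2 * p"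
proof -
  have "avg \<Omega> (\<lambda>g. real (plurality (h g) \<Lambda>))
      \<le> avg \<Omega> (\<lambda>g. 1 + (\<Sum>x\<in>\<Lambda>. \<Sum>y\<in>\<Lambda> - {x}. of_bool (h g x = h g y)))"
  proof (rule avg_mono)
    fix g
    obtain a where a: "a \<in> h g ` \<Lambda>" "plurality (h g) \<Lambda> = card {x\<in>\<Lambda>. h g x = a}"
      by (rule plurality_attained[OF \<Lambda>])
    then obtain x where x: "x \<in> \<Lambda>" "a = h g x" by auto
    have "real (card {y\<in>\<Lambda>. h g y = h g x}) = (\<Sum>y\<in>\<Lambda>. of_bool (h g x = h g y))"
      using \<Lambda>(1) by (simp add: of_bool_def sum.If_cases Int_def conj_commute eq_commute)
    also have "\<dots> = of_bool (h g x = h g x) + (\<Sum>y\<in>\<Lambda> - {x}. of_bool (h g x = h g y))"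
      by (rule sum.remove[OF \<Lambda>(1) x(1)])
    also have "of_bool (h g x = h g x) = (1::real)" by simp
    also have "(\<Sum>y\<in>\<Lambda> - {x}. of_bool (h g x = h g y))
        \<le> (\<Sum>x\<in>\<Lambda>. \<Sum>y\<in>\<Lambda> - {x}. of_bool (h g x = h g y) :: real)"
      using \<Lambda>(1) x
      by (intro member_le_sum[of x \<Lambda> "\<lambda>x. \<Sum>y\<in>\<Lambda> - {x}. of_bool (h g x = h g y)"]) (auto intro: sum_nonneg)
    finally show "real (plurality (h g) \<Lambda>) \<le> 1 + (\<Sum>x\<in>\<Lambda>. \<Sum>y\<in>\<Lambda> - {x}. of_bool (h g x = h g y))"
      using a(2) x(2) by simp
  qed
  also have "\<dots> = 1 + (\<Sum>x\<in>\<Lambda>. \<Sum>y\<in>\<Lambda> - {x}. avg \<Omega> (\<lambda>g. of_bool (h g x = h g y)))"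
    by (simp only: avg_add avg_sum avg_const[OF \<Omega>])
  also have "\<dots> \<le> 1 + (\<Sum>x\<in>\<Lambda>. \<Sum>y\<in>\<Lambda> - {x}. p)"
    by (intro add_left_mono sum_mono coll) auto
  also have "\<dots> \<le> 1 + (\<Sum>x\<in>\<Lambda>. \<Sum>y\<in>\<Lambda>. p)"
    using \<Lambda>(1) assms(5) by (intro add_left_mono sum_mono sum_mono2) auto
  also have "\<dots> = 1 + (card \<Lambda>)\<^sup>2 * p" by (simp add: power2_eq_square)
  finally show ?thesis .
qed

text \<open>A Chernoff bound at the fixed parameter 1/K, from exp y \<le> 1 + 2 y on [0, 1]. Losing
  a factor 2 on the mean is harmless where only the order of magnitude matters, and leaves an
  exponent independent of the mean.\<close>

lemma bounded_sum_tail: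
  fixes Y :: "'g \<Rightarrow> real" and K m :: real
  assumes "finite J" "finite \<Omega>" "\<Omega> \<noteq> {}" "K > 0"
    and Y: "\<And>g. 0 \<le> Y g" "\<And>g. Y g \<le> K" and m: "avg \<Omega> Y \<le> m"
  shows "avg (J \<rightarrow>\<^sub>E \<Omega>) (\<lambda>w. of_bool ((\<Sum>j\<in>J. Y (w j)) > (2 * m + 1) * card J)) \<le> exp (- (card J / K))"
proof -
  have "avg \<Omega> (\<lambda>g. exp (Y g / K)) \<le> avg \<Omega> (\<lambda>g. 1 + 2 / K * Y g)"
  proof (rule avg_mono)
    fix g
    define y where "y = Y g / K"
    have y: "0 \<le> y" "y \<le> 1" using Y[of g] assms(4) by (auto simp: y_def)
    have "exp y \<le> 1 + y + y\<^sup>2" by (rule exp_bound[OF y])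
    also have "y\<^sup>2 \<le> y" using y by (simp add: power2_eq_square mult_left_le)
    finally show "exp (Y g / K) \<le> 1 + 2 / K * Y g" by (simp add: y_def)
  qed
  also have "\<dots> = 1 + 2 / K * avg \<Omega> Y"
    by (simp only: avg_add avg_cmult avg_const[OF assms(2,3)])
  also have "\<dots> \<le> 1 + 2 / K * m"
    using m assms(4) by (intro add_left_mono mult_left_mono) auto
  also have "\<dots> \<le> exp (2 * m / K)" using exp_ge_add_one_self[of "2 * m / K"] by simp
  finally have mgf: "avg \<Omega> (\<lambda>g. exp (Y g / K)) \<le> exp (2 * m / K)" .
  have "avg (J \<rightarrow>\<^sub>E \<Omega>) (\<lambda>w. exp (\<Sum>j\<in>J. Y (w j) / K)) = avg \<Omega> (\<lambda>g. exp (Y g / K)) ^ card J"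
    by (rule avg_PiE_exp_sum[OF assms(1-3) subset_refl])
  also have "\<dots> \<le> exp (2 * m / K) ^ card J" by (intro power_mono mgf avg_nonneg) auto
  also have "\<dots> = exp (card J * (2 * m / K))" by (simp only: exp_of_nat_mult)
  finally have "avg (J \<rightarrow>\<^sub>E \<Omega>) (\<lambda>w. of_bool ((\<Sum>j\<in>J. Y (w j) / K) > (2 * m + 1) * card J / K))
      \<le> exp (card J * (2 * m / K)) * exp (- ((2 * m + 1) * card J / K))"
    by (rule avg_exp_markov)
  also have "\<dots> = exp (- (card J / K))"
    unfolding exp_add[symmetric] using assms(4) by (simp add: field_simps)
  finally show ?thesis
    using assms(4) by (simp add: sum_divide_distrib[symmetric] divide_less_cancel)
qed

section \<open>Bounds uniform over all lists of one size\<close>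

lemma uniform_chaining:
  fixes h :: "'g \<Rightarrow> 'x \<Rightarrow> 'a" and K \<gamma> :: real
  assumes V: "finite V" "card V \<ge> 2" and \<Omega>: "finite \<Omega>" "\<Omega> \<noteq> {}" and J: "finite J"
    and L: "1 \<le> L" "L \<le> 2 ^ T" and K: "K \<ge> 1" "288 * real L * exp (- K / 2) \<le> 1" and \<gamma>: "\<gamma> > 0"
  shows "avg (J \<rightarrow>\<^sub>E \<Omega>) (\<lambda>w. of_bool (\<exists>\<Lambda>\<subseteq>V. card \<Lambda> = L \<and>
      (\<Sum>j\<in>J. excess K (h (w j)) \<Lambda>) - card J * avg \<Omega> (\<lambda>g. excess K (h g) \<Lambda>)
      > 6 * \<gamma> * T * K\<^sup>2 * ((\<Sum>j\<in>J. real (plurality (h (w j)) \<Lambda>))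
        + card J * avg \<Omega> (\<lambda>g. real (plurality (h g) \<Lambda>)))
        + T * (6 * ln (card V)) * L / \<gamma> + card J)) \<le> 1 / 8"
    (is "avg ?W (\<lambda>w. of_bool (?bad w)) \<le> _")
proof -
  define D where "D \<Lambda> \<Lambda>' g = excess K (h g) \<Lambda> - 2 * excess K (h g) \<Lambda>'" for \<Lambda> \<Lambda>' g
  let ?P = "\<lambda>w. \<exists>\<Lambda>\<in>Pow V - {{}}. \<exists>\<Lambda>'\<in>Pow \<Lambda>.
      (\<Sum>j\<in>J. D \<Lambda> \<Lambda>' (w j)) - card J * avg \<Omega> (D \<Lambda> \<Lambda>')
      > \<gamma> * ((\<Sum>j\<in>J. (D \<Lambda> \<Lambda>' (w j))\<^sup>2) + card J * avg \<Omega> (\<lambda>g. (D \<Lambda> \<Lambda>' g)\<^sup>2))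
        + 6 * ln (card V) * card \<Lambda> / \<gamma>"
  \<comment> \<open>Outside the event of \<open>uniform_self_normalized_tail\<close>, every pair of
    nested lists satisfies the hypothesis \<open>good\<close> of \<open>chaining_bound\<close> with
    u = 6 ln |V|.\<close>
  have "?P w" if "?bad w" for w
  proof (rule ccontr)
    assume good: "\<not> ?P w"
    from that obtain \<Lambda> where \<Lambda>: "\<Lambda> \<subseteq> V" "card \<Lambda> = L" and gt:
      "(\<Sum>j\<in>J. excess K (h (w j)) \<Lambda>) - card J * avg \<Omega> (\<lambda>g. excess K (h g) \<Lambda>)
      > 6 * \<gamma> * T * K\<^sup>2 * ((\<Sum>j\<in>J. real (plurality (h (w j)) \<Lambda>))
        + card J * avg \<Omega> (\<lambda>g. real (plurality (h g) \<Lambda>)))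
        + T * (6 * ln (card V)) * L / \<gamma> + card J" by blast
    have fin: "finite \<Lambda>" using \<Lambda>(1) V(1) by (rule finite_subset)
    have ne: "\<Lambda> \<noteq> {}" using \<Lambda>(2) L(1) by auto
    have "(\<Sum>j\<in>J. excess K (h (w j)) \<Lambda>) - card J * avg \<Omega> (\<lambda>g. excess K (h g) \<Lambda>)
      \<le> 6 * \<gamma> * T * K\<^sup>2 * ((\<Sum>j\<in>J. real (plurality (h (w j)) \<Lambda>))
        + card J * avg \<Omega> (\<lambda>g. real (plurality (h g) \<Lambda>)))
        + T * (6 * ln (card V)) * card \<Lambda> / \<gamma> + card J"
    proof (rule chaining_bound[OF \<Omega> fin ne])
      fix \<Lambda>1 \<Lambda>2 D'
      assume sub: "\<Lambda>1 \<subseteq> \<Lambda>" "\<Lambda>1 \<noteq> {}" "\<Lambda>2 \<subseteq> \<Lambda>1"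
        and D': "D' = (\<lambda>g. excess K (h g) \<Lambda>1 - 2 * excess K (h g) \<Lambda>2)"
      have "D' = D \<Lambda>1 \<Lambda>2" by (simp add: D' D_def fun_eq_iff)
      moreover have "\<Lambda>1 \<in> Pow V - {{}}" "\<Lambda>2 \<in> Pow \<Lambda>1" using sub \<Lambda>(1) by auto
      ultimately show "(\<Sum>j\<in>J. D' (w j)) - card J * avg \<Omega> D'
        \<le> \<gamma> * ((\<Sum>j\<in>J. (D' (w j))\<^sup>2) + card J * avg \<Omega> (\<lambda>g. (D' g)\<^sup>2)) + 6 * ln (card V) * card \<Lambda>1 / \<gamma>"
        using good by (meson not_le)
    qed (use L K \<gamma> \<Lambda>(2) in auto)
    with gt show False unfolding \<Lambda>(2) by linarith
  qed
  then have "avg ?W (\<lambda>w. of_bool (?bad w)) \<le> avg ?W (\<lambda>w. of_bool (?P w))"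
    by (intro avg_mono) auto
  also have "\<dots> \<le> 1 / 8" by (rule uniform_self_normalized_tail[OF V \<Omega> J \<gamma>])
  finally show ?thesis .
qed

text \<open>The second inequality is K \<le> 1/\<epsilon> for the threshold K = 20
  log(1/\<epsilon>). At \<epsilon> = 1/256 it reads 160 \<le> 256; in terms of z = 1 / (256
  \<epsilon>) the left side grows at most like 40 z and the right side like 256 z.\<close>

lemma log_inverse_bounds:
  fixes \<epsilon> :: real
  assumes "0 < \<epsilon>" "\<epsilon> \<le> 1 / 256"
  shows "8 \<le> log 2 (1 / \<epsilon>)" "20 * log 2 (1 / \<epsilon>) \<le> 1 / \<epsilon>"
proof -
  define z where "z = 1 / (256 * \<epsilon>)"
  have z: "z \<ge> 1" using assms by (simp add: z_def field_simps)
  have "1 / \<epsilon> = 2 ^ 8 * z" using assms by (simp add: z_def)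
  then have "log 2 (1 / \<epsilon>) = log 2 (2 ^ 8) + log 2 z" using z by (simp add: log_mult)
  also have "log 2 ((2::real) ^ 8) = 8" by (subst log_pow_cancel) auto
  finally have l: "log 2 (1 / \<epsilon>) = 8 + log 2 z" .
  have "0 \<le> log 2 z" using z by simp
  with l show "8 \<le> log 2 (1 / \<epsilon>)" by simp
  have "ln z \<le> z - 1" using z by (intro ln_le_minus_one) auto
  also have "\<dots> \<le> 2 * (z - 1) * ln 2"
  proof -
    have "(z - 1) * 1 \<le> (z - 1) * (2 * ln 2)" using z ln2_ge_two_thirds by (intro mult_left_mono) auto
    then show ?thesis by (simp only: mult_ac mult_1_left mult_1_right)
  qed
  finally have "log 2 z \<le> 2 * (z - 1)" by (simp add: log_def divide_le_eq)
  with l have "20 * log 2 (1 / \<epsilon>) \<le> 120 + 40 * z" by simp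
  also have "\<dots> \<le> 256 * z" using z by simp
  also have "\<dots> = 1 / \<epsilon>" using assms by (simp add: z_def)
  finally show "20 * log 2 (1 / \<epsilon>) \<le> 1 / \<epsilon>" .
qed

text \<open>About 2 log(1/\<epsilon>) halvings exhaust a list of 2 / \<epsilon>^2 messages. With K =
  20 l the factor exp (-K/2) is at most \<epsilon>^10, which outweighs 288 L \<le> 576 /
  \<epsilon>^2.\<close>

lemma chain_parameters:
  fixes \<epsilon> l :: real
  assumes "0 < \<epsilon>" "\<epsilon> \<le> 1 / 256" "real L \<le> 2 / \<epsilon>\<^sup>2"
    and l_def: "l = log 2 (1 / \<epsilon>)"
  obtains T :: nat where "T \<ge> 1" "T \<le> 3 * l" "L \<le> 2 ^ T"
    "288 * real L * exp (- (20 * l) / 2) \<le> 1"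
proof -
  have l: "l \<ge> 8" using log_inverse_bounds(1)[OF assms(1,2)] by (simp add: l_def)
  \<comment> \<open>The extra 1 pays for the factor 2 in 2 / \<epsilon>^2.\<close>
  define T where "T = nat \<lceil>2 * l\<rceil> + 1"
  have "real (nat \<lceil>2 * l\<rceil>) = of_int \<lceil>2 * l\<rceil>" using l by (intro of_nat_nat) simp
  then have T: "2 * l + 1 \<le> T" "T \<le> 2 * l + 2"
    using le_of_int_ceiling[of "2 * l"] of_int_ceiling_le_add_one[of "2 * l"]
    unfolding T_def of_nat_add of_nat_1 by linarith+
  have el: "2 powr l = 1 / \<epsilon>" using assms(1) by (simp add: l_def)
  have "real L \<le> 2 / \<epsilon>\<^sup>2" by (rule assms(3))
  also have "\<dots> = 2 powr (2 * l + 1)"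
  proof -
    have "2 powr (2 * l + 1) = 2 powr (l + l + 1)" by simp
    also have "\<dots> = 1 / \<epsilon> * (1 / \<epsilon>) * 2" unfolding powr_add el by simp
    finally show ?thesis by (simp add: power2_eq_square)
  qed
  also have "\<dots> \<le> 2 powr T" using T by (intro powr_mono) auto
  also have "\<dots> = real (2 ^ T)" by (simp add: powr_realpow)
  finally have "L \<le> 2 ^ T" by (simp only: of_nat_le_iff)
  moreover have "288 * real L * exp (- (20 * l) / 2) \<le> 1"
  proof -
    have "exp (- (20 * l) / 2) = exp (- l) ^ 10" by (simp add: exp_of_nat_mult[symmetric])
    also have "exp (- l) \<le> \<epsilon>"
    proof -
      have "ln (1 / \<epsilon>) \<le> l"
      proof -
        have "ln (1 / \<epsilon>) * ln 2 \<le> ln (1 / \<epsilon>) * 1"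
          using assms(1,2) ln_2_less_1 by (intro mult_left_mono) auto
        then show ?thesis by (simp add: l_def log_def le_divide_eq)
      qed
      then have "- l \<le> ln \<epsilon>" using assms(1) by (simp add: ln_div)
      then have "exp (- l) \<le> exp (ln \<epsilon>)" by (simp only: exp_le_cancel_iff)
      then show ?thesis using assms(1) by simp
    qed
    then have "exp (- l) ^ 10 \<le> \<epsilon> ^ 10" by (intro power_mono) auto
    finally have "288 * real L * exp (- (20 * l) / 2) \<le> 288 * (2 / \<epsilon>\<^sup>2) * \<epsilon> ^ 10"
      using assms(3) by (intro mult_mono) auto
    also have "\<epsilon> ^ 10 = \<epsilon>\<^sup>2 * \<epsilon> ^ 8" by (simp add: power_add[symmetric])
    also have "288 * (2 / \<epsilon>\<^sup>2) * (\<epsilon>\<^sup>2 * \<epsilon> ^ 8) = 576 * (\<epsilon>\<^sup>2 / \<epsilon>\<^sup>2) * \<epsilon> ^ 8" by (simp only: mult_ac times_divide_eq_right times_divide_eq_left) simp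
    also have "\<epsilon>\<^sup>2 / \<epsilon>\<^sup>2 = 1" using assms(1) by simp
    also have "576 * 1 * \<epsilon> ^ 8 \<le> 576 * (1 / 256) ^ 8" using power_mono[of \<epsilon> "1 / 256" 8] assms(1,2) by simp
    also have "\<dots> \<le> 1" by (simp add: power_divide)
    finally show ?thesis .
  qed
  moreover have "T \<ge> 1" by (simp add: T_def)
  moreover have "T \<le> 3 * l" using T l by linarith
  ultimately show ?thesis by (intro that)
qed

lemma plurality_le_excess: "real (plurality \<phi> \<Lambda>) \<le> excess K \<phi> \<Lambda> + K"
  by (simp add: excess_def)

lemma excess_le_plurality: "K \<ge> 0 \<Longrightarrow> excess K \<phi> \<Lambda> \<le> real (plurality \<phi> \<Lambda>)"
  by (simp add: excess_def)

text \<open>Let x be the sum of the pluralities and E = n L (1/q + \<epsilon>) the bound on its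
  mean. Chaining gives x - E \<le> r (x - E) + 2 r E + n K + R + n, where each of the last four
  terms is at most n L \<epsilon>. As r \<le> 1/2, x - E \<le> 8 n L \<epsilon>; together with the
  \<epsilon> in E this makes the 9.\<close>

lemma uniform_plurality_bound:
  fixes h :: "'g \<Rightarrow> 'x \<Rightarrow> 'a" and \<epsilon> :: real
  assumes V: "finite V" "card V \<ge> 2" and \<Omega>: "finite \<Omega>" "\<Omega> \<noteq> {}" and J: "finite J"
    and A: "finite A" "A \<noteq> {}" "\<And>g x. g \<in> \<Omega> \<Longrightarrow> x \<in> V \<Longrightarrow> h g x \<in> A"
    and coll: "\<And>x y. x \<in> V \<Longrightarrow> y \<in> V \<Longrightarrow> x \<noteq> y \<Longrightarrow> avg \<Omega> (\<lambda>g. of_bool (h g x = h g y)) \<le> 1 / card A"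
    and \<epsilon>: "0 < \<epsilon>" "\<epsilon> \<le> 1 / 256" and L: "1 / \<epsilon>\<^sup>2 \<le> L" "L \<le> 2 / \<epsilon>\<^sup>2"
    and n_ge: "259200 * ln (card V) * log 2 (1 / \<epsilon>) ^ 4 * ((1 / card A + \<epsilon>) / \<epsilon>\<^sup>2) \<le> card J"
  shows "avg (J \<rightarrow>\<^sub>E \<Omega>) (\<lambda>w. of_bool (\<exists>\<Lambda>\<subseteq>V. card \<Lambda> = L \<and>
      (\<Sum>j\<in>J. real (plurality (h (w j)) \<Lambda>)) > card J * (L * (1 / card A + 9 * \<epsilon>)))) \<le> 1 / 8"
    (is "avg ?W (\<lambda>w. of_bool (?bad w)) \<le> _")
proof -
  define l where "l = log 2 (1 / \<epsilon>)"
  define K where "K = 20 * l"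
  define \<theta> where "\<theta> = 1 / card A + \<epsilon>"
  obtain T :: nat where T: "T \<ge> 1" "T \<le> 3 * l" "L \<le> 2 ^ T" "288 * real L * exp (- (20 * l) / 2) \<le> 1"
    by (rule chain_parameters[OF \<epsilon> L(2) l_def])
  note T = T[folded K_def]
  have l: "l \<ge> 8" "K \<le> 1 / \<epsilon>" using log_inverse_bounds[OF \<epsilon>] by (auto simp: l_def K_def)
  have K: "K \<ge> 1" using l by (simp add: K_def)
  have \<theta>: "\<theta> \<ge> \<epsilon>" "\<theta> > 0" using \<epsilon> by (auto simp: \<theta>_def add_nonneg_pos)
  have Lpos: "real L > 0" 
  proof -
    have "1 / \<epsilon>\<^sup>2 > 0" using \<epsilon> by simp
    then show ?thesis using L(1) by linarith
  qed
  have Le: "real L * \<epsilon> \<ge> 1 / \<epsilon>"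
    using mult_right_mono[OF L(1), of \<epsilon>] \<epsilon> by (simp add: power2_eq_square)
  have e1: "1 / \<epsilon> \<ge> 1" using \<epsilon> by simp
  \<comment> \<open>The lower bound on L enters here: it brings the sqrt L of the expected plurality
    down to the order L \<epsilon> of the tolerated deviation.\<close>
  have sq: "sqrt L \<le> L * \<epsilon>"
  proof -
    have "real L * 1 \<le> L * (L * \<epsilon>\<^sup>2)" using L(1) \<epsilon> Lpos by (intro mult_left_mono) (auto simp: field_simps)
    then have "real L \<le> (L * \<epsilon>)\<^sup>2" by (simp add: power2_eq_square mult_ac)
    then show ?thesis using \<epsilon> by (intro real_le_lsqrt) auto
  qed
  \<comment> \<open>balances the two error terms of the chaining bound\<close>
  define \<gamma> where "\<gamma> = \<epsilon> / (12 * T * K\<^sup>2 * \<theta>)"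
  have \<gamma>: "\<gamma> > 0" using \<epsilon> T(1) K \<theta> by (simp add: \<gamma>_def)
  define r where "r = \<epsilon> / (2 * \<theta>)"
  have r: "6 * \<gamma> * T * K\<^sup>2 = r" using T(1) K \<theta> by (simp add: \<gamma>_def r_def field_simps)
  have r2: "0 \<le> r" "r \<le> 1 / 2" using \<theta> \<epsilon> by (auto simp: r_def field_simps)
  define n where "n = real (card J)"
  define R where "R = T * (6 * ln (card V)) * L / \<gamma>"
  have R: "R \<le> n * (L * \<epsilon>)"
  proof -
    have lnV: "ln (card V) \<ge> 0" using V(2) by simp
    have "real T * K \<le> 3 * l * (20 * l)" unfolding K_def using T(2) l by (intro mult_mono) auto
    then have "(T * K)\<^sup>2 \<le> (60 * l\<^sup>2)\<^sup>2"
      using K by (intro power_mono) (auto simp: power2_eq_square)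
    \<comment> \<open>The fourth power of the logarithm: two factors come from the number of levels,
      two from the threshold.\<close>
    then have TK: "real T ^ 2 * K\<^sup>2 \<le> 3600 * l ^ 4" by (simp add: power_mult_distrib)
    have "R = 72 * ln (card V) * (\<theta> / \<epsilon>\<^sup>2) * (L * \<epsilon>) * (real T ^ 2 * K\<^sup>2)"
      using T(1) K \<theta> \<epsilon> by (simp add: R_def \<gamma>_def field_simps power2_eq_square)
    also have "\<dots> \<le> 72 * ln (card V) * (\<theta> / \<epsilon>\<^sup>2) * (L * \<epsilon>) * (3600 * l ^ 4)"
      using TK lnV \<theta> \<epsilon> by (intro mult_left_mono) auto
    also have "\<dots> = (259200 * ln (card V) * l ^ 4 * (\<theta> / \<epsilon>\<^sup>2)) * (L * \<epsilon>)" by simp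
    also have "\<dots> \<le> n * (L * \<epsilon>)"
      using n_ge \<epsilon> by (intro mult_right_mono) (auto simp: l_def \<theta>_def n_def)
    finally show ?thesis .
  qed
  have bad: "\<exists>\<Lambda>\<subseteq>V. card \<Lambda> = L \<and>
      (\<Sum>j\<in>J. excess K (h (w j)) \<Lambda>) - card J * avg \<Omega> (\<lambda>g. excess K (h g) \<Lambda>)
      > 6 * \<gamma> * T * K\<^sup>2 * ((\<Sum>j\<in>J. real (plurality (h (w j)) \<Lambda>))
        + card J * avg \<Omega> (\<lambda>g. real (plurality (h g) \<Lambda>)))
        + T * (6 * ln (card V)) * L / \<gamma> + card J" if "?bad w" for w
  proof -
    from that obtain \<Lambda> where \<Lambda>: "\<Lambda> \<subseteq> V" "card \<Lambda> = L"
      and gt: "(\<Sum>j\<in>J. real (plurality (h (w j)) \<Lambda>)) > n * (L * (1 / card A + 9 * \<epsilon>))"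
      unfolding n_def by blast
    have fin: "finite \<Lambda>" "\<Lambda> \<noteq> {}" using finite_subset[OF \<Lambda>(1) V(1)] \<Lambda>(2) Lpos by auto
    define x where "x = (\<Sum>j\<in>J. real (plurality (h (w j)) \<Lambda>))"
    define X where "X = (\<Sum>j\<in>J. excess K (h (w j)) \<Lambda>)"
    define p where "p = avg \<Omega> (\<lambda>g. real (plurality (h g) \<Lambda>))"
    define f where "f = avg \<Omega> (\<lambda>g. excess K (h g) \<Lambda>)"
    have "x \<le> (\<Sum>j\<in>J. excess K (h (w j)) \<Lambda> + K)"
      unfolding x_def by (intro sum_mono plurality_le_excess)
    then have xX: "x \<le> X + n * K" by (simp add: X_def sum.distrib n_def)
    have fp: "f \<le> p" unfolding f_def p_def using K by (intro avg_mono excess_le_plurality) auto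
    have "p \<le> card \<Lambda> / card A + sqrt (card \<Lambda>)"
      unfolding p_def using \<Lambda>(1) by (intro avg_plurality_le_sqrt \<Omega> fin A coll) auto
    then have p: "p \<le> L * \<theta>" using sq by (simp add: \<Lambda>(2) \<theta>_def algebra_simps)
    have n0: "n \<ge> 0" by (simp add: n_def)
    have "X - n * f > r * (x + n * p) + R + n"
    proof (rule ccontr)
      assume "\<not> ?thesis"
      then have le: "X - n * f \<le> r * (x + n * p) + R + n" by simp
      define E where "E = n * (L * \<theta>)"
      have nf: "n * f \<le> E" unfolding E_def using fp p n0 by (intro mult_left_mono) auto
      have np: "n * p \<le> E" unfolding E_def using p n0 by (intro mult_left_mono) auto
      have "x - E \<le> r * (x - E) + 2 * (r * E) + n * K + R + n"
      proof -
        have "r * (n * p) \<le> r * E" using np r2 by (intro mult_left_mono) auto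
        then show ?thesis using le xX nf by (simp add: algebra_simps)
      qed
      moreover have rE: "2 * (r * E) = n * (L * \<epsilon>)" using \<theta> by (simp add: r_def E_def)
      \<comment> \<open>The cutoff costs K per column, which is affordable because K \<le>
        1/\<epsilon> \<le> L \<epsilon>.\<close>
      moreover have "n * K \<le> n * (L * \<epsilon>)" using l(2) Le n0 by (intro mult_left_mono) auto
      moreover have "n * 1 \<le> n * (L * \<epsilon>)" using e1 Le n0 by (intro mult_left_mono) auto
      ultimately have 1: "x - E \<le> r * (x - E) + 4 * (n * (L * \<epsilon>))" using R by linarith
      have 0: "n * (L * \<epsilon>) \<ge> 0" using n0 \<epsilon> by simp
      have half: "d \<le> 8 * M" if "d \<le> r * d + 4 * M" "M \<ge> 0" for d M
      proof (cases "d \<ge> 0")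
        case True
        then have "r * d \<le> 1 / 2 * d" using r2 by (intro mult_right_mono) auto
        with that show ?thesis by linarith
      qed (use that in linarith)
      have "x - E \<le> 8 * (n * (L * \<epsilon>))" by (rule half[OF 1 0])
      then show False using gt by (simp add: x_def E_def \<theta>_def algebra_simps)
    qed
    then show ?thesis
      using \<Lambda> unfolding r R_def[symmetric] x_def X_def p_def f_def n_def
      by (intro exI[of _ \<Lambda>] conjI)
  qed
  have "avg ?W (\<lambda>w. of_bool (?bad w)) \<le> avg ?W (\<lambda>w. of_bool (\<exists>\<Lambda>\<subseteq>V. card \<Lambda> = L \<and>
      (\<Sum>j\<in>J. excess K (h (w j)) \<Lambda>) - card J * avg \<Omega> (\<lambda>g. excess K (h g) \<Lambda>)
      > 6 * \<gamma> * T * K\<^sup>2 * ((\<Sum>j\<in>J. real (plurality (h (w j)) \<Lambda>))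
        + card J * avg \<Omega> (\<lambda>g. real (plurality (h g) \<Lambda>)))
        + T * (6 * ln (card V)) * L / \<gamma> + card J))"
  proof (rule avg_mono)
    fix w show "of_bool (?bad w) \<le> (of_bool (\<exists>\<Lambda>\<subseteq>V. card \<Lambda> = L \<and>
      (\<Sum>j\<in>J. excess K (h (w j)) \<Lambda>) - card J * avg \<Omega> (\<lambda>g. excess K (h g) \<Lambda>)
      > 6 * \<gamma> * T * K\<^sup>2 * ((\<Sum>j\<in>J. real (plurality (h (w j)) \<Lambda>))
        + card J * avg \<Omega> (\<lambda>g. real (plurality (h g) \<Lambda>)))
        + T * (6 * ln (card V)) * L / \<gamma> + card J) :: real)"
      using bad[of w] by (cases "?bad w"; simp only: of_bool_eq) simp_all
  qed
  also have "\<dots> \<le> 1 / 8"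
    using Lpos by (intro uniform_chaining V \<Omega> J T K \<gamma>) linarith
  finally show ?thesis .
qed

text \<open>Below the cutoff a plain union bound over the lists of size L is affordable: a summand
  is at most K, so the tail exp (-n/K) only has to beat |V|^(-6 L).\<close>

lemma uniform_truncated_plurality_bound:
  fixes h :: "'g \<Rightarrow> 'x \<Rightarrow> 'a" and K m :: real
  assumes V: "finite V" "card V \<ge> 2" and \<Omega>: "finite \<Omega>" "\<Omega> \<noteq> {}" and J: "finite J"
    and "K > 0" "L \<ge> 1" and n: "6 * ln (card V) * L * K \<le> card J"
    and m: "\<And>\<Lambda>. \<Lambda> \<subseteq> V \<Longrightarrow> card \<Lambda> = L \<Longrightarrow> avg \<Omega> (\<lambda>g. real (plurality (h g) \<Lambda>)) \<le> m"
  shows "avg (J \<rightarrow>\<^sub>E \<Omega>) (\<lambda>w. of_bool (\<exists>\<Lambda>\<subseteq>V. card \<Lambda> = L \<and>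
      (\<Sum>j\<in>J. min (real (plurality (h (w j)) \<Lambda>)) K) > (2 * m + 1) * card J)) \<le> 1 / 8"
    (is "avg ?W (\<lambda>w. of_bool (\<exists>\<Lambda>\<subseteq>V. _ \<and> ?P \<Lambda> w)) \<le> _")
proof -
  define I where "I = {\<Lambda>. \<Lambda> \<subseteq> V \<and> card \<Lambda> = L}"
  have I: "I \<subseteq> Pow V - {{}}" using assms(7) by (auto simp: I_def)
  then have fI: "finite I" using V(1) by (auto intro: finite_subset)
  have "(\<exists>\<Lambda>\<subseteq>V. card \<Lambda> = L \<and> ?P \<Lambda> w) \<longleftrightarrow> (\<exists>\<Lambda>\<in>I. ?P \<Lambda> w)" for w by (auto simp: I_def)
  then have "avg ?W (\<lambda>w. of_bool (\<exists>\<Lambda>\<subseteq>V. card \<Lambda> = L \<and> ?P \<Lambda> w)) = avg ?W (\<lambda>w. of_bool (\<exists>\<Lambda>\<in>I. ?P \<Lambda> w))"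
    by simp
  also have "\<dots> \<le> (\<Sum>\<Lambda>\<in>I. avg ?W (\<lambda>w. of_bool (?P \<Lambda> w)))" by (rule avg_union_bound[OF fI])
  also have "\<dots> \<le> (\<Sum>\<Lambda>\<in>I. (1 * exp (- (6 * ln (card V)))) ^ card \<Lambda>)"
  proof (rule sum_mono)
    fix \<Lambda> assume "\<Lambda> \<in> I"
    then have \<Lambda>: "\<Lambda> \<subseteq> V" "card \<Lambda> = L" by (auto simp: I_def)
    have "avg \<Omega> (\<lambda>g. min (real (plurality (h g) \<Lambda>)) K) \<le> avg \<Omega> (\<lambda>g. real (plurality (h g) \<Lambda>))"
      by (intro avg_mono) auto
    with m[OF \<Lambda>] have "avg ?W (\<lambda>w. of_bool (?P \<Lambda> w)) \<le> exp (- (card J / K))"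
      using assms(6) by (intro bounded_sum_tail[OF J \<Omega>]) auto
    also have "\<dots> \<le> exp (L * (- (6 * ln (card V))))"
      using n assms(6) by (simp add: field_simps)
    also have "\<dots> = (1 * exp (- (6 * ln (card V)))) ^ card \<Lambda>"
      using \<Lambda> by (simp only: exp_of_nat_mult mult_1)
    finally show "avg ?W (\<lambda>w. of_bool (?P \<Lambda> w)) \<le> (1 * exp (- (6 * ln (card V)))) ^ card \<Lambda>" .
  qed
  also have "\<dots> \<le> (\<Sum>\<Lambda>\<in>Pow V - {{}}. (1 * exp (- (6 * ln (card V)))) ^ card \<Lambda>)"
    using V(1) I by (intro sum_mono2) auto
  also have "\<dots> \<le> 1 / 8" by (intro sum_nonempty_subsets_le V) auto
  finally show ?thesis .
qed

text \<open>Here L \<epsilon> is at most 2, so a cost of K per column for the cutoff would exceed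
  the target, which is a constant per column. The pluralities are split at K instead: chaining
  controls the excess, and an exponential tail the truncated part.\<close>

lemma uniform_plurality_bound_large_alphabet:
  fixes h :: "'g \<Rightarrow> 'x \<Rightarrow> 'a" and \<epsilon> :: real
  assumes V: "finite V" "card V \<ge> 2" and \<Omega>: "finite \<Omega>" "\<Omega> \<noteq> {}" and J: "finite J"
    and coll: "\<And>x y. x \<in> V \<Longrightarrow> y \<in> V \<Longrightarrow> x \<noteq> y \<Longrightarrow> avg \<Omega> (\<lambda>g. of_bool (h g x = h g y)) \<le> \<epsilon>\<^sup>2"
    and \<epsilon>: "0 < \<epsilon>" "\<epsilon> \<le> 1 / 256" and L: "1 \<le> L" "L \<le> 2 / \<epsilon>"
    and n_ge: "518400 * ln (card V) * log 2 (1 / \<epsilon>) ^ 4 / \<epsilon> \<le> card J"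
  shows "avg (J \<rightarrow>\<^sub>E \<Omega>) (\<lambda>w. of_bool (\<exists>\<Lambda>\<subseteq>V. card \<Lambda> = L \<and>
      (\<Sum>j\<in>J. real (plurality (h (w j)) \<Lambda>)) > 41 * real (card J))) \<le> 1 / 4"
    (is "avg ?W (\<lambda>w. of_bool (?bad w)) \<le> _")
proof -
  define l where "l = log 2 (1 / \<epsilon>)"
  define K where "K = 20 * l"
  have "real L \<le> 2 / \<epsilon>\<^sup>2"
  proof -
    have "2 / \<epsilon> \<le> 2 / \<epsilon>\<^sup>2"
      using \<epsilon> by (intro divide_left_mono) (auto simp: power2_eq_square mult_le_cancel_left1)
    then show ?thesis using L(2) by linarith
  qed
  from chain_parameters[OF \<epsilon> this l_def]
  obtain T :: nat where T: "T \<ge> 1" "T \<le> 3 * l" "L \<le> 2 ^ T" "288 * real L * exp (- (20 * l) / 2) \<le> 1" .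
  note T = T[folded K_def]
  have l: "l \<ge> 8" using log_inverse_bounds[OF \<epsilon>] by (auto simp: l_def K_def)
  have K: "K \<ge> 1" using l by (simp add: K_def)
  \<comment> \<open>Makes the coefficient of x equal to 1/2. Mean and deviation are both of order n,
    so no \<epsilon> occurs.\<close>
  define \<gamma> where "\<gamma> = 1 / (12 * T * K\<^sup>2)"
  have \<gamma>: "\<gamma> > 0" using T(1) K by (simp add: \<gamma>_def)
  have r: "6 * \<gamma> * T * K\<^sup>2 = 1 / 2" using T(1) K by (simp add: \<gamma>_def field_simps)
  define n where "n = real (card J)"
  define R where "R = T * (6 * ln (card V)) * L / \<gamma>"
  have lnV: "ln (card V) \<ge> 0" using V(2) by simp
  have R: "R \<le> n"
  proof -
    have "real T * K \<le> 3 * l * (20 * l)" unfolding K_def using T(2) l by (intro mult_mono) auto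
    then have "(T * K)\<^sup>2 \<le> (60 * l\<^sup>2)\<^sup>2"
      using K by (intro power_mono) (auto simp: power2_eq_square)
    then have TK: "real T ^ 2 * K\<^sup>2 \<le> 3600 * l ^ 4" by (simp add: power_mult_distrib)
    have "R = 72 * ln (card V) * L * (real T ^ 2 * K\<^sup>2)"
      using T(1) K by (simp add: R_def \<gamma>_def field_simps power2_eq_square)
    also have "\<dots> \<le> 72 * ln (card V) * (2 / \<epsilon>) * (3600 * l ^ 4)"
    proof (rule mult_mono[OF _ TK])
      show "72 * ln (card V) * L \<le> 72 * ln (card V) * (2 / \<epsilon>)"
        using lnV L by (intro mult_left_mono) auto
    qed (use lnV \<epsilon> in auto)
    also have "\<dots> = 518400 * ln (card V) * l ^ 4 / \<epsilon>" by simp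
    also have "\<dots> \<le> n" using n_ge by (simp add: l_def n_def)
    finally show ?thesis .
  qed
  have nK: "6 * ln (card V) * L * K \<le> n"
  proof -
    have "6 * ln (card V) * L * K \<le> 6 * ln (card V) * (2 / \<epsilon>) * (43200 * l ^ 4)"
    proof (intro mult_mono)
      have "l ^ 1 \<le> l ^ 4" using l by (intro power_increasing) auto
      then show "K \<le> 43200 * l ^ 4" using l by (simp add: K_def)
    qed (use lnV L K \<epsilon> in auto)
    also have "\<dots> = 518400 * ln (card V) * l ^ 4 / \<epsilon>" by simp
    also have "\<dots> \<le> n" using n_ge by (simp add: l_def n_def)
    finally show ?thesis .
  qed
  have p5: "avg \<Omega> (\<lambda>g. real (plurality (h g) \<Lambda>)) \<le> 5" if \<Lambda>: "\<Lambda> \<subseteq> V" "card \<Lambda> = L" for \<Lambda>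
  proof -
    have fin: "finite \<Lambda>" "\<Lambda> \<noteq> {}" using finite_subset[OF \<Lambda>(1) V(1)] \<Lambda>(2) L(1) by auto
    have "avg \<Omega> (\<lambda>g. real (plurality (h g) \<Lambda>)) \<le> 1 + (card \<Lambda>)\<^sup>2 * \<epsilon>\<^sup>2"
      using \<Lambda>(1) by (intro avg_plurality_le_collisions \<Omega> fin coll) auto
    also have "(card \<Lambda>)\<^sup>2 * \<epsilon>\<^sup>2 = (L * \<epsilon>)\<^sup>2" by (simp add: \<Lambda>(2) power_mult_distrib)
    also have "\<dots> \<le> 2\<^sup>2" using L(2) \<epsilon> by (intro power_mono) (auto simp: field_simps)
    finally show ?thesis by simp
  qed
  let ?B1 = "\<lambda>w. \<exists>\<Lambda>\<subseteq>V. card \<Lambda> = L \<and>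
      (\<Sum>j\<in>J. excess K (h (w j)) \<Lambda>) - card J * avg \<Omega> (\<lambda>g. excess K (h g) \<Lambda>)
      > 6 * \<gamma> * T * K\<^sup>2 * ((\<Sum>j\<in>J. real (plurality (h (w j)) \<Lambda>))
        + card J * avg \<Omega> (\<lambda>g. real (plurality (h g) \<Lambda>)))
        + T * (6 * ln (card V)) * L / \<gamma> + card J"
  let ?B2 = "\<lambda>w. \<exists>\<Lambda>\<subseteq>V. card \<Lambda> = L \<and>
      (\<Sum>j\<in>J. min (real (plurality (h (w j)) \<Lambda>)) K) > (2 * 5 + 1) * real (card J)"
  have bad: "?B1 w \<or> ?B2 w" if "?bad w" for w
  proof (rule ccontr)
    assume good: "\<not> (?B1 w \<or> ?B2 w)"
    from that obtain \<Lambda> where \<Lambda>: "\<Lambda> \<subseteq> V" "card \<Lambda> = L"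
      and gt: "(\<Sum>j\<in>J. real (plurality (h (w j)) \<Lambda>)) > 41 * n"
      unfolding n_def by blast
    define x where "x = (\<Sum>j\<in>J. real (plurality (h (w j)) \<Lambda>))"
    define y where "y = (\<Sum>j\<in>J. min (real (plurality (h (w j)) \<Lambda>)) K)"
    define X where "X = (\<Sum>j\<in>J. excess K (h (w j)) \<Lambda>)"
    define p where "p = avg \<Omega> (\<lambda>g. real (plurality (h g) \<Lambda>))"
    define f where "f = avg \<Omega> (\<lambda>g. excess K (h g) \<Lambda>)"
    have "x = X + y"
      unfolding x_def X_def y_def sum.distrib[symmetric] by (intro sum.cong) (auto simp: excess_def)
    moreover have "\<not> (X - n * f > 6 * \<gamma> * T * K\<^sup>2 * (x + n * p) + R + n)"
    proof
      assume "X - n * f > 6 * \<gamma> * T * K\<^sup>2 * (x + n * p) + R + n"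
      with \<Lambda> have "?B1 w"
        unfolding x_def X_def p_def f_def n_def R_def by (intro exI[of _ \<Lambda>] conjI)
      with good show False by (elim notE) (rule disjI1)
    qed
    then have "X - n * f \<le> 1 / 2 * (x + n * p) + R + n" unfolding r by simp
    moreover have "\<not> y > (2 * 5 + 1) * n"
    proof
      assume "y > (2 * 5 + 1) * n"
      with \<Lambda> have "?B2 w" unfolding y_def n_def by (intro exI[of _ \<Lambda>] conjI)
      with good show False by (elim notE) (rule disjI2)
    qed
    moreover have "f \<le> p" unfolding f_def p_def using K by (intro avg_mono excess_le_plurality) auto
    moreover have p5': "p \<le> 5" unfolding p_def by (rule p5[OF \<Lambda>])
    moreover have "n * f \<le> n * 5" "n * p \<le> n * 5"
      using \<open>f \<le> p\<close> p5' by (auto simp: n_def intro: mult_left_mono)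
    \<comment> \<open>From x = X + y with X \<le> 5 n + (x + 5 n) / 2 + 2 n and y \<le> 11 n one
      obtains x / 2 \<le> 20.5 n: the constant 41.\<close>
    moreover have "X - a \<le> 1 / 2 * (x + b) + R + n \<Longrightarrow> a \<le> n * 5 \<Longrightarrow> b \<le> n * 5 \<Longrightarrow>
        x = X + y \<Longrightarrow> \<not> y > (2 * 5 + 1) * n \<Longrightarrow> x \<le> 41 * n" for a b
      using R by (simp add: field_simps)
    ultimately have "x \<le> 41 * n" by blast
    with gt show False unfolding x_def[symmetric] by simp
  qed
  have "avg ?W (\<lambda>w. of_bool (?bad w)) \<le> avg ?W (\<lambda>w. of_bool (?B1 w) + of_bool (?B2 w))"
  proof (rule avg_mono)
    fix w show "of_bool (?bad w) \<le> (of_bool (?B1 w) + of_bool (?B2 w) :: real)"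
      using bad[of w]
      by (cases "?bad w"; cases "?B1 w"; cases "?B2 w"; simp only: of_bool_eq) simp_all
  qed
  also have "\<dots> = avg ?W (\<lambda>w. of_bool (?B1 w)) + avg ?W (\<lambda>w. of_bool (?B2 w))" by (rule avg_add)
  also have "\<dots> \<le> 1 / 8 + 1 / 8"
  proof (rule add_mono)
    show "avg ?W (\<lambda>w. of_bool (?B1 w)) \<le> 1 / 8" by (intro uniform_chaining V \<Omega> J L T K \<gamma>)
    show "avg ?W (\<lambda>w. of_bool (?B2 w)) \<le> 1 / 8"
      using K nK by (intro uniform_truncated_plurality_bound V \<Omega> J L p5) (auto simp: n_def)
  qed
  finally show ?thesis by simp
qed

section \<open>Random linear codes\<close>

text \<open>The column comes before the message, so that \<open>dot F k g\<close> is a colouring of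
  the messages by field elements, the form that \<open>plurality\<close> takes.\<close>

definition dot :: "('a, 'b) ring_scheme \<Rightarrow> nat \<Rightarrow> (nat \<Rightarrow> 'a) \<Rightarrow> (nat \<Rightarrow> 'a) \<Rightarrow> 'a" where
  "dot F k g x = (\<Oplus>\<^bsub>F\<^esub>i\<in>{..<k}. x i \<otimes>\<^bsub>F\<^esub> g i)"

definition matrix_of_columns :: "nat \<Rightarrow> nat \<Rightarrow> (nat \<Rightarrow> nat \<Rightarrow> 'a) \<Rightarrow> nat \<times> nat \<Rightarrow> 'a" where
  "matrix_of_columns k n w = (\<lambda>(i, j)\<in>{..<k} \<times> {..<n}. w j i)"

text \<open>Turns a uniform matrix into independent uniform columns, which are the samples in the
  chaining argument.\<close>

lemma bij_betw_matrix_of_columns: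
  "bij_betw (matrix_of_columns k n) ({..<n} \<rightarrow>\<^sub>E vectors F k) (matrices F k n)"
proof (rule bij_betw_byWitness[where f' = "\<lambda>G. \<lambda>j\<in>{..<n}. \<lambda>i\<in>{..<k}. G (i, j)"])
  show "\<forall>w\<in>{..<n} \<rightarrow>\<^sub>E vectors F k. (\<lambda>j\<in>{..<n}. \<lambda>i\<in>{..<k}. matrix_of_columns k n w (i, j)) = w"
  proof
    fix w assume w: "w \<in> {..<n} \<rightarrow>\<^sub>E vectors F k"
    show "(\<lambda>j\<in>{..<n}. \<lambda>i\<in>{..<k}. matrix_of_columns k n w (i, j)) = w"
    proof
      fix j
      show "(\<lambda>j\<in>{..<n}. \<lambda>i\<in>{..<k}. matrix_of_columns k n w (i, j)) j = w j"
      proof (cases "j < n")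
        case True
        then have "w j \<in> {..<k} \<rightarrow>\<^sub>E carrier F" using w by (auto simp: vectors_def)
        then show ?thesis
          using True by (auto simp: matrix_of_columns_def fun_eq_iff restrict_def PiE_def extensional_def)
      next
        case False
        then show ?thesis using w by (auto simp: PiE_def extensional_def)
      qed
    qed
  qed
  show "\<forall>G\<in>matrices F k n. matrix_of_columns k n (\<lambda>j\<in>{..<n}. \<lambda>i\<in>{..<k}. G (i, j)) = G"
    by (auto simp: matrix_of_columns_def matrices_def fun_eq_iff restrict_def PiE_def extensional_def)
  show "matrix_of_columns k n ` ({..<n} \<rightarrow>\<^sub>E vectors F k) \<subseteq> matrices F k n"
    by (auto simp: matrix_of_columns_def matrices_def vectors_def PiE_def Pi_def split: prod.splits)
  show "(\<lambda>G. \<lambda>j\<in>{..<n}. \<lambda>i\<in>{..<k}. G (i, j)) ` matrices F k n \<subseteq> {..<n} \<rightarrow>\<^sub>E vectors F k"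
    by (auto simp: matrices_def vectors_def PiE_def Pi_def)
qed

context field
begin

lemma vectors_mem: "x \<in> vectors R k \<Longrightarrow> i < k \<Longrightarrow> x i \<in> carrier R"
  by (auto simp: vectors_def)

lemma dot_closed: "x \<in> vectors R k \<Longrightarrow> g \<in> vectors R k \<Longrightarrow> dot R k g x \<in> carrier R"
  unfolding dot_def by (intro finsum_closed) (auto simp: vectors_mem)

lemma dot_split:
  assumes "x \<in> vectors R k" "g \<in> vectors R k" "i < k"
  shows "dot R k g x = x i \<otimes> g i \<oplus> (\<Oplus>j\<in>{..<k} - {i}. x j \<otimes> g j)"
proof -
  have "{..<k} = insert i ({..<k} - {i})" using assms(3) by auto
  then have "dot R k g x = (\<Oplus>j\<in>insert i ({..<k} - {i}). x j \<otimes> g j)" by (simp only: dot_def)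
  also have "\<dots> = x i \<otimes> g i \<oplus> (\<Oplus>j\<in>{..<k} - {i}. x j \<otimes> g j)"
    using assms by (intro finsum_insert) (auto simp: vectors_mem)
  finally show ?thesis .
qed

lemma vec_mat_mult_columns:
  assumes "x \<in> vectors R k" "w \<in> {..<n} \<rightarrow>\<^sub>E vectors R k"
  shows "vec_mat_mult R k n x (matrix_of_columns k n w) = (\<lambda>j\<in>{..<n}. dot R k (w j) x)"
  unfolding vec_mat_mult_def dot_def
proof (rule restrict_ext)
  fix j assume "j \<in> {..<n}"
  then have "w j \<in> vectors R k" "j < n" using assms by auto
  then show "(\<Oplus>i\<in>{..<k}. x i \<otimes> matrix_of_columns k n w (i, j)) = (\<Oplus>i\<in>{..<k}. x i \<otimes> w j i)"
    using assms(1) by (intro finsum_cong') (auto simp: matrix_of_columns_def vectors_mem)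
qed

lemma linear_equation_unique:
  assumes "c \<in> carrier R" "d \<in> carrier R" "u \<in> carrier R" "v \<in> carrier R" "r \<in> carrier R" "s \<in> carrier R"
    and "c \<noteq> d" "c \<otimes> u \<oplus> r = d \<otimes> u \<oplus> s" "c \<otimes> v \<oplus> r = d \<otimes> v \<oplus> s"
  shows "u = v"
proof -
  have "(c \<ominus> d) \<otimes> u = s \<ominus> r"
  proof -
    have "(c \<ominus> d) \<otimes> u = (c \<otimes> u \<oplus> r) \<ominus> d \<otimes> u \<ominus> r" using assms(1-6) by algebra
    also have "\<dots> = (d \<otimes> u \<oplus> s) \<ominus> d \<otimes> u \<ominus> r" by (simp only: assms(8))
    also have "\<dots> = s \<ominus> r" using assms(1-6) by algebra
    finally show ?thesis .
  qed
  moreover have "(c \<ominus> d) \<otimes> v = s \<ominus> r"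
  proof -
    have "(c \<ominus> d) \<otimes> v = (c \<otimes> v \<oplus> r) \<ominus> d \<otimes> v \<ominus> r" using assms(1-6) by algebra
    also have "\<dots> = (d \<otimes> v \<oplus> s) \<ominus> d \<otimes> v \<ominus> r" by (simp only: assms(9))
    also have "\<dots> = s \<ominus> r" using assms(1-6) by algebra
    finally show ?thesis .
  qed
  moreover have "c \<ominus> d \<noteq> \<zero>" using assms by simp
  ultimately show ?thesis using assms m_lcancel[of "c \<ominus> d" u v] by simp
qed

text \<open>If x and y differ at i, the equation \<open>dot R k g x = dot R k g y\<close> determines
  \<open>g i\<close> from the other entries. Overwriting \<open>g i\<close> by an arbitrary field
  element is therefore injective on pairs of a collision and an element.\<close>

lemma card_collisions_le:
  assumes fin: "finite (carrier R)" and xy: "x \<in> vectors R k" "y \<in> vectors R k" "x \<noteq> y"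
  shows "card {g \<in> vectors R k. dot R k g x = dot R k g y} * card (carrier R) \<le> card (vectors R k)"
proof -
  obtain i where i: "i < k" "x i \<noteq> y i"
    using xy PiE_ext[of x "{..<k}" "\<lambda>_. carrier R" y] by (auto simp: vectors_def)
  define S where "S = {g \<in> vectors R k. dot R k g x = dot R k g y}"
  have finV: "finite (vectors R k)" using fin by (auto simp: vectors_def intro: finite_PiE)
  have inj: "inj_on (\<lambda>(g, a). g(i := a)) (S \<times> carrier R)"
  proof (rule inj_onI, clarify)
    fix g a g' a' assume g: "g \<in> S" "a \<in> carrier R" "g' \<in> S" "a' \<in> carrier R"
      and eq: "g(i := a) = g'(i := a')"
    have a: "a = a'" using fun_cong[OF eq, of i] by simp
    have off: "g j = g' j" if "j \<noteq> i" for j using fun_cong[OF eq, of j] that by simp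
    have gv: "g \<in> vectors R k" "g' \<in> vectors R k" using g by (auto simp: S_def)
    define r where "r z = (\<Oplus>j\<in>{..<k} - {i}. z j \<otimes> g j)" for z :: "nat \<Rightarrow> 'a"
    have r: "(\<Oplus>j\<in>{..<k} - {i}. z j \<otimes> g' j) = r z" if "z \<in> vectors R k" for z
      unfolding r_def using that gv by (intro finsum_cong') (auto simp: vectors_mem off)
    have rc: "r z \<in> carrier R" if "z \<in> vectors R k" for z
      unfolding r_def using that gv by (intro finsum_closed) (auto simp: vectors_mem)
    have "x i \<otimes> g i \<oplus> r x = y i \<otimes> g i \<oplus> r y"
      using g(1) dot_split[OF xy(1) gv(1) i(1)] dot_split[OF xy(2) gv(1) i(1)]
      by (simp add: S_def r_def)
    moreover have "x i \<otimes> g' i \<oplus> r x = y i \<otimes> g' i \<oplus> r y"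
      using g(3) dot_split[OF xy(1) gv(2) i(1)] dot_split[OF xy(2) gv(2) i(1)]
      by (simp add: S_def r xy)
    ultimately have "g i = g' i"
      using i xy gv rc
      by (intro linear_equation_unique[of "x i" "y i" "g i" "g' i" "r x" "r y"]) (auto simp: vectors_mem)
    then have "g = g'" using off by (metis ext)
    with a show "g = g' \<and> a = a'" by simp
  qed
  have "(\<lambda>(g, a). g(i := a)) ` (S \<times> carrier R) \<subseteq> vectors R k"
    using i(1) by (auto simp: S_def vectors_def PiE_def Pi_def extensional_def)
  then have "card (S \<times> carrier R) \<le> card (vectors R k)"
    using inj finV by (intro card_inj_on_le[of "\<lambda>(g, a). g(i := a)"])
  then show ?thesis by (simp add: S_def card_cartesian_product)
qed

section \<open>Dimension of the code\<close>

lemma vectorspace_func_space: "vectorspace R (func_space S)"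
  by (intro vectorspace.intro func_space_is_module field_axioms)

text \<open>Counting replaces an explicit basis: coordinates with respect to some basis B match the
  |F|^k vectors with the |F|^|B| coefficient families, and |F| > 1 forces |B| = k.\<close>

lemma dim_func_space:
  assumes fin: "finite (carrier R)"
  shows "vectorspace.dim R (func_space {..<k}) = k" "vectorspace.fin_dim R (func_space {..<k})"
proof -
  interpret V: vectorspace R "func_space {..<k}" by (rule vectorspace_func_space)
  have c: "carrier (func_space {..<k}) = {..<k} \<rightarrow>\<^sub>E carrier R" by (simp add: func_space_def)
  have finV: "finite (carrier (func_space {..<k}))" unfolding c using fin by (intro finite_PiE) auto
  have "V.gen_set (carrier (func_space {..<k}))"
    by (intro equalityI V.span_is_subset2 V.in_own_span subset_refl)
  then show fd: "V.fin_dim"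
    unfolding V.fin_dim_def using finV by (intro exI[of _ "carrier (func_space {..<k})"]) simp
  obtain B where B: "finite B" "V.basis B" using V.finite_basis_exists[OF fd] by (elim exE conjE)
  have Bc: "B \<subseteq> carrier (func_space {..<k})" using B(2) unfolding V.basis_def by (elim conjE)
  have "\<forall>v. v \<in> carrier (func_space {..<k}) \<longrightarrow> (\<exists>!a. a \<in> B \<rightarrow>\<^sub>E carrier R \<and> V.lincomb a B = v)"
    using V.basis_criterion[OF B(1) Bc] B(2) by (rule iffD1)
  then have ex1: "\<exists>!a. a \<in> B \<rightarrow>\<^sub>E carrier R \<and> V.lincomb a B = v"
    if "v \<in> carrier (func_space {..<k})" for v using that by (elim allE impE)
  have "bij_betw (\<lambda>a. V.lincomb a B) (B \<rightarrow>\<^sub>E carrier R) (carrier (func_space {..<k}))"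
  proof (rule bij_betwI')
    fix a b assume ab: "a \<in> B \<rightarrow>\<^sub>E carrier R" "b \<in> B \<rightarrow>\<^sub>E carrier R"
    have "V.lincomb a B \<in> carrier (func_space {..<k})" using ab Bc by (intro V.lincomb_closed) auto
    from ex1[OF this] show "(V.lincomb a B = V.lincomb b B) = (a = b)" using ab by metis
  next
    fix a assume "a \<in> B \<rightarrow>\<^sub>E carrier R"
    then show "V.lincomb a B \<in> carrier (func_space {..<k})" using Bc by (intro V.lincomb_closed) auto
  next
    fix v assume "v \<in> carrier (func_space {..<k})"
    from ex1[OF this] show "\<exists>a\<in>B \<rightarrow>\<^sub>E carrier R. v = V.lincomb a B" by metis
  qed
  then have "card (B \<rightarrow>\<^sub>E carrier R) = card (carrier (func_space {..<k}))" by (rule bij_betw_same_card)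
  then have "card (carrier R) ^ card B = card (carrier R) ^ k"
    unfolding c using B(1) by (simp add: card_PiE)
  moreover have "card (carrier R) > 1"
  proof -
    have "{\<zero>, \<one>} \<subseteq> carrier R" by simp
    from card_mono[OF fin this] show ?thesis by simp
  qed
  ultimately have "card B = k" using power_inject_exp by blast
  then show "V.dim = k" using V.dim_basis[OF B] by simp
qed

text \<open>Encoding is a linear map with the code as its image and, by injectivity, a kernel of
  dimension 0; rank-nullity gives the dimension.\<close>

lemma code_dim_eq:
  assumes fin: "finite (carrier R)" and G: "G \<in> matrices R k n"
    and inj: "inj_on (\<lambda>x. vec_mat_mult R k n x G) (vectors R k)"
  shows "code_dim R n (linear_code R k n G) = k"
proof -
  define T where "T x = vec_mat_mult R k n x G" for x
  interpret V: vectorspace R "func_space {..<k}" by (rule vectorspace_func_space)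
  interpret W: vectorspace R "func_space {..<n}" by (rule vectorspace_func_space)
  have cV: "carrier (func_space {..<k}) = vectors R k" for k by (simp add: func_space_def vectors_def)
  have Gc: "G (i, j) \<in> carrier R" if "i < k" "j < n" for i j using G that by (auto simp: matrices_def)
  have Tc: "T x \<in> vectors R n" if "x \<in> vectors R k" for x
    unfolding T_def vec_mat_mult_def vectors_def
    using that Gc by (auto simp: vectors_mem intro!: finsum_closed)
  have "linear_map R (func_space {..<k}) (func_space {..<n}) T"
  proof -
    have "T \<in> module_hom R (func_space {..<k}) (func_space {..<n})"
      unfolding module_hom_def
    proof (intro CollectI conjI allI impI Pi_I; (elim conjE)?)
      fix x assume "x \<in> carrier (func_space {..<k})"
      then show "T x \<in> carrier (func_space {..<n})" using Tc by (simp add: cV)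
    next
      fix x y assume xy: "x \<in> carrier (func_space {..<k})" "y \<in> carrier (func_space {..<k})"
      then have xy: "x \<in> vectors R k" "y \<in> vectors R k" by (auto simp: cV)
      have "(\<Oplus>i\<in>{..<k}. (x i \<oplus> y i) \<otimes> G (i, j))
          = (\<Oplus>i\<in>{..<k}. x i \<otimes> G (i, j)) \<oplus> (\<Oplus>i\<in>{..<k}. y i \<otimes> G (i, j))" if "j < n" for j
      proof -
        have "(\<Oplus>i\<in>{..<k}. (x i \<oplus> y i) \<otimes> G (i, j))
            = (\<Oplus>i\<in>{..<k}. x i \<otimes> G (i, j) \<oplus> y i \<otimes> G (i, j))"
          using xy Gc that by (intro finsum_cong') (auto simp: vectors_mem l_distr)
        also have "\<dots> = (\<Oplus>i\<in>{..<k}. x i \<otimes> G (i, j)) \<oplus> (\<Oplus>i\<in>{..<k}. y i \<otimes> G (i, j))"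
          using xy Gc that by (intro finsum_addf) (auto simp: vectors_mem)
        finally show ?thesis .
      qed
      moreover have "(\<Oplus>i\<in>{..<k}. (\<lambda>i\<in>{..<k}. x i \<oplus> y i) i \<otimes> G (i, j))
          = (\<Oplus>i\<in>{..<k}. (x i \<oplus> y i) \<otimes> G (i, j))" if "j < n" for j
        using xy Gc that by (intro finsum_cong') (auto simp: vectors_mem)
      ultimately show "T (x \<oplus>\<^bsub>func_space {..<k}\<^esub> y) = T x \<oplus>\<^bsub>func_space {..<n}\<^esub> T y"
        by (auto simp: T_def vec_mat_mult_def func_space_def fun_eq_iff restrict_def)
    next
      fix c x assume c: "c \<in> carrier R" and "x \<in> carrier (func_space {..<k})"
      then have x: "x \<in> vectors R k" by (auto simp: cV)
      have "(\<Oplus>i\<in>{..<k}. (\<lambda>i\<in>{..<k}. c \<otimes> x i) i \<otimes> G (i, j)) = c \<otimes> (\<Oplus>i\<in>{..<k}. x i \<otimes> G (i, j))"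
        if "j < n" for j
      proof -
        have "(\<Oplus>i\<in>{..<k}. (\<lambda>i\<in>{..<k}. c \<otimes> x i) i \<otimes> G (i, j)) = (\<Oplus>i\<in>{..<k}. c \<otimes> (x i \<otimes> G (i, j)))"
          using x c Gc that by (intro finsum_cong') (auto simp: vectors_mem m_assoc)
        also have "\<dots> = c \<otimes> (\<Oplus>i\<in>{..<k}. x i \<otimes> G (i, j))"
          using x c Gc that by (intro finsum_rdistr[symmetric]) (auto simp: vectors_mem)
        finally show ?thesis .
      qed
      then show "T (c \<odot>\<^bsub>func_space {..<k}\<^esub> x) = c \<odot>\<^bsub>func_space {..<n}\<^esub> T x"
        by (auto simp: T_def vec_mat_mult_def func_space_def fun_eq_iff restrict_def)
    qed
    then show ?thesis
      by (intro linear_map.intro mod_hom.intro mod_hom_axioms.intro V.vectorspace_axioms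
        W.vectorspace_axioms V.module_axioms W.module_axioms)
  qed
  then interpret T: linear_map R "func_space {..<k}" "func_space {..<n}" T .
  have im: "T.imT = linear_code R k n G"
    by (auto simp: T.im_def cV linear_code_def T_def)
  have "vectorspace.dim R (W.vs T.imT) + vectorspace.dim R (V.vs T.kerT) = V.dim"
    by (rule T.rank_nullity[OF dim_func_space(2)[OF fin]])
  moreover have "vectorspace.dim R (V.vs T.kerT) = 0"
    using inj by (intro T.inj_imp_dim_ker0) (simp add: cV T_def[abs_def])
  ultimately show ?thesis
    unfolding code_dim_def im using dim_func_space(1)[OF fin] by simp
qed

end

section \<open>Failure probabilities of a random code\<close>

lemma avg_of_bool_not_le:
  assumes "finite S" "S \<noteq> {}" "\<And>x. x \<in> S \<Longrightarrow> \<not> P x \<Longrightarrow> Q x \<or> Q' x"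
  shows "avg S (\<lambda>x. of_bool (P x)) \<ge> 1 - avg S (\<lambda>x. of_bool (Q x)) - avg S (\<lambda>x. of_bool (Q' x))"
proof -
  have "1 = avg S (\<lambda>_. 1)" by (rule avg_const[OF assms(1,2), symmetric])
  also have "\<dots> \<le> avg S (\<lambda>x. of_bool (P x) + (of_bool (Q x) + of_bool (Q' x)))"
    using assms(3) by (intro avg_mono) (fastforce simp: of_bool_def)
  also have "\<dots> = avg S (\<lambda>x. of_bool (P x))
      + (avg S (\<lambda>x. of_bool (Q x)) + avg S (\<lambda>x. of_bool (Q' x)))"
    by (simp only: avg_add)
  finally show ?thesis by linarith
qed

lemma sum_card_swap:
  assumes "finite A" "finite B"
  shows "(\<Sum>a\<in>A. card {b\<in>B. P a b}) = (\<Sum>b\<in>B. card {a\<in>A. P a b})"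
proof -
  have "(\<Sum>a\<in>A. card {b\<in>B. P a b}) = (\<Sum>a\<in>A. \<Sum>b\<in>B. of_bool (P a b))"
    using assms(2) by (simp add: of_bool_def sum.If_cases Int_def)
  also have "\<dots> = (\<Sum>b\<in>B. \<Sum>a\<in>A. of_bool (P a b))" by (rule sum.swap)
  also have "\<dots> = (\<Sum>b\<in>B. card {a\<in>A. P a b})"
    using assms(1) by (simp add: of_bool_def sum.If_cases Int_def)
  finally show ?thesis .
qed

text \<open>Here v is the length before rounding. As log q \<ge> 1, l \<ge> 1 and m \<le> \<epsilon>
  < 1/2, it is at least 2 B k \<ge> 2, which leaves room for injective encoding and shows that
  rounding up at most doubles it. The latter is what the rate needs.\<close>

lemma block_length_bounds:
  fixes \<epsilon> B l m v :: real
  assumes \<epsilon>: "0 < \<epsilon>" "\<epsilon> < 1 / 2" and "k \<ge> 1" "q \<ge> 2" "B \<ge> 1"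
  defines "l \<equiv> log 2 (1 / \<epsilon>)" and "m \<equiv> min \<epsilon> (real q * \<epsilon>\<^sup>2)"
  defines "v \<equiv> B * real k * log 2 (real q) * l ^ 5 / m"
  shows "l \<ge> 1" "0 < m" "m \<le> \<epsilon>" "log 2 (real q) \<ge> 1" "v \<ge> 2 * B * k"
    "v \<le> block_length B k q \<epsilon>" "block_length B k q \<epsilon> \<le> 2 * v"
proof -
  have "log 2 2 \<le> log 2 (1 / \<epsilon>)" using \<epsilon> by (intro log_mono) (auto simp: field_simps)
  then show l: "l \<ge> 1" by (simp add: l_def)
  show m: "0 < m" "m \<le> \<epsilon>" using \<epsilon> assms(4) by (auto simp: m_def)
  have "log 2 2 \<le> log 2 (real q)" using assms(4) by (intro log_mono) auto
  then show lq: "log 2 (real q) \<ge> 1" by simp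
  have "2 * B * k = B * k * 1 * 1 / (1 / 2)" by simp
  also have "\<dots> \<le> B * k * log 2 q * l ^ 5 / m"
    using assms(5) lq l m \<epsilon> by (intro frac_le mult_mono mult_nonneg_nonneg one_le_power) auto
  finally show v: "v \<ge> 2 * B * k" by (simp add: v_def)
  have bl: "block_length B k q \<epsilon> = nat \<lceil>v\<rceil>" by (simp add: block_length_def v_def l_def m_def)
  show "v \<le> block_length B k q \<epsilon>" unfolding bl by (rule real_nat_ceiling_ge)
  have "2 * B * k \<ge> 2 * 1 * 1" using assms(3,5) by (intro mult_mono) auto
  then have v2: "v \<ge> 2" using v by linarith
  then have "real (nat \<lceil>v\<rceil>) = of_int \<lceil>v\<rceil>" by (intro of_nat_nat) simp
  also have "\<dots> \<le> v + 1" by (rule of_int_ceiling_le_add_one)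
  also have "\<dots> \<le> 2 * v" using v2 by simp
  finally show "block_length B k q \<epsilon> \<le> 2 * v" unfolding bl .
qed

context field
begin

lemma finite_vectors: "finite (carrier R) \<Longrightarrow> finite (vectors R k)"
  unfolding vectors_def by (intro finite_PiE) auto

lemma vectors_nonempty: "vectors R k \<noteq> {}"
proof -
  have "(\<lambda>i\<in>{..<k}. \<zero>) \<in> vectors R k" by (simp add: vectors_def)
  then show ?thesis by blast
qed

lemma card_vectors: "card (vectors R k) = card (carrier R) ^ k"
  by (simp add: vectors_def card_PiE)

lemma card_carrier_ge_2: "finite (carrier R) \<Longrightarrow> card (carrier R) \<ge> 2"
  using card_mono[of "carrier R" "{\<zero>, \<one>}"] by simp

abbreviation columns :: "nat \<Rightarrow> nat \<Rightarrow> (nat \<Rightarrow> nat \<Rightarrow> 'a) set" where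
  "columns k n \<equiv> {..<n} \<rightarrow>\<^sub>E vectors R k"

lemma columns_nonempty: "columns k n \<noteq> {}"
  unfolding PiE_eq_empty_iff using vectors_nonempty by blast

lemma finite_columns: "finite (carrier R) \<Longrightarrow> finite (columns k n)"
  by (intro finite_PiE finite_vectors) auto

lemma prob_random_matrix:
  assumes "finite (carrier R)"
  shows "measure_pmf.prob (random_matrix R k n) E
    = avg (columns k n) (\<lambda>w. of_bool (matrix_of_columns k n w \<in> E))"
proof -
  note bij = bij_betw_matrix_of_columns[of k n R]
  have fin: "finite (matrices R k n)"
    using iffD1[OF bij_betw_finite[OF bij] finite_columns[OF assms]] .
  have ne: "matrices R k n \<noteq> {}"
    using bij columns_nonempty by (auto simp: bij_betw_def)
  have "measure_pmf.prob (random_matrix R k n) E = card (matrices R k n \<inter> E) / card (matrices R k n)"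
    unfolding random_matrix_def by (rule measure_pmf_of_set[OF ne fin])
  also have "\<dots> = (\<Sum>G\<in>matrices R k n. of_bool (G \<in> E)) / card (matrices R k n)"
    using fin by (simp add: of_bool_def sum.If_cases)
  also have "\<dots> = avg (columns k n) (\<lambda>w. of_bool (matrix_of_columns k n w \<in> E))"
    unfolding avg_def sum.reindex_bij_betw[OF bij, symmetric] bij_betw_same_card[OF bij] ..
  finally show ?thesis .
qed

lemma avg_collision_le:
  assumes "finite (carrier R)" "x \<in> vectors R k" "y \<in> vectors R k" "x \<noteq> y"
  shows "avg (vectors R k) (\<lambda>g. of_bool (dot R k g x = dot R k g y)) \<le> 1 / card (carrier R)"
proof -
  have V: "finite (vectors R k)" by (rule finite_vectors[OF assms(1)])
  have pos: "card (vectors R k) > 0" "card (carrier R) > 0"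
    using V vectors_nonempty assms(1) by (auto simp: card_gt_0_iff)
  define c where "c = card {g \<in> vectors R k. dot R k g x = dot R k g y}"
  have "avg (vectors R k) (\<lambda>g. of_bool (dot R k g x = dot R k g y)) = c / card (vectors R k)"
    unfolding avg_def c_def using V by (simp add: of_bool_def sum.If_cases Int_def)
  moreover have "real c * card (carrier R) \<le> card (vectors R k)"
    unfolding c_def of_nat_mult[symmetric] of_nat_le_iff by (rule card_collisions_le[OF assms])
  moreover from this have "c / card (vectors R k) \<le> 1 / card (carrier R)"
    using pos by (simp add: field_simps)
  ultimately show ?thesis by simp
qed

text \<open>Two distinct messages agree at all n independent columns with probability at most q^-n.
  The at most q^(2 k) pairs cost q^(2 k - n), which is at most 1/8 under the hypothesis on
  n.\<close>

lemma avg_not_injective_le: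
  assumes fin: "finite (carrier R)" and n: "n \<ge> 2 * k + 3"
  shows "avg (columns k n) (\<lambda>w. of_bool (\<not> inj_on (\<lambda>x. vec_mat_mult R k n x (matrix_of_columns k n w)) (vectors R k)))
    \<le> 1 / 8"
proof -
  define V where "V = vectors R k"
  define q where "q = real (card (carrier R))"
  have q: "q \<ge> 2" using card_carrier_ge_2[OF fin] by (simp add: q_def)
  have V: "finite V" "V \<noteq> {}" using finite_vectors[OF fin] vectors_nonempty by (auto simp: V_def)
  define I where "I = {p \<in> V \<times> V. fst p \<noteq> snd p}"
  have I: "finite I" using V by (auto simp: I_def)
  let ?P = "\<lambda>p w. \<forall>j\<in>{..<n}. dot R k (w j) (fst p) = dot R k (w j) (snd p)"
  have "avg (columns k n) (\<lambda>w. of_bool (\<not> inj_on (\<lambda>x. vec_mat_mult R k n x (matrix_of_columns k n w)) V))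
      \<le> avg (columns k n) (\<lambda>w. of_bool (\<exists>p\<in>I. ?P p w))"
  proof (rule avg_mono)
    fix w assume w: "w \<in> columns k n"
    have "\<exists>p\<in>I. ?P p w" if "\<not> inj_on (\<lambda>x. vec_mat_mult R k n x (matrix_of_columns k n w)) V"
    proof -
      from that obtain x y where xy: "x \<in> V" "y \<in> V" "x \<noteq> y"
        "vec_mat_mult R k n x (matrix_of_columns k n w) = vec_mat_mult R k n y (matrix_of_columns k n w)"
        unfolding inj_on_def by blast
      then have eq: "(\<lambda>j\<in>{..<n}. dot R k (w j) x) = (\<lambda>j\<in>{..<n}. dot R k (w j) y)"
        using w by (simp add: vec_mat_mult_columns V_def)
      have "dot R k (w j) x = dot R k (w j) y" if "j < n" for j
        using fun_cong[OF eq, of j] that by simp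
      then show ?thesis using xy by (intro bexI[of _ "(x, y)"]) (auto simp: I_def)
    qed
    then show "of_bool (\<not> inj_on (\<lambda>x. vec_mat_mult R k n x (matrix_of_columns k n w)) V)
        \<le> (of_bool (\<exists>p\<in>I. ?P p w) :: real)" by (simp only: of_bool_def split: if_split) auto
  qed
  also have "\<dots> \<le> (\<Sum>p\<in>I. avg (columns k n) (\<lambda>w. of_bool (?P p w)))" by (rule avg_union_bound[OF I])
  also have "\<dots> \<le> (\<Sum>p\<in>I. (1 / q) ^ n)"
  proof (rule sum_mono)
    fix p assume p: "p \<in> I"
    have "of_bool (?P p w) = (\<Prod>j\<in>{..<n}. of_bool (dot R k (w j) (fst p) = dot R k (w j) (snd p)) :: real)" for w
      by (induction n) (auto simp: lessThan_Suc)
    then have "avg (columns k n) (\<lambda>w. of_bool (?P p w))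
        = (\<Prod>j\<in>{..<n}. avg V (\<lambda>g. of_bool (dot R k g (fst p) = dot R k g (snd p))))"
      using avg_PiE_prod[OF finite_lessThan V(1), of n "\<lambda>_ g. of_bool (dot R k g (fst p) = dot R k g (snd p))"]
      by (simp add: V_def)
    also have "\<dots> \<le> (\<Prod>j\<in>{..<n}. 1 / q)"
    proof (rule prod_mono, intro conjI)
      show "avg V (\<lambda>g. of_bool (dot R k g (fst p) = dot R k g (snd p))) \<le> 1 / q"
        unfolding V_def q_def using p by (intro avg_collision_le fin) (auto simp: I_def V_def)
    qed (intro avg_nonneg, simp)
    finally show "avg (columns k n) (\<lambda>w. of_bool (?P p w)) \<le> (1 / q) ^ n" by simp
  qed
  also have "\<dots> \<le> q ^ (2 * k) * (1 / q) ^ n"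
  proof -
    have "card I \<le> card (V \<times> V)" using V by (intro card_mono) (auto simp: I_def)
    also have "\<dots> = card (carrier R) ^ (2 * k)"
      by (simp add: card_cartesian_product V_def card_vectors mult_2 power_add)
    finally have "real (card I) \<le> q ^ (2 * k)" unfolding q_def of_nat_power[symmetric] of_nat_le_iff .
    then have "card I * (1 / q) ^ n \<le> q ^ (2 * k) * (1 / q) ^ n" using q by (intro mult_right_mono) auto
    then show ?thesis by simp
  qed
  also have "\<dots> = (1 / q) ^ (n - 2 * k)"
    using q n by (simp add: power_diff power_divide)
  also have "\<dots> \<le> (1 / 2) ^ (n - 2 * k)" using q by (intro power_mono frac_le) auto
  also have "\<dots> \<le> (1 / 2) ^ 3" using n by (intro power_decreasing) auto
  finally show ?thesis by (simp add: V_def power3_eq_cube)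
qed

text \<open>Double counting of agreements: L codewords close to z agree with it in at least n L (1 -
  \<rho>) places altogether, and the messages that agree at column j share the symbol
  \<open>z j\<close> there.\<close>

lemma card_close_codewords_less:
  fixes \<rho> :: real
  assumes fin: "finite (carrier R)" and w: "w \<in> columns k n" and "n > 0" "L > 0"
    and bound: "\<And>\<Lambda>. \<Lambda> \<subseteq> vectors R k \<Longrightarrow> card \<Lambda> = L \<Longrightarrow>
      (\<Sum>j<n. real (plurality (dot R k (w j)) \<Lambda>)) < n * (L * (1 - \<rho>))"
  shows "card {c \<in> linear_code R k n (matrix_of_columns k n w). rel_hamming_dist n z c \<le> \<rho>} < L"
proof (rule ccontr)
  define V where "V = vectors R k"
  define f where "f x = (\<lambda>j\<in>{..<n}. dot R k (w j) x)" for x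
  define S where "S = {c \<in> linear_code R k n (matrix_of_columns k n w). rel_hamming_dist n z c \<le> \<rho>}"
  assume "\<not> ?thesis"
  then have "L \<le> card S" by (simp add: S_def)
  then obtain S' where S': "S' \<subseteq> S" "card S' = L" by (rule obtain_subset_with_card_n)
  have "linear_code R k n (matrix_of_columns k n w) = f ` V"
    unfolding linear_code_def V_def f_def Setcompr_eq_image using w
    by (intro image_cong refl vec_mat_mult_columns)
  then have "S' \<subseteq> f ` V" using S'(1) by (auto simp: S_def)
  \<comment> \<open>One preimage is chosen per codeword, so the list has exactly L messages even if
    encoding is not injective.\<close>
  then obtain \<Lambda> where \<Lambda>: "\<Lambda> \<subseteq> V" "inj_on f \<Lambda>" "S' = f ` \<Lambda>" unfolding subset_image_inj by blast
  have finV: "finite V" unfolding V_def by (rule finite_vectors[OF fin])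
  have fin\<Lambda>: "finite \<Lambda>" using \<Lambda>(1) finV by (rule finite_subset)
  have L: "card \<Lambda> = L" using S'(2) \<Lambda>(2,3) by (simp add: card_image)
  have agree: "n * (1 - \<rho>) \<le> card {j\<in>{..<n}. dot R k (w j) x = z j}" if "x \<in> \<Lambda>" for x
  proof -
    have "rel_hamming_dist n z (f x) \<le> \<rho>" using that \<Lambda>(3) S'(1) by (auto simp: S_def)
    then have d: "card {i\<in>{..<n}. z i \<noteq> f x i} \<le> \<rho> * n"
      using assms(3) by (simp add: rel_hamming_dist_def divide_le_eq)
    have "{j\<in>{..<n}. dot R k (w j) x = z j} = {..<n} - {i\<in>{..<n}. z i \<noteq> f x i}"
      by (auto simp: f_def)
    moreover have "card ({..<n} - {i\<in>{..<n}. z i \<noteq> f x i}) = card {..<n} - card {i\<in>{..<n}. z i \<noteq> f x i}"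
      by (intro card_Diff_subset) auto
    ultimately have "n \<le> card {j\<in>{..<n}. dot R k (w j) x = z j} + card {i\<in>{..<n}. z i \<noteq> f x i}"
      by simp
    then have "real n \<le> card {j\<in>{..<n}. dot R k (w j) x = z j} + real (card {i\<in>{..<n}. z i \<noteq> f x i})"
      by (simp only: of_nat_add[symmetric] of_nat_le_iff)
    with d show ?thesis by (simp add: algebra_simps)
  qed
  have "n * (L * (1 - \<rho>)) = (\<Sum>x\<in>\<Lambda>. n * (1 - \<rho>))" by (simp add: L)
  also have "\<dots> \<le> (\<Sum>x\<in>\<Lambda>. real (card {j\<in>{..<n}. dot R k (w j) x = z j}))"
    by (intro sum_mono agree)
  also have "\<dots> = real (\<Sum>j\<in>{..<n}. card {x\<in>\<Lambda>. dot R k (w j) x = z j})"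
    unfolding of_nat_sum[symmetric] sum_card_swap[OF fin\<Lambda> finite_lessThan] ..
  also have "\<dots> \<le> (\<Sum>j<n. real (plurality (dot R k (w j)) \<Lambda>))"
    unfolding of_nat_sum by (intro sum_mono of_nat_mono fibre_le_plurality fin\<Lambda>)
  also have "\<dots> < n * (L * (1 - \<rho>))" using bound \<Lambda>(1) L by (simp add: V_def)
  finally show False by simp
qed

text \<open>Settles \<epsilon> > 1/256: with A = 256 the radius 1 - 1/q - A \<epsilon> is then
  negative.\<close>

lemma list_decodable_negative_radius:
  assumes "\<rho> < 0" "B \<ge> 0"
  shows "list_decodable R n C \<rho> B"
proof -
  have "{c \<in> C. rel_hamming_dist n z c \<le> \<rho>} = {}" for z
    using assms(1) by (auto simp: rel_hamming_dist_def not_le intro: less_le_trans)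
  then show ?thesis unfolding list_decodable_def using assms(2) by (simp only: card.empty of_nat_0) simp
qed

lemma ln_card_vectors_le:
  assumes "finite (carrier R)"
  shows "ln (card (vectors R k)) \<le> k * log 2 (card (carrier R))"
proof -
  define q where "q = real (card (carrier R))"
  have q: "q \<ge> 2" using card_carrier_ge_2[OF assms] by (simp add: q_def)
  have "ln q * ln 2 \<le> ln q * 1" using q ln_2_less_1 by (intro mult_left_mono) auto
  then have "ln q \<le> log 2 q" by (simp add: log_def le_divide_eq)
  then have "k * ln q \<le> k * log 2 q" by (intro mult_left_mono) auto
  then show ?thesis using q by (simp add: card_vectors q_def[symmetric] ln_realpow)
qed

lemma avg_not_list_decodable_le:
  assumes fin: "finite (carrier R)" and \<epsilon>: "0 < \<epsilon>" "\<epsilon> < 1 / 2" and k: "k \<ge> 1"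
    and q_def: "q = card (carrier R)" and n_def: "n = block_length 518400 k q \<epsilon>"
  shows "avg (columns k n) (\<lambda>w. of_bool (\<not> list_decodable R n
      (linear_code R k n (matrix_of_columns k n w)) (1 - 1 / real q - 256 * \<epsilon>) (2 / \<epsilon>\<^sup>2))) \<le> 1 / 8"
proof (cases "\<epsilon> \<le> 1 / 256")
  case False
  have "1 - 1 / real q - 256 * \<epsilon> < 0"
  proof -
    have "1 / real q \<ge> 0" by simp
    then show ?thesis using False by linarith
  qed
  then have "list_decodable R n C (1 - 1 / real q - 256 * \<epsilon>) (2 / \<epsilon>\<^sup>2)" for C
    by (intro list_decodable_negative_radius) auto
  then show ?thesis by (simp add: avg_def)
next
  case True
  have q2: "q \<ge> 2" using card_carrier_ge_2[OF fin] q_def by simp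
  define l where "l = log 2 (1 / \<epsilon>)"
  define m where "m = min \<epsilon> (real q * \<epsilon>\<^sup>2)"
  note bl = block_length_bounds[OF \<epsilon> k q2, of 518400, folded l_def m_def n_def]
  \<comment> \<open>The smallest list size to which \<open>uniform_plurality_bound\<close>
    applies.\<close>
  define L where "L = nat \<lceil>1 / \<epsilon>\<^sup>2\<rceil>"
  have e2: "1 / \<epsilon>\<^sup>2 \<ge> 1" using \<epsilon> by (simp add: power_le_one)
  have "real L = of_int \<lceil>1 / \<epsilon>\<^sup>2\<rceil>" unfolding L_def using e2 by (intro of_nat_nat) simp
  then have L: "1 / \<epsilon>\<^sup>2 \<le> L" "L \<le> 1 / \<epsilon>\<^sup>2 + 1"
    using le_of_int_ceiling[of "1 / \<epsilon>\<^sup>2"] of_int_ceiling_le_add_one[of "1 / \<epsilon>\<^sup>2"] by linarith+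
  have L2: "L \<le> 2 / \<epsilon>\<^sup>2" using L(2) e2 by simp
  define V where "V = vectors R k"
  have V: "finite V" "V \<noteq> {}" "card V \<ge> 2"
  proof -
    have "2 ^ 1 \<le> q ^ k" using q2 k by (intro order_trans[OF power_mono power_increasing]) auto
    then show "card V \<ge> 2" by (simp add: V_def card_vectors q_def)
  qed (auto simp: V_def finite_vectors[OF fin] vectors_nonempty)
  have npos: "n > 0"
  proof -
    have "0 < 2 * 518400 * real k" using k by simp
    then have "0 < real n" using bl(5,6) by linarith
    then show ?thesis by simp
  qed
  have n: "259200 * ln (card V) * log 2 (1 / \<epsilon>) ^ 4 * ((1 / card (carrier R) + \<epsilon>) / \<epsilon>\<^sup>2) \<le> card {..<n}"
  proof -
    \<comment> \<open>The minimum in the block length enters here: it bounds q \<epsilon>^2 and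
      \<epsilon> from below at once. The resulting 2 doubles 259200 to 518400.\<close>
    have "(1 / q + \<epsilon>) / \<epsilon>\<^sup>2 = 1 / (q * \<epsilon>\<^sup>2) + 1 / \<epsilon>"
      using \<epsilon> q2 by (simp add: field_simps power2_eq_square)
    also have "\<dots> \<le> 1 / m + 1 / m"
      using \<epsilon> q2 bl(2) by (intro add_mono divide_left_mono) (auto simp: m_def)
    finally have 1: "(1 / q + \<epsilon>) / \<epsilon>\<^sup>2 \<le> 2 / m" by simp
    have lnV: "ln (card V) \<le> k * log 2 q" "0 \<le> ln (card V)"
      using ln_card_vectors_le[OF fin] V(3) by (auto simp: V_def q_def)
    have l45: "l ^ 4 \<le> l ^ 5" using bl(1) by (intro power_increasing) auto
    have "259200 * ln (card V) * l ^ 4 * ((1 / q + \<epsilon>) / \<epsilon>\<^sup>2)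
        \<le> 259200 * (k * log 2 q) * l ^ 5 * (2 / m)"
      using 1 lnV l45 bl(1) \<epsilon> q2 by (intro mult_mono mult_nonneg_nonneg) auto
    also have "\<dots> = 518400 * real k * log 2 (real q) * l ^ 5 / m" by simp
    also have "\<dots> \<le> n" using bl(6) by simp
    finally show ?thesis by (simp add: l_def q_def)
  qed
  have dotc: "dot R k g x \<in> carrier R" if "g \<in> V" "x \<in> V" for g x
    using that by (simp add: V_def dot_closed)
  let ?bad = "\<lambda>w. \<exists>\<Lambda>\<subseteq>V. card \<Lambda> = L \<and> (\<Sum>j\<in>{..<n}. real (plurality (dot R k (w j)) \<Lambda>))
      > card {..<n} * (L * (1 / card (carrier R) + 9 * \<epsilon>))"
  have Lpos: "L > 0" using L(1) e2 by linarith
  have "avg (columns k n) (\<lambda>w. of_bool (\<not> list_decodable R n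
      (linear_code R k n (matrix_of_columns k n w)) (1 - 1 / real q - 256 * \<epsilon>) (2 / \<epsilon>\<^sup>2)))
      \<le> avg (columns k n) (\<lambda>w. of_bool (?bad w))"
  proof (rule avg_mono)
    fix w assume w: "w \<in> columns k n"
    have "list_decodable R n (linear_code R k n (matrix_of_columns k n w))
        (1 - 1 / real q - 256 * \<epsilon>) (2 / \<epsilon>\<^sup>2)" if good: "\<not> ?bad w"
      unfolding list_decodable_def
    proof
      fix z
      have "card {c \<in> linear_code R k n (matrix_of_columns k n w).
          rel_hamming_dist n z c \<le> 1 - 1 / real q - 256 * \<epsilon>} < L"
      proof (rule card_close_codewords_less[OF fin w npos Lpos])
        fix \<Lambda> assume \<Lambda>: "\<Lambda> \<subseteq> vectors R k" "card \<Lambda> = L"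
        have "(\<Sum>j<n. real (plurality (dot R k (w j)) \<Lambda>)) \<le> n * (L * (1 / q + 9 * \<epsilon>))"
        proof (rule ccontr)
          assume "\<not> ?thesis"
          with \<Lambda> have "?bad w"
            unfolding V_def q_def card_lessThan not_le by (intro exI[of _ \<Lambda>] conjI)
          with good show False ..
        qed
        also have "\<dots> < n * (L * (1 - (1 - 1 / real q - 256 * \<epsilon>)))"
          using npos Lpos \<epsilon> by (intro mult_strict_left_mono) auto
        finally show "(\<Sum>j<n. real (plurality (dot R k (w j)) \<Lambda>))
            < n * (L * (1 - (1 - 1 / real q - 256 * \<epsilon>)))" .
      qed
      then show "real (card {c \<in> linear_code R k n (matrix_of_columns k n w).
          rel_hamming_dist n z c \<le> 1 - 1 / real q - 256 * \<epsilon>}) \<le> 2 / \<epsilon>\<^sup>2" using L2 by linarith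
    qed
    then show "of_bool (\<not> list_decodable R n (linear_code R k n (matrix_of_columns k n w))
        (1 - 1 / real q - 256 * \<epsilon>) (2 / \<epsilon>\<^sup>2)) \<le> (of_bool (?bad w) :: real)"
      by (cases "?bad w"; simp only: of_bool_eq) simp_all
  qed
  also have "\<dots> \<le> 1 / 8"
    unfolding V_def[symmetric]
  proof (rule uniform_plurality_bound[OF V(1,3,1,2) finite_lessThan fin _ dotc _ \<epsilon>(1) True L(1) L2 n])
    show "avg V (\<lambda>g. of_bool (dot R k g x = dot R k g y)) \<le> 1 / card (carrier R)"
      if "x \<in> V" "y \<in> V" "x \<noteq> y" for x y
      using that unfolding V_def by (intro avg_collision_le fin)
  qed auto
  finally show ?thesis .
qed

text \<open>A large q makes collisions rarer than \<epsilon>^2 and the minimum in the block length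
  equal to \<epsilon>. With L \<ge> 1/\<epsilon>, a bad list would need pluralities summing to n L
  (1/q + 256 \<epsilon>) \<ge> 256 n, far above the 41 n that holds outside the bad event.\<close>

lemma avg_not_list_decodable_large_alphabet_le:
  assumes fin: "finite (carrier R)" and \<epsilon>: "0 < \<epsilon>" "\<epsilon> < 1 / 2" and k: "k \<ge> 1"
    and q_def: "q = card (carrier R)" and n_def: "n = block_length 518400 k q \<epsilon>"
    and large: "real q > 1 / \<epsilon>\<^sup>2"
  shows "avg (columns k n) (\<lambda>w. of_bool (\<not> list_decodable R n
      (linear_code R k n (matrix_of_columns k n w)) (1 - 1 / real q - 256 * \<epsilon>) (1 / \<epsilon>))) \<le> 1 / 4"
proof (cases "\<epsilon> \<le> 1 / 256")
  case False
  have "1 - 1 / real q - 256 * \<epsilon> < 0"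
  proof -
    have "1 / real q \<ge> 0" by simp
    then show ?thesis using False by linarith
  qed
  then have "list_decodable R n C (1 - 1 / real q - 256 * \<epsilon>) (1 / \<epsilon>)" for C
    using \<epsilon> by (intro list_decodable_negative_radius) auto
  then show ?thesis by (simp add: avg_def)
next
  case True
  have q2: "q \<ge> 2" using card_carrier_ge_2[OF fin] q_def by simp
  define l where "l = log 2 (1 / \<epsilon>)"
  have qe: "real q * \<epsilon>\<^sup>2 > 1" using large \<epsilon> by (simp add: field_simps)
  then have m: "min \<epsilon> (real q * \<epsilon>\<^sup>2) = \<epsilon>" using \<epsilon> by simp
  note bl = block_length_bounds[OF \<epsilon> k q2, of 518400, folded l_def n_def, unfolded m]
  define L where "L = nat \<lceil>1 / \<epsilon>\<rceil>"
  have e2: "1 / \<epsilon> \<ge> 1" using \<epsilon> by simp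
  have "real L = of_int \<lceil>1 / \<epsilon>\<rceil>" unfolding L_def using e2 by (intro of_nat_nat) simp
  then have L: "1 / \<epsilon> \<le> L" "L \<le> 1 / \<epsilon> + 1"
    using le_of_int_ceiling[of "1 / \<epsilon>"] of_int_ceiling_le_add_one[of "1 / \<epsilon>"] by linarith+
  have L2: "L \<le> 2 / \<epsilon>" using L(2) e2 by simp
  have L1: "1 \<le> L" using L(1) e2 by linarith
  define V where "V = vectors R k"
  have V: "finite V" "V \<noteq> {}" "card V \<ge> 2"
  proof -
    have "2 ^ 1 \<le> q ^ k" using q2 k by (intro order_trans[OF power_mono power_increasing]) auto
    then show "card V \<ge> 2" by (simp add: V_def card_vectors q_def)
  qed (auto simp: V_def finite_vectors[OF fin] vectors_nonempty)
  have npos: "n > 0"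
  proof -
    have "0 < 2 * 518400 * real k" using k by simp
    then have "0 < real n" using bl(5,6) by linarith
    then show ?thesis by simp
  qed
  have n: "518400 * ln (card V) * log 2 (1 / \<epsilon>) ^ 4 / \<epsilon> \<le> card {..<n}"
  proof -
    have lnV: "ln (card V) \<le> k * log 2 q" "0 \<le> ln (card V)"
      using ln_card_vectors_le[OF fin] V(3) by (auto simp: V_def q_def)
    have l45: "l ^ 4 \<le> l ^ 5" using bl(1) by (intro power_increasing) auto
    have "518400 * ln (card V) * l ^ 4 / \<epsilon> \<le> 518400 * (k * log 2 q) * l ^ 5 / \<epsilon>"
      using lnV l45 bl(1) \<epsilon> q2 by (intro divide_right_mono mult_mono mult_nonneg_nonneg) auto
    also have "\<dots> = 518400 * real k * log 2 (real q) * l ^ 5 / \<epsilon>" by simp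
    also have "\<dots> \<le> n" using bl(6) by simp
    finally show ?thesis by (simp add: l_def)
  qed
  let ?bad = "\<lambda>w. \<exists>\<Lambda>\<subseteq>V. card \<Lambda> = L \<and> (\<Sum>j\<in>{..<n}. real (plurality (dot R k (w j)) \<Lambda>))
      > 41 * real (card {..<n})"
  have Lpos: "L > 0" using L1 by linarith
  have "avg (columns k n) (\<lambda>w. of_bool (\<not> list_decodable R n
      (linear_code R k n (matrix_of_columns k n w)) (1 - 1 / real q - 256 * \<epsilon>) (1 / \<epsilon>)))
      \<le> avg (columns k n) (\<lambda>w. of_bool (?bad w))"
  proof (rule avg_mono)
    fix w assume w: "w \<in> columns k n"
    have "list_decodable R n (linear_code R k n (matrix_of_columns k n w))
        (1 - 1 / real q - 256 * \<epsilon>) (1 / \<epsilon>)" if good: "\<not> ?bad w"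
      unfolding list_decodable_def
    proof
      fix z
      have "card {c \<in> linear_code R k n (matrix_of_columns k n w).
          rel_hamming_dist n z c \<le> 1 - 1 / real q - 256 * \<epsilon>} < L"
      proof (rule card_close_codewords_less[OF fin w npos Lpos])
        fix \<Lambda> assume \<Lambda>: "\<Lambda> \<subseteq> vectors R k" "card \<Lambda> = L"
        have "(\<Sum>j<n. real (plurality (dot R k (w j)) \<Lambda>)) \<le> 41 * real n"
        proof (rule ccontr)
          assume "\<not> ?thesis"
          with \<Lambda> have "?bad w"
            unfolding V_def card_lessThan not_le by (intro exI[of _ \<Lambda>] conjI)
          with good show False ..
        qed
        also have "\<dots> < real n * 256" using npos by simp
        also have "\<dots> \<le> n * (L * (1 - (1 - 1 / real q - 256 * \<epsilon>)))"
        proof (rule mult_left_mono)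
          have "1 * 256 \<le> (L * \<epsilon>) * 256" using L(1) \<epsilon> by (intro mult_right_mono) (auto simp: field_simps)
          moreover have "0 \<le> L * (1 / real q)" by simp
          moreover have "L * (1 - (1 - 1 / real q - 256 * \<epsilon>)) = L * (1 / real q) + (L * \<epsilon>) * 256"
            by (simp add: algebra_simps)
          ultimately show "256 \<le> L * (1 - (1 - 1 / real q - 256 * \<epsilon>))" by linarith
        qed simp
        finally show "(\<Sum>j<n. real (plurality (dot R k (w j)) \<Lambda>))
            < n * (L * (1 - (1 - 1 / real q - 256 * \<epsilon>)))" .
      qed
      \<comment> \<open>The strict inequality matters: fewer than L codewords, with L \<le>
        1/\<epsilon> + 1, means at most 1/\<epsilon>.\<close>
      then show "real (card {c \<in> linear_code R k n (matrix_of_columns k n w).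
          rel_hamming_dist n z c \<le> 1 - 1 / real q - 256 * \<epsilon>}) \<le> 1 / \<epsilon>" using L(2) by linarith
    qed
    then show "of_bool (\<not> list_decodable R n (linear_code R k n (matrix_of_columns k n w))
        (1 - 1 / real q - 256 * \<epsilon>) (1 / \<epsilon>)) \<le> (of_bool (?bad w) :: real)"
      by (cases "?bad w"; simp only: of_bool_eq) simp_all
  qed
  also have "\<dots> \<le> 1 / 4"
    unfolding V_def[symmetric]
  proof (rule uniform_plurality_bound_large_alphabet[OF V(1,3,1,2) finite_lessThan _ \<epsilon>(1) True L1 L2 n])
    show "avg V (\<lambda>g. of_bool (dot R k g x = dot R k g y)) \<le> \<epsilon>\<^sup>2"
      if "x \<in> V" "y \<in> V" "x \<noteq> y" for x y
    proof -
      have "avg V (\<lambda>g. of_bool (dot R k g x = dot R k g y)) \<le> 1 / q"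
        using that unfolding V_def q_def by (intro avg_collision_le fin)
      also have "1 / q \<le> \<epsilon>\<^sup>2" using qe q2 by (simp add: field_simps)
      finally show ?thesis .
    qed
  qed
  finally show ?thesis .
qed

text \<open>Injectivity fails with probability at most 1/8 and list decodability with at most 1/4,
  which leaves 5/8. The event E is kept abstract so that it can also carry the statement on the
  rate.\<close>

lemma prob_good_code_ge_half:
  assumes fin: "finite (carrier R)" and \<epsilon>: "0 < \<epsilon>" "\<epsilon> < 1 / 2" and k: "k \<ge> 1"
    and q_def: "q = card (carrier R)" and n_def: "n = block_length 518400 k q \<epsilon>"
    and good: "avg (columns k n) (\<lambda>w. of_bool (\<not> list_decodable R n
      (linear_code R k n (matrix_of_columns k n w)) \<rho> B)) \<le> 1 / 4"
    and E: "\<And>G. code_dim R n (linear_code R k n G) = k \<Longrightarrow>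
      list_decodable R n (linear_code R k n G) \<rho> B \<Longrightarrow> G \<in> E"
  shows "measure_pmf.prob (random_matrix R k n) E \<ge> 1 / 2"
proof -
  have q2: "q \<ge> 2" using card_carrier_ge_2[OF fin] q_def by simp
  note bl = block_length_bounds[OF \<epsilon> k q2, of 518400, folded n_def]
  have "real (2 * k + 3) \<le> 2 * 518400 * real k" using k by simp
  then have "real (2 * k + 3) \<le> real n" using bl(5,6) by linarith
  then have n: "2 * k + 3 \<le> n" by (simp only: of_nat_le_iff)
  let ?inj = "\<lambda>w. inj_on (\<lambda>x. vec_mat_mult R k n x (matrix_of_columns k n w)) (vectors R k)"
  let ?ld = "\<lambda>w. list_decodable R n (linear_code R k n (matrix_of_columns k n w)) \<rho> B"
  have "1 - avg (columns k n) (\<lambda>w. of_bool (\<not> ?inj w)) - avg (columns k n) (\<lambda>w. of_bool (\<not> ?ld w))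
      \<le> avg (columns k n) (\<lambda>w. of_bool (matrix_of_columns k n w \<in> E))"
  proof (rule avg_of_bool_not_le[OF finite_columns[OF fin] columns_nonempty])
    fix w assume w: "w \<in> columns k n" and "matrix_of_columns k n w \<notin> E"
    have "matrix_of_columns k n w \<in> matrices R k n"
      using bij_betw_apply[OF bij_betw_matrix_of_columns w] .
    then show "\<not> ?inj w \<or> \<not> ?ld w"
      using code_dim_eq[OF fin] E \<open>matrix_of_columns k n w \<notin> E\<close> by blast
  qed
  moreover have "avg (columns k n) (\<lambda>w. of_bool (\<not> ?inj w)) \<le> 1 / 8"
    by (rule avg_not_injective_le[OF fin n])
  ultimately show ?thesis unfolding prob_random_matrix[OF fin] using good by linarith
qed

end

theorem mainTheorem5:
  shows "\<exists>A B p \<epsilon>\<^sub>0 c :: real. A > 0 \<and> B > 0 \<and> p > 0 \<and> \<epsilon>\<^sub>0 > 0 \<and> c > 0 \<and>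
    (\<forall>(\<epsilon>::real) (k::nat) (q::nat) (F :: nat ring) (n::nat).
      0 < \<epsilon> \<longrightarrow> \<epsilon> < 1/2 \<longrightarrow> k \<ge> 1 \<longrightarrow> primepow q \<longrightarrow>
      field F \<longrightarrow> finite (carrier F) \<longrightarrow> card (carrier F) = q \<longrightarrow>
      n = block_length B k q \<epsilon> \<longrightarrow>
        measure_pmf.prob (random_matrix F k n)
          {G. code_dim F n (linear_code F k n G) = k \<and>
              code_rate F n (linear_code F k n G) = real k / real n \<and>
              code_rate F n (linear_code F k n G) \<ge>
                c * (min \<epsilon> (real q * \<epsilon>\<^sup>2) / (log 2 (real q) * (log 2 (1 / \<epsilon>)) ^ 5)) \<and>
              list_decodable F n (linear_code F k n G)
                (1 - 1 / real q - A * \<epsilon>) (2 / \<epsilon>\<^sup>2)} \<ge> p \<and>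
        (real q > 1 / \<epsilon>\<^sup>2 \<longrightarrow> \<epsilon> \<le> \<epsilon>\<^sub>0 \<longrightarrow>
          measure_pmf.prob (random_matrix F k n)
            {G. code_dim F n (linear_code F k n G) = k \<and>
                list_decodable F n (linear_code F k n G)
                  (1 - 1 / real q - A * \<epsilon>) (1 / \<epsilon>)} \<ge> p))"
\<comment> \<open>A = 256 matches the range \<epsilon> \<le> 1/256 of the plurality bounds, B =
  518400 is 2 * 72 * 60^2, and c = 1 / (2 B) because rounding at most doubles the length.\<close>
proof (rule exI[of _ 256], rule exI[of _ 518400], rule exI[of _ "1 / 2"], rule exI[of _ 1],
    rule exI[of _ "1 / (2 * 518400)"], intro conjI allI impI)
  fix \<epsilon> :: real and k q n :: nat and F :: "nat ring"
  assume \<epsilon>: "0 < \<epsilon>" "\<epsilon> < 1/2" and k: "k \<ge> 1" and F: "field F" "finite (carrier F)"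
    and q: "card (carrier F) = q" and n: "n = block_length 518400 k q \<epsilon>"
  note field = F(1)
  have q2: "q \<ge> 2" using field.card_carrier_ge_2[OF F] q by simp
  define l where "l = log 2 (1 / \<epsilon>)"
  define m where "m = min \<epsilon> (real q * \<epsilon>\<^sup>2)"
  define v where "v = 518400 * real k * log 2 (real q) * l ^ 5 / m"
  note bl = block_length_bounds[OF \<epsilon> k q2, of 518400, folded l_def m_def v_def n]
  have rate: "1 / (2 * 518400) * (m / (log 2 (real q) * l ^ 5)) \<le> real k / real n"
  proof -
    have "0 < 2 * 518400 * real k" using k by simp
    then have pos: "v > 0" "n > 0" using bl(5,6) by (simp_all add: v_def)
    have nv: "real n \<le> 2 * v" using bl(7) by (simp add: v_def)
    have "1 / (2 * 518400) * (m / (log 2 (real q) * l ^ 5)) = real k / (2 * v)"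
      using k bl by (simp add: v_def field_simps)
    also have "\<dots> \<le> real k / real n"
      using nv pos by (intro divide_left_mono) auto
    finally show ?thesis .
  qed
  show "measure_pmf.prob (random_matrix F k n)
          {G. code_dim F n (linear_code F k n G) = k \<and>
              code_rate F n (linear_code F k n G) = real k / real n \<and>
              code_rate F n (linear_code F k n G) \<ge>
                1 / (2 * 518400) * (min \<epsilon> (real q * \<epsilon>\<^sup>2) / (log 2 (real q) * (log 2 (1 / \<epsilon>)) ^ 5)) \<and>
              list_decodable F n (linear_code F k n G)
                (1 - 1 / real q - 256 * \<epsilon>) (2 / \<epsilon>\<^sup>2)} \<ge> 1 / 2"
  proof (rule field.prob_good_code_ge_half[OF F \<epsilon> k q[symmetric] n])
    show "avg ({..<n} \<rightarrow>\<^sub>E vectors F k) (\<lambda>w. of_bool (\<not> list_decodable F n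
        (linear_code F k n (matrix_of_columns k n w)) (1 - 1 / real q - 256 * \<epsilon>) (2 / \<epsilon>\<^sup>2))) \<le> 1 / 4"
      using field.avg_not_list_decodable_le[OF F \<epsilon> k q[symmetric] n] by linarith
  qed (use rate in \<open>simp add: code_rate_def l_def m_def\<close>)
  assume large: "real q > 1 / \<epsilon>\<^sup>2"
  show "measure_pmf.prob (random_matrix F k n)
            {G. code_dim F n (linear_code F k n G) = k \<and>
                list_decodable F n (linear_code F k n G)
                  (1 - 1 / real q - 256 * \<epsilon>) (1 / \<epsilon>)} \<ge> 1 / 2"
    by (rule field.prob_good_code_ge_half[OF F \<epsilon> k q[symmetric] n
        field.avg_not_list_decodable_large_alphabet_le[OF F \<epsilon> k q[symmetric] n large]]) simp
qed simp_all

end
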